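(* Let $a\in L^\infty(\mathbb R^n,\mathbb R^n)$ with $\operatorname{div} a=0$ in $\mathcal D'(\mathbb R^n)$, and let $A$ be the closure in $L^2=L^2(\mathbb R^n)$ of the operator $A_0u=a\cdot\nabla u$, $D(A_0)=C_0^1(\mathbb R^n)$. Let $\tilde A$ be a maximal skew-symmetric extension of $A$, with deficiency indexes $d_+=\operatorname{codim}\operatorname{Im}(E+\tilde A)$ and $d_-=\operatorname{codim}\operatorname{Im}(E-\tilde A)$ (so that $d_+=0$ or $d_-=0$). Define $B=-\tilde A$ if $d_+=0$ and $B=\tilde A^*$ if $d_-=0$. Then $B$ generates a $C_0$-semigroup of contractions $T_t=e^{Bt}$, $t\ge 0$, on $L^2$ such that for every $u_0\in L^2$ the function $u(t,x)=(T_tu_0)(x)$ is a generalized solution of the Cauchy problem $u_t+\operatorname{div}_x(a(x)u)=0$, $u(0,x)=u_0(x)$. Moreover, in the case $d_+=0$ the operators $T_t$ are isometric, that is, $\|T_tu\|_2=\|u\|_2$ for all $u\in L^2$.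
   Context: $\Pi=(0,+\infty)\times\mathbb R^n$, $\bar\Pi=[0,+\infty)\times\mathbb R^n$. $L^2(\mathbb R^n)$ is the real Hilbert space, $E$ is the identity operator, $C_0^k$ denotes compactly supported $C^k$ functions (functions in $C_0^\infty(\bar\Pi)$ need not vanish at $t=0$). A function $u\in L^1_{loc}(\bar\Pi)$ is a generalized solution of the Cauchy problem with data $u_0\in L^1_{loc}(\mathbb R^n)$ if for all $f\in C_0^\infty(\bar\Pi)$ $$\int_\Pi [u f_t+u\,a\cdot\nabla_x f]\,dt\,dx+\int_{\mathbb R^n}u_0(x)f(0,x)\,dx=0.$$ A densely defined operator $S$ is skew-symmetric if $S\subset -S^*$; it is maximal skew-symmetric if it has no proper skew-symmetric extension. $A_0$ is skew-symmetric because $\operatorname{div}a=0$. One has $A\subset\tilde A\subset-\tilde A^*\subset-A^*$. If $d_+=d_-=0$, then $\tilde A$ is skew-adjoint and the two definitions of $B$ agree. *)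

theory Defs
  imports "HOL-Analysis.Analysis"
begin

section \<open>The real Hilbert space of square integrable functions\<close>

definition square_integrable :: "('a::euclidean_space \<Rightarrow> real) \<Rightarrow> bool" where
  "square_integrable f \<longleftrightarrow> f \<in> borel_measurable lebesgue \<and> integrable lebesgue (\<lambda>x. (f x)\<^sup>2)"

definition ae_equal :: "('a::euclidean_space \<Rightarrow> real) \<Rightarrow> ('a \<Rightarrow> real) \<Rightarrow> bool" where
  "ae_equal f g \<longleftrightarrow> square_integrable f \<and> square_integrable g \<and> (AE x in lebesgue. f x = g x)"

lemma ae_equalI:
  assumes "square_integrable f" and "\<And>x. f x = g x"
  shows "ae_equal f g"
proof -
  have "f = g" using assms(2) by (rule ext)
  then show ?thesis using assms(1) by (simp add: ae_equal_def)
qed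

lemma ae_equal_refl: "ae_equal f f \<longleftrightarrow> square_integrable f"
  by (simp add: ae_equal_def)

lemma square_integrable_mult:
  assumes "square_integrable f" "square_integrable g"
  shows "integrable lebesgue (\<lambda>x. f x * g x)"
proof (rule Bochner_Integration.integrable_bound)
  show "integrable lebesgue (\<lambda>x. (f x)\<^sup>2 + (g x)\<^sup>2)"
    using assms by (simp add: square_integrable_def)
  show "(\<lambda>x. f x * g x) \<in> borel_measurable lebesgue"
    using assms by (auto simp: square_integrable_def intro: borel_measurable_times)
  have "\<bar>s * t\<bar> \<le> s\<^sup>2 + t\<^sup>2" for s t :: real
  proof -
    have "2 * (\<bar>s\<bar> * \<bar>t\<bar>) \<le> s\<^sup>2 + t\<^sup>2"
      using sum_squares_bound[of "\<bar>s\<bar>" "\<bar>t\<bar>"] by (simp add: mult.assoc)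
    moreover have "0 \<le> \<bar>s\<bar> * \<bar>t\<bar>"
      by simp
    ultimately show ?thesis
      unfolding abs_mult by linarith
  qed
  then show "AE x in lebesgue. norm (f x * g x) \<le> norm ((f x)\<^sup>2 + (g x)\<^sup>2)"
    by (intro AE_I2) (simp add: order.trans[OF _ abs_ge_self])
qed

lemma square_integrable_zero: "square_integrable (\<lambda>x. 0)"
  by (simp add: square_integrable_def)

lemma square_integrable_scale:
  "square_integrable f \<Longrightarrow> square_integrable (\<lambda>x. c * f x)"
  by (auto simp: square_integrable_def power_mult_distrib
      intro: borel_measurable_times borel_measurable_const)

lemma square_integrable_add:
  assumes "square_integrable f" "square_integrable g"
  shows "square_integrable (\<lambda>x. f x + g x)"
  using assms square_integrable_mult[OF assms]
  by (auto simp: square_integrable_def power2_sum mult.assoc intro: borel_measurable_add)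

quotient_type (overloaded) 'a L2 = "'a::euclidean_space \<Rightarrow> real" / partial: ae_equal
proof (rule part_equivpI)
  show "\<exists>f::'a \<Rightarrow> real. ae_equal f f"
    using square_integrable_zero ae_equal_refl by blast
  show "symp (ae_equal :: ('a \<Rightarrow> real) \<Rightarrow> _)"
    by (simp add: symp_def ae_equal_def eq_commute)
  show "transp (ae_equal :: ('a \<Rightarrow> real) \<Rightarrow> _)"
  proof (rule transpI)
    fix f g h :: "'a \<Rightarrow> real"
    assume fg: "ae_equal f g" and gh: "ae_equal g h"
    have "AE x in lebesgue. f x = g x" "AE x in lebesgue. g x = h x"
      using fg gh by (simp_all add: ae_equal_def)
    then have "AE x in lebesgue. f x = h x"
      by eventually_elim simp
    then show "ae_equal f h"
      using fg gh by (simp add: ae_equal_def)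
  qed
qed

instantiation L2 :: (euclidean_space) real_inner
begin

lift_definition zero_L2 :: "'a L2" is "\<lambda>x. 0"
  by (simp add: ae_equal_def square_integrable_zero)

lift_definition plus_L2 :: "'a L2 \<Rightarrow> 'a L2 \<Rightarrow> 'a L2" is "\<lambda>f g x. f x + g x"
  by (auto simp: ae_equal_def intro!: square_integrable_add)

lift_definition scaleR_L2 :: "real \<Rightarrow> 'a L2 \<Rightarrow> 'a L2" is "\<lambda>c f x. c * f x"
  by (auto simp: ae_equal_def intro!: square_integrable_scale)

lift_definition inner_L2 :: "'a L2 \<Rightarrow> 'a L2 \<Rightarrow> real" is "\<lambda>f g. LINT x|lebesgue. f x * g x"
proof -
  fix f f' g g' :: "'a \<Rightarrow> real"
  assume "ae_equal f f'" "ae_equal g g'"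
  then show "(LINT x|lebesgue. f x * g x) = (LINT x|lebesgue. f' x * g' x)"
    by (intro integral_cong_AE) (auto simp: ae_equal_def square_integrable_def)
qed

definition uminus_L2 :: "'a L2 \<Rightarrow> 'a L2" where "uminus_L2 u = (- 1) *\<^sub>R u"
definition minus_L2 :: "'a L2 \<Rightarrow> 'a L2 \<Rightarrow> 'a L2" where "minus_L2 u v = u + (- v)"
definition norm_L2 :: "'a L2 \<Rightarrow> real" where "norm_L2 u = sqrt (inner u u)"
definition dist_L2 :: "'a L2 \<Rightarrow> 'a L2 \<Rightarrow> real" where "dist_L2 u v = norm (u - v)"
definition sgn_L2 :: "'a L2 \<Rightarrow> 'a L2" where "sgn_L2 u = inverse (norm u) *\<^sub>R u"
definition uniformity_L2 :: "('a L2 \<times> 'a L2) filter" where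
  "uniformity_L2 = (INF e\<in>{0 <..}. principal {(u, v). dist u v < e})"
definition open_L2 :: "'a L2 set \<Rightarrow> bool" where
  "open_L2 U \<longleftrightarrow> (\<forall>u\<in>U. eventually (\<lambda>(u', v). u' = u \<longrightarrow> v \<in> U) uniformity)"

instance
proof
  fix u v w :: "'a L2" and r s :: real and U :: "'a L2 set"
  note [simp] = ae_equal_refl
  show "u + v + w = u + (v + w)"
    by transfer (rule ae_equalI; simp add: square_integrable_add)
  show "u + v = v + u"
    by transfer (rule ae_equalI; simp add: square_integrable_add)
  show "0 + u = u"
    by transfer (rule ae_equalI; simp)
  show "- u + u = 0"
    unfolding uminus_L2_def by transfer (simp add: square_integrable_zero)
  show "u - v = u + - v"
    by (simp add: minus_L2_def)
  show "r *\<^sub>R (u + v) = r *\<^sub>R u + r *\<^sub>R v"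
    by transfer
      (rule ae_equalI; simp add: distrib_left square_integrable_add square_integrable_scale)
  show "(r + s) *\<^sub>R u = r *\<^sub>R u + s *\<^sub>R u"
    by transfer (rule ae_equalI; simp add: distrib_right square_integrable_scale
        square_integrable_add)
  show "r *\<^sub>R s *\<^sub>R u = (r * s) *\<^sub>R u"
    by transfer (rule ae_equalI; simp add: square_integrable_scale)
  show "1 *\<^sub>R u = u"
    by transfer simp
  show "inner u v = inner v u"
    by transfer (simp add: mult.commute)
  show "inner (u + v) w = inner u w + inner v w"
    by transfer (simp add: distrib_right square_integrable_mult)
  show "inner (r *\<^sub>R u) v = r * inner u v"
    by transfer (simp add: mult.assoc)
  show "0 \<le> inner u u"
    by transfer simp
  show "inner u u = 0 \<longleftrightarrow> u = 0"
  proof transfer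
    fix f :: "'a \<Rightarrow> real"
    assume "ae_equal f f"
    then have f: "square_integrable f"
      by (simp add: ae_equal_def)
    have "(LINT x|lebesgue. f x * f x) = 0 \<longleftrightarrow> (AE x in lebesgue. f x * f x = 0)"
      using square_integrable_mult[OF f f] by (intro integral_nonneg_eq_0_iff_AE) auto
    then show "(LINT x|lebesgue. f x * f x) = 0 \<longleftrightarrow> ae_equal f (\<lambda>x. 0)"
      using f by (simp add: ae_equal_def square_integrable_zero)
  qed
  show "norm u = sqrt (inner u u)" "dist u v = norm (u - v)" "sgn u = inverse (norm u) *\<^sub>R u"
    by (simp_all add: norm_L2_def dist_L2_def sgn_L2_def)
  show "uniformity = (INF e\<in>{0 <..}. principal {(u::'a L2, v). dist u v < e})"
    by (rule uniformity_L2_def)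
  show "open U \<longleftrightarrow> (\<forall>u\<in>U. \<forall>\<^sub>F (u', v) in uniformity. u' = u \<longrightarrow> v \<in> U)"
    by (rule open_L2_def)
qed

end

section \<open>Unbounded operators in a real inner product space\<close>

text \<open>An operator is represented by its graph, so that extension of operators is inclusion and
  the closure of a closable operator is the topological closure of its graph.\<close>

type_synonym 'h op = "('h \<times> 'h) set"

definition is_operator :: "'h::real_inner op \<Rightarrow> bool" where
  "is_operator S \<longleftrightarrow> subspace S \<and> single_valued S"

definition densely_defined :: "'h::real_inner op \<Rightarrow> bool" where
  "densely_defined S \<longleftrightarrow> closure (Domain S) = UNIV"

definition op_uminus :: "'h::real_inner op \<Rightarrow> 'h op" where
  "op_uminus S = {(u, - v) | u v. (u, v) \<in> S}"

definition op_add :: "'h::real_inner op \<Rightarrow> 'h op \<Rightarrow> 'h op" where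
  "op_add S S' = {(u, v + w) | u v w. (u, v) \<in> S \<and> (u, w) \<in> S'}"

text \<open>The adjoint is an operator (single-valued) when \<open>S\<close> is densely defined.\<close>

definition op_adjoint :: "'h::real_inner op \<Rightarrow> 'h op" where
  "op_adjoint S = {(v, w). \<forall>(u, y)\<in>S. inner y v = inner u w}"

definition skew_symmetric :: "'h::real_inner op \<Rightarrow> bool" where
  "skew_symmetric S \<longleftrightarrow>
     is_operator S \<and> densely_defined S \<and> S \<subseteq> op_uminus (op_adjoint S)"

definition maximal_skew_symmetric :: "'h::real_inner op \<Rightarrow> bool" where
  "maximal_skew_symmetric S \<longleftrightarrow>
     skew_symmetric S \<and> (\<forall>S'. skew_symmetric S' \<and> S \<subseteq> S' \<longrightarrow> S' = S)"

text \<open>Algebraic codimension, i.e. the dimension of the quotient by \<open>V\<close>; all infinite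
  cardinals are identified with \<open>\<infinity>\<close>.\<close>

definition codim :: "'h::real_vector set \<Rightarrow> enat" where
  "codim V = (INF B\<in>{B. span (V \<union> B) = UNIV}. if finite B then enat (card B) else \<infinity>)"

definition deficiency_plus :: "'h::real_inner op \<Rightarrow> enat" where
  "deficiency_plus S = codim (Range (op_add Id S))"

definition deficiency_minus :: "'h::real_inner op \<Rightarrow> enat" where
  "deficiency_minus S = codim (Range (op_add Id (op_uminus S)))"

text \<open>A semigroup is given by a function on all of \<open>\<real>\<close>, of which only the values at
  \<open>t \<ge> 0\<close> matter.\<close>

definition C0_contraction_semigroup :: "(real \<Rightarrow> 'h::real_inner \<Rightarrow> 'h) \<Rightarrow> bool" where
  "C0_contraction_semigroup T \<longleftrightarrow>
     (\<forall>t\<ge>0. bounded_linear (T t) \<and> (\<forall>u. norm (T t u) \<le> norm u)) \<and>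
     (\<forall>u. T 0 u = u) \<and>
     (\<forall>s\<ge>0. \<forall>t\<ge>0. \<forall>u. T (s + t) u = T s (T t u)) \<and>
     (\<forall>u. ((\<lambda>t. T t u) \<longlongrightarrow> u) (at_right 0))"

definition semigroup_generator :: "(real \<Rightarrow> 'h::real_inner \<Rightarrow> 'h) \<Rightarrow> 'h op" where
  "semigroup_generator T =
     {(u, v). ((\<lambda>h. (T h u - u) /\<^sub>R h) \<longlongrightarrow> v) (at_right 0)}"

section \<open>Test functions\<close>

text \<open>The set \<open>S\<close> will be either the whole space or a closed half-space; on these sets the
  derivative within \<open>S\<close> is unique (at boundary points it is one-sided in the normal direction), and values of \<open>f\<close> outside
  \<open>S\<close> are irrelevant.\<close>

primrec Ck_on :: "nat \<Rightarrow> 'a::euclidean_space set \<Rightarrow> ('a \<Rightarrow> real) \<Rightarrow> bool" where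
  "Ck_on 0 S f \<longleftrightarrow> continuous_on S f"
| "Ck_on (Suc k) S f \<longleftrightarrow>
     (\<exists>f'. (\<forall>x\<in>S. (f has_derivative f' x) (at x within S)) \<and> (\<forall>v. Ck_on k S (\<lambda>x. f' x v)))"

definition compactly_supported_on :: "'a::euclidean_space set \<Rightarrow> ('a \<Rightarrow> real) \<Rightarrow> bool" where
  "compactly_supported_on S f \<longleftrightarrow>
     compact (closure (support_on S f)) \<and> closure (support_on S f) \<subseteq> S"

definition Ck_compact_on :: "nat \<Rightarrow> 'a::euclidean_space set \<Rightarrow> ('a \<Rightarrow> real) \<Rightarrow> bool" where
  "Ck_compact_on k S f \<longleftrightarrow> Ck_on k S f \<and> compactly_supported_on S f"

definition Cinf_compact_on :: "'a::euclidean_space set \<Rightarrow> ('a \<Rightarrow> real) \<Rightarrow> bool" where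
  "Cinf_compact_on S f \<longleftrightarrow> (\<forall>k. Ck_on k S f) \<and> compactly_supported_on S f"

definition grad :: "('a::euclidean_space \<Rightarrow> real) \<Rightarrow> 'a \<Rightarrow> 'a" where
  "grad f x = (\<Sum>b\<in>Basis. frechet_derivative f (at x) b *\<^sub>R b)"

section \<open>The transport equation\<close>

definition Linf_field :: "('a::euclidean_space \<Rightarrow> 'a) \<Rightarrow> bool" where
  "Linf_field a \<longleftrightarrow>
     a \<in> borel_measurable lebesgue \<and> (\<exists>C. AE x in lebesgue. norm (a x) \<le> C)"

definition divergence_free :: "('a::euclidean_space \<Rightarrow> 'a) \<Rightarrow> bool" where
  "divergence_free a \<longleftrightarrow>
     (\<forall>\<phi>. Cinf_compact_on UNIV \<phi> \<longrightarrow> (LINT x|lebesgue. inner (a x) (grad \<phi> x)) = 0)"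

definition A0 :: "('a::euclidean_space \<Rightarrow> 'a) \<Rightarrow> 'a L2 op" where
  "A0 a = {(abs_L2 \<phi>, abs_L2 (\<lambda>x. inner (a x) (grad \<phi> x))) | \<phi>. Ck_compact_on 1 UNIV \<phi>}"

definition L1_loc :: "'a::euclidean_space set \<Rightarrow> ('a \<Rightarrow> real) \<Rightarrow> bool" where
  "L1_loc S f \<longleftrightarrow> (\<forall>K. compact K \<and> K \<subseteq> S \<longrightarrow> set_integrable lebesgue K f)"

definition open_half_space :: "(real \<times> 'a::euclidean_space) set" where
  "open_half_space = {0<..} \<times> UNIV"

definition closed_half_space :: "(real \<times> 'a::euclidean_space) set" where
  "closed_half_space = {0..} \<times> UNIV"

definition generalized_solution ::
    "('a::euclidean_space \<Rightarrow> 'a) \<Rightarrow> ('a \<Rightarrow> real) \<Rightarrow> (real \<times> 'a \<Rightarrow> real) \<Rightarrow> bool" where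
  "generalized_solution a u0 u \<longleftrightarrow>
     L1_loc UNIV u0 \<and> L1_loc closed_half_space u \<and>
     (\<forall>f. Cinf_compact_on closed_half_space f \<longrightarrow>
        (LINT (t, x):open_half_space|lebesgue.
            u (t, x) * deriv (\<lambda>s. f (s, x)) t + u (t, x) * inner (a x) (grad (\<lambda>y. f (t, y)) x))
        + (LINT x|lebesgue. u0 x * f (0, x)) = 0)"

text \<open>The values of a curve \<open>U\<close> in \<open>L2\<close> are functions modulo null sets, so reading
  \<open>U\<close> as a function of \<open>(t, x)\<close> involves a choice of a jointly measurable representative.\<close>

definition represents_curve ::
    "(real \<times> 'a::euclidean_space \<Rightarrow> real) \<Rightarrow> (real \<Rightarrow> 'a L2) \<Rightarrow> bool" where
  "represents_curve u U \<longleftrightarrow>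
     u \<in> borel_measurable (lebesgue_on closed_half_space) \<and>
     (\<forall>t\<ge>0. AE x in lebesgue. u (t, x) = rep_L2 (U t) x)"

end

theory Submission
  imports Defs
begin

text \<open>
  Let \<open>S\<close> be the maximal skew-symmetric extension. Since \<open>\<langle>u, S u\<rangle> = 0\<close>, one has
  \<open>\<parallel>u \<plusminus> S u\<parallel>\<^sup>2 = \<parallel>u\<parallel>\<^sup>2 + \<parallel>S u\<parallel>\<^sup>2\<close>, so for the closed operator \<open>S\<close> the ranges of \<open>E \<plusminus> S\<close> are
  closed. If both were proper, unit vectors \<open>w\<^sub>1\<close>, \<open>w\<^sub>2\<close> orthogonal to them would allow the Cayley
  transform, and with it \<open>S\<close>, to be extended, against maximality (\<open>maximal_skew_symmetric_range\<close>).
  Hence \<open>- S\<close> or \<open>S\<close> is m-dissipative: it is dissipative and \<open>E\<close> minus it is onto. The adjoint of an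
  m-dissipative operator is m-dissipative too (\<open>m_dissipative_adjoint\<close>), so in either case the
  operator \<open>B\<close> is m-dissipative, and \<open>B \<subseteq> S\<^sup>*\<close> (\<open>skew_symmetric_generator\<close>).

  An m-dissipative \<open>M\<close> generates a contraction semigroup. Here the semigroup is obtained as the limit
  of the backward Euler scheme \<open>(E - h M)\<^sup>-\<^sup>k u\<close>, \<open>k h \<approx> t\<close>, along the step sizes \<open>h = 2\<^sup>-\<^sup>n\<close>. Halving
  the step changes a single step only by \<open>O(h\<^sup>2)\<close> when \<open>u\<close> is in the domain of \<open>M\<^sup>2\<close>, and contractions
  do not amplify errors, so the approximations form a Cauchy sequence on a dense set and then
  everywhere (\<open>euler_convergent\<close>). The semigroup law, strong continuity and the derivative at \<open>0\<close>
  are inherited from elementary discrete estimates. The generator is a dissipative extension of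
  \<open>M\<close>, hence equal to \<open>M\<close>, as an m-dissipative operator has no proper dissipative extension. If
  \<open>\<langle>u, M u\<rangle> = 0\<close>, a step loses only \<open>O(h\<^sup>2)\<close> of the squared norm, and the limit is isometric
  (\<open>semigroup_isometric\<close>).

  For the equation, let \<open>F t = f(t, \<cdot>)\<close> for a test function \<open>f\<close>. It is a differentiable curve in \<open>L\<^sup>2\<close>
  with values in the domain of \<open>A\<^sub>0 \<subseteq> S\<close>, and \<open>B \<subseteq> S\<^sup>*\<close> gives
  \<open>d/dt \<langle>T\<^sub>t u\<^sub>0, F t\<rangle> = \<langle>T\<^sub>t u\<^sub>0, F' t + S (F t)\<rangle>\<close> for \<open>u\<^sub>0\<close> in the domain of \<open>B\<close>. Integration in \<open>t\<close>,
  extended to all \<open>u\<^sub>0\<close> by density (\<open>weak_formulation\<close>), is the defining identity of a generalized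
  solution once the inner products are written as integrals over \<open>x\<close> and combined by Fubini's
  theorem (\<open>generalized_solution_orbit\<close>). A jointly measurable representative of \<open>t \<mapsto> T\<^sub>t u\<^sub>0\<close> exists
  because the orbit is uniformly continuous (\<open>represents_curve_exists\<close>).
\<close>

section \<open>Orthogonality in Hilbert spaces\<close>

lemma norm_minimizer_orthogonal:
  fixes w :: "'h::real_inner"
  assumes V: "subspace V" and min: "\<And>v. v \<in> V \<Longrightarrow> norm w \<le> norm (w - v)" and v: "v \<in> V"
  shows "inner v w = 0"
proof (cases "v = 0")
  case False
  define c where "c = inner v w / inner v v"
  have vv: "inner v v > 0" using False by simp
  have "norm w \<le> norm (w - c *\<^sub>R v)" using min V v by (simp add: subspace_scale)
  then have "(norm w)\<^sup>2 \<le> (norm (w - c *\<^sub>R v))\<^sup>2" by (simp add: power_mono)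
  also have "\<dots> = (norm w)\<^sup>2 - 2 * c * inner v w + c\<^sup>2 * inner v v"
    unfolding power2_norm_eq_inner
    by (simp add: inner_diff_left inner_diff_right inner_commute power2_eq_square algebra_simps)
  also have "\<dots> = (norm w)\<^sup>2 - (inner v w)\<^sup>2 / inner v v"
    using vv by (simp add: c_def power2_eq_square field_simps)
  finally have "(inner v w)\<^sup>2 \<le> 0" using vv by (simp add: field_simps)
  then show ?thesis by simp
qed simp

text \<open>A minimizing sequence for the distance to \<open>V\<close> is Cauchy by the parallelogram law.\<close>

lemma exists_orthogonal_vector:
  fixes V :: "'h::{real_inner,banach} set"
  assumes V: "subspace V" "closed V" and "V \<noteq> UNIV"
  obtains w where "w \<noteq> 0" "\<And>v. v \<in> V \<Longrightarrow> inner v w = 0"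
proof -
  obtain x where x: "x \<notin> V" using assms by auto
  have ne: "V \<noteq> {}" using V(1) subspace_0 by blast
  define d where "d = infdist x V"
  have d_le: "d \<le> norm (x - v)" if "v \<in> V" for v
    using infdist_le[OF that, of x] by (simp add: d_def dist_norm)
  have d0: "d \<ge> 0" by (simp add: d_def infdist_nonneg)
  have "\<exists>v\<in>V. norm (x - v) < d + 1 / Suc n" for n
  proof -
    have "infdist x V < d + 1 / Suc n" by (simp add: d_def)
    then show ?thesis
      using infdist_notempty[OF ne, of x] cINF_less_iff[OF ne bdd_belowI2[where m = 0 and f = "dist x"]]
      by (auto simp: dist_norm)
  qed
  then obtain v where v: "\<And>n. v n \<in> V" "\<And>n. norm (x - v n) < d + 1 / Suc n" by metis
  have close: "(norm (v m - v n))\<^sup>2 \<le> 8 * (d + 1) / Suc N" if "N \<le> m" "N \<le> n" for m n N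
  proof -
    let ?e = "1 / real (Suc N)"
    have e: "0 \<le> ?e" "?e \<le> 1" by simp_all
    have b: "norm (x - v k) \<le> d + ?e" if "N \<le> k" for k
    proof -
      have "1 / real (Suc k) \<le> ?e" using that by (simp add: field_simps)
      then show ?thesis using v(2)[of k] by linarith
    qed
    have mid: "(1/2) *\<^sub>R (v m + v n) \<in> V"
      using v V(1) by (simp add: subspace_scale subspace_add)
    have par: "(norm (p - q))\<^sup>2 = 2 * (norm p)\<^sup>2 + 2 * (norm q)\<^sup>2 - (norm (p + q))\<^sup>2" for p q :: 'h
      by (simp add: power2_norm_eq_inner inner_diff_left inner_diff_right inner_add_left
          inner_add_right inner_commute)
    have s: "(x - v n) + (x - v m) = 2 *\<^sub>R (x - (1/2) *\<^sub>R (v m + v n))"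
      by (simp add: algebra_simps scaleR_2)
    have "2 * d \<le> norm ((x - v n) + (x - v m))"
      unfolding s using d_le[OF mid] by simp
    then have "4 * d\<^sup>2 \<le> (norm ((x - v n) + (x - v m)))\<^sup>2"
      using power_mono[of "2 * d" _ 2] d0 by (simp add: power_mult_distrib)
    moreover have "(norm (x - v k))\<^sup>2 \<le> (d + ?e)\<^sup>2" if "N \<le> k" for k
      using b[OF that] by (simp add: power_mono)
    ultimately have "(norm ((x - v n) - (x - v m)))\<^sup>2 \<le> 4 * (d + ?e)\<^sup>2 - 4 * d\<^sup>2"
      unfolding par[of "x - v n" "x - v m"] using that by (smt (verit, best))
    also have "\<dots> = 4 * ?e * (2 * d + ?e)" by (simp add: power2_eq_square algebra_simps)
    also have "\<dots> \<le> 4 * ?e * (2 * d + 2)"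
      by (rule mult_left_mono) (use e in linarith)+
    finally show ?thesis by (simp add: algebra_simps)
  qed
  have "Cauchy v"
  proof (rule CauchyI)
    fix e :: real assume e: "0 < e"
    obtain N where N: "8 * (d + 1) / e\<^sup>2 < real (Suc N)"
      using reals_Archimedean2 less_trans of_nat_less_iff lessI by metis
    have "norm (v m - v n) < e" if "m \<ge> N" "n \<ge> N" for m n
    proof -
      have "(norm (v m - v n))\<^sup>2 \<le> 8 * (d + 1) / Suc N" using close that by blast
      also have "\<dots> < e\<^sup>2" using N e by (simp add: field_simps)
      finally show ?thesis using e by (simp add: power2_less_imp_less)
    qed
    then show "\<exists>M. \<forall>m\<ge>M. \<forall>n\<ge>M. norm (v m - v n) < e" by blast
  qed
  then obtain p where p: "v \<longlonglongrightarrow> p" using Cauchy_convergent convergent_def by blast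
  have pV: "p \<in> V" using closed_sequentially[OF V(2)] v(1) p by blast
  have "(\<lambda>n. norm (x - v n)) \<longlonglongrightarrow> norm (x - p)" by (intro tendsto_intros p)
  moreover have "(\<lambda>n. d + 1 / real (Suc n)) \<longlonglongrightarrow> d + 0"
    by (intro tendsto_intros LIMSEQ_Suc[OF lim_1_over_n])
  ultimately have le: "norm (x - p) \<le> d"
    using v(2) by (intro LIMSEQ_le[of "\<lambda>n. norm (x - v n)" _ "\<lambda>n. d + 1 / real (Suc n)"])
      (auto intro: less_imp_le)
  have "inner u (x - p) = 0" if "u \<in> V" for u
  proof (rule norm_minimizer_orthogonal[OF V(1) _ that])
    fix u' assume "u' \<in> V"
    then have "d \<le> norm (x - (p + u'))" using pV V(1) by (intro d_le) (simp add: subspace_add)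
    then show "norm (x - p) \<le> norm (x - p - u')" using le by (simp add: algebra_simps)
  qed
  moreover have "x - p \<noteq> 0" using pV x by auto
  ultimately show ?thesis using that by blast
qed

lemma subspace_closure:
  fixes V :: "'h::real_normed_vector set"
  assumes V: "subspace V"
  shows "subspace (closure V)"
proof (rule subspaceI)
  show "0 \<in> closure V" using subspace_0[OF V] closure_subset by blast
next
  fix x y assume "x \<in> closure V" "y \<in> closure V"
  then obtain f g where "\<And>n. f n \<in> V" "f \<longlonglongrightarrow> x" "\<And>n. g n \<in> V" "g \<longlonglongrightarrow> y"
    unfolding closure_sequential by blast
  then show "x + y \<in> closure V"
    unfolding closure_sequential using V
    by (intro exI[of _ "\<lambda>n. f n + g n"]) (auto intro: tendsto_add subspace_add)
next
  fix x and c :: real assume "x \<in> closure V"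
  then obtain f where "\<And>n. f n \<in> V" "f \<longlonglongrightarrow> x" unfolding closure_sequential by blast
  then show "c *\<^sub>R x \<in> closure V"
    unfolding closure_sequential using V
    by (intro exI[of _ "\<lambda>n. c *\<^sub>R f n"]) (auto intro!: tendsto_intros simp: subspace_scale)
qed

lemma dense_subspace_if_orthogonal_trivial:
  fixes V :: "'h::{real_inner,banach} set"
  assumes "subspace V" and "\<And>w. (\<And>v. v \<in> V \<Longrightarrow> inner v w = 0) \<Longrightarrow> w = 0"
  shows "closure V = UNIV"
proof (rule ccontr)
  assume "closure V \<noteq> UNIV"
  then obtain w where "w \<noteq> 0" "\<And>v. v \<in> closure V \<Longrightarrow> inner v w = 0"
    using exists_orthogonal_vector[OF subspace_closure[OF assms(1)] closed_closure] by metis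
  then show False using assms(2)[of w] closure_subset by blast
qed

text \<open>A vector orthogonal to the kernel represents the functional up to a factor.\<close>

lemma riesz_representation:
  fixes f :: "'h::{real_inner,banach} \<Rightarrow> real"
  assumes "bounded_linear f"
  obtains z where "\<And>x. f x = inner x z"
proof (cases "\<forall>x. f x = 0")
  case True
  then show ?thesis using that[of 0] by simp
next
  case False
  interpret bounded_linear f by fact
  have lin: "linear f" by (rule linear_axioms)
  have "closed (f -` {0})"
    by (intro continuous_closed_vimage closed_singleton)
      (simp add: linear_continuous_at assms)
  then obtain w where w: "w \<noteq> 0" "\<And>v. f v = 0 \<Longrightarrow> inner v w = 0"
    using exists_orthogonal_vector[of "f -` {0}"] False linear_subspace_vimage[OF lin subspace_single_0]
    by (metis (mono_tags, lifting) UNIV_I vimage_singleton_eq)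
  have fw: "f w \<noteq> 0" using w by (metis inner_eq_zero_iff)
  have "f x = inner x ((f w / inner w w) *\<^sub>R w)" for x
  proof -
    have "f (x - (f x / f w) *\<^sub>R w) = 0" using fw by (simp add: diff scaleR)
    then have "inner x w = f x / f w * inner w w"
      using w(2)[of "x - (f x / f w) *\<^sub>R w"] by (simp add: inner_diff_left)
    then show ?thesis using fw w by (simp add: field_simps)
  qed
  then show ?thesis using that by blast
qed

section \<open>Resolvents of m-dissipative operators\<close>

definition dissipative :: "'h::real_inner op \<Rightarrow> bool" where
  "dissipative M \<longleftrightarrow> is_operator M \<and> (\<forall>(u, v)\<in>M. inner u v \<le> 0)"

definition m_dissipative :: "'h::real_inner op \<Rightarrow> bool" where
  "m_dissipative M \<longleftrightarrow> dissipative M \<and> (\<forall>f. \<exists>u v. (u, v) \<in> M \<and> u - v = f)"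

text \<open>The value at \<open>f\<close> of the inverse of \<open>E - h M\<close>, i.e. the backward Euler step of size \<open>h\<close>
  for \<open>u' = M u\<close>.\<close>

definition resolvent :: "'h::real_inner op \<Rightarrow> real \<Rightarrow> 'h \<Rightarrow> 'h" where
  "resolvent M h f = (THE u. \<exists>v. (u, v) \<in> M \<and> u - h *\<^sub>R v = f)"

lemma op_diff: "subspace M \<Longrightarrow> (u, v) \<in> M \<Longrightarrow> (u', v') \<in> M \<Longrightarrow> (u - u', v - v') \<in> M"
  using subspace_diff[of M "(u, v)" "(u', v')"] by simp

lemma op_add_mem: "subspace M \<Longrightarrow> (u, v) \<in> M \<Longrightarrow> (u', v') \<in> M \<Longrightarrow> (u + u', v + v') \<in> M"
  using subspace_add[of M "(u, v)" "(u', v')"] by simp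

lemma op_scale: "subspace M \<Longrightarrow> (u, v) \<in> M \<Longrightarrow> (c *\<^sub>R u, c *\<^sub>R v) \<in> M"
  using subspace_scale[of M "(u, v)" c] by simp

lemma subspace_Domain: "subspace M \<Longrightarrow> subspace (Domain (M :: 'h::real_inner op))"
  using linear_subspace_image[OF linear_fst, of M] by (simp add: fst_eq_Domain)

lemma dissipative_norm_le:
  assumes "dissipative M" "(u, v) \<in> M" "h \<ge> 0"
  shows "norm u \<le> norm (u - h *\<^sub>R v)"
proof -
  have "inner u v \<le> 0" using assms by (auto simp: dissipative_def)
  then have "h * inner u v \<le> 0" using assms(3) by (simp add: mult_nonneg_nonpos)
  moreover have "(norm (u - h *\<^sub>R v))\<^sup>2 = (norm u)\<^sup>2 - 2 * (h * inner u v) + h\<^sup>2 * inner v v"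
    unfolding power2_norm_eq_inner
    by (simp add: inner_diff_left inner_diff_right inner_commute[of v u] power2_eq_square algebra_simps)
  moreover have "h\<^sup>2 * inner v v \<ge> 0" by simp
  ultimately have "(norm u)\<^sup>2 \<le> (norm (u - h *\<^sub>R v))\<^sup>2" by linarith
  then show ?thesis by (rule power2_le_imp_le) simp
qed

text \<open>If \<open>E - c M\<close> is onto and \<open>2 h > c\<close>, then \<open>u - h M u = f\<close> is a fixed point equation for a
  strict contraction; iterating, the step can be made as small as desired.\<close>

lemma range_resolvent_step:
  fixes M :: "'h::{real_inner,banach} op"
  assumes M: "dissipative M" and c: "c > 0" "h > c / 2" "h \<le> c"
    and surj: "\<And>f. \<exists>u v. (u, v) \<in> M \<and> u - c *\<^sub>R v = f"
  shows "\<exists>u v. (u, v) \<in> M \<and> u - h *\<^sub>R v = f"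
proof -
  have sub: "subspace M" using M by (simp add: dissipative_def is_operator_def)
  from surj obtain R V where R: "\<And>f. (R f, V f) \<in> M" "\<And>f. R f - c *\<^sub>R V f = f" by metis
  have Rlip: "norm (R f - R g) \<le> norm (f - g)" for f g
  proof -
    have "norm (R f - R g) \<le> norm ((R f - R g) - c *\<^sub>R (V f - V g))"
      using c by (intro dissipative_norm_le[OF M] op_diff[OF sub] R) simp
    also have "(R f - R g) - c *\<^sub>R (V f - V g) = (R f - c *\<^sub>R V f) - (R g - c *\<^sub>R V g)"
      by (simp add: algebra_simps)
    also have "\<dots> = f - g" by (simp add: R)
    finally show ?thesis .
  qed
  \<comment> \<open>The factor \<open>k - 1\<close> of the contraction is below one exactly because \<open>2 h > c\<close>.\<close>
  define k where "k = c / h"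
  have h: "h > 0" and k: "1 \<le> k" "k < 2" using c by (auto simp: k_def field_simps)
  let ?P = "\<lambda>u. R (k *\<^sub>R f + (1 - k) *\<^sub>R u)"
  have "\<exists>!u. ?P u = u"
  proof (rule banach_fix_type[of "k - 1"])
    show "\<forall>x y. dist (?P x) (?P y) \<le> (k - 1) * dist x y"
    proof (intro allI)
      fix x y
      have "dist (?P x) (?P y) \<le> norm ((1 - k) *\<^sub>R (x - y))"
        unfolding dist_norm by (rule order.trans[OF Rlip]) (simp add: algebra_simps)
      then show "dist (?P x) (?P y) \<le> (k - 1) * dist x y" using k by (simp add: dist_norm)
    qed
  qed (use k in auto)
  then obtain u where u: "?P u = u" by blast
  define g where "g = k *\<^sub>R f + (1 - k) *\<^sub>R u"
  have "(u, V g) \<in> M" using R(1)[of g] u by (simp add: g_def)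
  moreover have "u - c *\<^sub>R V g = g" using R(2)[of g] u by (simp add: g_def)
  then have "c *\<^sub>R V g = k *\<^sub>R (u - f)" by (simp add: g_def algebra_simps)
  then have "(h / c) *\<^sub>R (c *\<^sub>R V g) = (h / c) *\<^sub>R (k *\<^sub>R (u - f))" by simp
  then have "h *\<^sub>R V g = u - f" using c h by (simp add: k_def)
  then have "u - h *\<^sub>R V g = f" by simp
  ultimately show ?thesis by blast
qed

definition step :: "nat \<Rightarrow> real" where "step n = (1/2) ^ n"

lemma step_pos: "step n > 0" and step_nonneg: "step n \<ge> 0" and step_Suc: "step (Suc n) = step n / 2"
  by (simp_all add: step_def)

lemma step_tendsto_0: "step \<longlonglongrightarrow> 0"
  unfolding step_def by (rule LIMSEQ_realpow_zero) auto

locale m_dissipative_op =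
  fixes M :: "'h::{real_inner,banach} op"
  assumes m_dissipative: "m_dissipative M"
begin

lemma sub: "subspace M" and diss: "dissipative M"
  using m_dissipative by (auto simp: m_dissipative_def dissipative_def is_operator_def)

lemma single_valued: "(u, v) \<in> M \<Longrightarrow> (u, v') \<in> M \<Longrightarrow> v = v'"
  using diss by (auto simp: dissipative_def is_operator_def dest: single_valuedD)

lemma inner_le_0: "(u, v) \<in> M \<Longrightarrow> inner u v \<le> 0"
  using diss by (auto simp: dissipative_def)

lemma range_step: "\<exists>u v. (u, v) \<in> M \<and> u - step n *\<^sub>R v = f"
proof (induction n arbitrary: f)
  case 0
  then show ?case using m_dissipative by (simp add: m_dissipative_def step_def)
next
  case (Suc n)
  \<comment> \<open>The halved step is just out of reach, hence the detour through three quarters.\<close>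
  have mid: "\<exists>u v. (u, v) \<in> M \<and> u - (3/4 * step n) *\<^sub>R v = f" for f
    by (rule range_resolvent_step[OF diss, of "step n"]) (use step_pos[of n] Suc in auto)
  show ?case
    by (rule range_resolvent_step[OF diss, of "3/4 * step n"])
      (use step_pos[of n] mid in \<open>auto simp: step_Suc\<close>)
qed

abbreviation J :: "nat \<Rightarrow> 'h \<Rightarrow> 'h" where "J n \<equiv> resolvent M (step n)"

lemma J_eqI:
  assumes "(u, v) \<in> M" "u - step n *\<^sub>R v = f"
  shows "J n f = u"
  unfolding resolvent_def
proof (rule the_equality)
  show "\<exists>v. (u, v) \<in> M \<and> u - step n *\<^sub>R v = f" using assms by blast
  fix u' assume "\<exists>v. (u', v) \<in> M \<and> u' - step n *\<^sub>R v = f"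
  then obtain v' where v': "(u', v') \<in> M" "u' - step n *\<^sub>R v' = f" by blast
  have "norm (u' - u) \<le> norm ((u' - u) - step n *\<^sub>R (v' - v))"
    by (intro dissipative_norm_le[OF diss] op_diff[OF sub] v' assms step_nonneg)
  also have "(u' - u) - step n *\<^sub>R (v' - v) = (u' - step n *\<^sub>R v') - (u - step n *\<^sub>R v)"
    by (simp add: algebra_simps)
  finally show "u' = u" using v' assms by simp
qed

lemma J_mem: obtains v where "(J n f, v) \<in> M" "J n f - step n *\<^sub>R v = f"
  using range_step[of n f] J_eqI by metis

lemma J_linear: "linear (J n)"
proof (rule linearI)
  fix f g and c :: real
  obtain v where v: "(J n f, v) \<in> M" "J n f - step n *\<^sub>R v = f" by (rule J_mem)
  obtain w where w: "(J n g, w) \<in> M" "J n g - step n *\<^sub>R w = g" by (rule J_mem)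
  have "(J n f + J n g) - step n *\<^sub>R (v + w) = (J n f - step n *\<^sub>R v) + (J n g - step n *\<^sub>R w)"
    by (simp add: algebra_simps)
  then show "J n (f + g) = J n f + J n g"
    by (intro J_eqI[OF op_add_mem[OF sub v(1) w(1)]]) (simp add: v w)
  have "c *\<^sub>R J n f - step n *\<^sub>R (c *\<^sub>R v) = c *\<^sub>R (J n f - step n *\<^sub>R v)"
    by (simp add: algebra_simps)
  then show "J n (c *\<^sub>R f) = c *\<^sub>R J n f"
    by (intro J_eqI[OF op_scale[OF sub v(1)]]) (simp add: v)
qed

lemma J_norm: "norm (J n f) \<le> norm f"
proof -
  obtain v where v: "(J n f, v) \<in> M" "J n f - step n *\<^sub>R v = f" by (rule J_mem)
  show ?thesis using dissipative_norm_le[OF diss v(1) step_nonneg[of n]] v(2) by simp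
qed

lemma J_on_domain:
  assumes "(u, v) \<in> M"
  shows "(J n u, J n v) \<in> M" "J n u = u + step n *\<^sub>R J n v"
proof -
  interpret linear "J n" by (rule J_linear)
  obtain w where w: "(J n u, w) \<in> M" "J n u - step n *\<^sub>R w = u" by (rule J_mem)
  have "J n (u - step n *\<^sub>R v) = u" by (rule J_eqI[OF assms refl])
  then show eq: "J n u = u + step n *\<^sub>R J n v" by (simp add: diff scale algebra_simps)
  have "step n *\<^sub>R w = J n u - u" using w(2) by (metis add_diff_cancel_left' diff_add_cancel)
  then have "step n *\<^sub>R w = step n *\<^sub>R J n v" using eq by (metis add_diff_cancel_left')
  then have "w = J n v" using step_pos[of n] by (metis less_irrefl scaleR_cancel_left)
  then show "(J n u, J n v) \<in> M" using w by simp
qed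

definition Jk :: "nat \<Rightarrow> nat \<Rightarrow> 'h \<Rightarrow> 'h" where "Jk n k = (J n ^^ k)"

lemma Jk_0 [simp]: "Jk n 0 u = u" and Jk_Suc: "Jk n (Suc k) u = J n (Jk n k u)"
  and Jk_add: "Jk n (k + l) u = Jk n k (Jk n l u)"
  by (simp_all add: Jk_def funpow_add)

lemma Jk_linear: "linear (Jk n k)"
proof (induction k)
  case 0
  then show ?case by (simp add: Jk_def linear_id[unfolded id_def] id_def)
next
  case (Suc k)
  then show ?case using linear_compose[OF Suc J_linear[of n]] by (simp add: Jk_def o_def)
qed

lemma Jk_norm: "norm (Jk n k u) \<le> norm u"
  by (induction k) (auto simp: Jk_Suc intro: order.trans[OF J_norm])

lemma Jk_diff: "Jk n k (u - v) = Jk n k u - Jk n k v"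
  by (rule linear_diff[OF Jk_linear])

lemma Jk_mem: "(u, v) \<in> M \<Longrightarrow> (Jk n k u, Jk n k v) \<in> M"
  by (induction k) (auto simp: Jk_Suc intro: J_on_domain)

lemma Jk_increment: "(u, v) \<in> M \<Longrightarrow> Jk n (Suc k) u - Jk n k u = step n *\<^sub>R Jk n (Suc k) v"
  using J_on_domain(2)[OF Jk_mem, of u v n n k] by (simp add: Jk_Suc)

lemma Jk_near:
  assumes "(u, v) \<in> M"
  shows "norm (Jk n k u - u) \<le> real k * step n * norm v"
proof (induction k)
  case (Suc k)
  have "norm (Jk n (Suc k) u - u) \<le> norm (Jk n (Suc k) u - Jk n k u) + norm (Jk n k u - u)"
    by (metis diff_add_cancel add_diff_eq norm_triangle_ineq)
  also have "norm (Jk n (Suc k) u - Jk n k u) \<le> step n * norm v"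
    unfolding Jk_increment[OF assms] using Jk_norm step_nonneg[of n] by (simp add: mult_left_mono)
  finally show ?case using Suc by (simp add: algebra_simps)
qed simp

text \<open>Two half steps and one full step both expand to \<open>u + h M u\<close> with a remainder made of resolvents
  applied to \<open>h\<^sup>2 M\<^sup>2 u\<close>.\<close>

lemma J_consistency:
  assumes uv: "(u, v) \<in> M" and vw: "(v, w) \<in> M"
  shows "norm (Jk (Suc n) 2 u - J n u) \<le> 2 * (step n)\<^sup>2 * norm w"
proof -
  let ?J = "J (Suc n)" let ?h = "step n"
  interpret L: linear "?J" by (rule J_linear)
  have half: "?J u = u + (?h / 2) *\<^sub>R ?J v" "?J v = v + (?h / 2) *\<^sub>R ?J w"
    using J_on_domain(2)[OF uv, of "Suc n"] J_on_domain(2)[OF vw, of "Suc n"]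
    by (simp_all add: step_Suc)
  have twice: "?J (?J u) = ?J u + (?h / 2) *\<^sub>R ?J (?J v)" "?J (?J v) = ?J v + (?h / 2) *\<^sub>R ?J (?J w)"
    using arg_cong[OF half(1), of ?J] arg_cong[OF half(2), of ?J] by (simp_all add: L.add L.scale)
  have "?J (?J u) = ?J u + (?h / 2) *\<^sub>R ?J v + (?h\<^sup>2 / 4) *\<^sub>R ?J (?J w)"
    by (simp only: twice) (simp add: power2_eq_square algebra_simps)
  also have "\<dots> = u + ?h *\<^sub>R ?J v + (?h\<^sup>2 / 4) *\<^sub>R ?J (?J w)"
    by (subst half(1)) (simp add: scaleR_left_distrib[symmetric])
  also have "\<dots> = u + ?h *\<^sub>R v + (?h\<^sup>2 / 2) *\<^sub>R ?J w + (?h\<^sup>2 / 4) *\<^sub>R ?J (?J w)"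
    by (subst half(2)) (simp add: power2_eq_square algebra_simps)
  finally have two: "Jk (Suc n) 2 u = \<dots>" by (simp add: Jk_def numeral_2_eq_2)
  have one: "J n u = u + ?h *\<^sub>R v + ?h\<^sup>2 *\<^sub>R J n w"
    by (subst J_on_domain(2)[OF uv], subst J_on_domain(2)[OF vw])
      (simp add: power2_eq_square algebra_simps)
  have "Jk (Suc n) 2 u - J n u
      = (?h\<^sup>2 / 2) *\<^sub>R ?J w + (?h\<^sup>2 / 4) *\<^sub>R ?J (?J w) - ?h\<^sup>2 *\<^sub>R J n w"
    by (simp add: two one)
  also have "norm \<dots> \<le> norm ((?h\<^sup>2 / 2) *\<^sub>R ?J w) + norm ((?h\<^sup>2 / 4) *\<^sub>R ?J (?J w))
      + norm (?h\<^sup>2 *\<^sub>R J n w)"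
    by (meson norm_triangle_ineq norm_triangle_ineq4 add_right_mono order.trans)
  also have "\<dots> = ?h\<^sup>2 / 2 * norm (?J w) + ?h\<^sup>2 / 4 * norm (?J (?J w)) + ?h\<^sup>2 * norm (J n w)"
    by simp
  also have "\<dots> \<le> ?h\<^sup>2 / 2 * norm w + ?h\<^sup>2 / 4 * norm w + ?h\<^sup>2 * norm w"
    by (intro add_mono mult_left_mono J_norm order.trans[OF J_norm J_norm]) auto
  also have "\<dots> \<le> 2 * ?h\<^sup>2 * norm w" by (simp add: algebra_simps)
  finally show ?thesis .
qed

text \<open>The errors of the single steps add up, since the remaining steps are contractions and the
  iterates of \<open>u\<close> stay in the domain of \<open>M\<^sup>2\<close> with the same bound.\<close>

lemma Jk_consistency:
  assumes uv: "(u, v) \<in> M" and vw: "(v, w) \<in> M"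
  shows "norm (Jk (Suc n) (2 * k) u - Jk n k u) \<le> real k * (2 * (step n)\<^sup>2 * norm w)"
proof (induction k)
  case (Suc k)
  let ?L = "Jk (Suc n) 2"
  have "Jk (Suc n) (2 * Suc k) u - Jk n (Suc k) u
      = ?L (Jk (Suc n) (2 * k) u - Jk n k u) + (?L (Jk n k u) - J n (Jk n k u))"
    using Jk_add[of "Suc n" 2 "2 * k" u] by (simp add: Jk_diff Jk_Suc)
  also have "norm \<dots> \<le> norm (Jk (Suc n) (2 * k) u - Jk n k u) + 2 * (step n)\<^sup>2 * norm w"
  proof (rule norm_triangle_le, rule add_mono[OF Jk_norm])
    have "norm (?L (Jk n k u) - J n (Jk n k u)) \<le> 2 * (step n)\<^sup>2 * norm (Jk n k w)"
      by (rule J_consistency[OF Jk_mem[OF uv] Jk_mem[OF vw]])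
    also have "\<dots> \<le> 2 * (step n)\<^sup>2 * norm w" by (intro mult_left_mono Jk_norm) auto
    finally show "norm (?L (Jk n k u) - J n (Jk n k u)) \<le> 2 * (step n)\<^sup>2 * norm w" .
  qed
  finally show ?case using Suc by (simp add: algebra_simps)
qed simp

text \<open>Write a vector orthogonal to the domain as \<open>u - M u\<close>. Then \<open>\<parallel>u\<parallel>\<^sup>2 = \<langle>u, M u\<rangle> \<le> 0\<close>.\<close>

lemma domain_dense: "closure (Domain M) = UNIV"
proof (rule dense_subspace_if_orthogonal_trivial[OF subspace_Domain[OF sub]])
  fix w assume w: "\<And>v. v \<in> Domain M \<Longrightarrow> inner v w = 0"
  obtain u v where uv: "(u, v) \<in> M" "u - v = w"
    using m_dissipative unfolding m_dissipative_def by blast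
  have "inner u u = inner u v" using w[OF DomainI[OF uv(1)]] unfolding uv(2)[symmetric] by (simp add: inner_diff_right)
  then have "u = 0" using inner_le_0[OF uv(1)] inner_ge_zero[of u] by auto
  moreover have "(0, 0) \<in> M" using subspace_0[OF sub] by (simp add: zero_prod_def)
  ultimately show "w = 0" using uv single_valued by auto
qed


end

section \<open>The contraction semigroup generated by an m-dissipative operator\<close>

definition steps :: "nat \<Rightarrow> real \<Rightarrow> nat" where "steps n t = nat \<lfloor>t / step n\<rfloor>"

lemma steps_bounds:
  assumes "t \<ge> 0"
  shows "real (steps n t) * step n \<le> t" "t < (real (steps n t) + 1) * step n"
proof -
  have "0 \<le> t / step n" using assms step_nonneg by simp
  then have "real (steps n t) = of_int \<lfloor>t / step n\<rfloor>" by (simp add: steps_def)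
  moreover have "of_int \<lfloor>t / step n\<rfloor> \<le> t / step n" "t / step n < of_int \<lfloor>t / step n\<rfloor> + 1"
    by linarith+
  ultimately show "real (steps n t) * step n \<le> t" "t < (real (steps n t) + 1) * step n"
    by (simp_all only: pos_le_divide_eq[OF step_pos] pos_divide_less_eq[OF step_pos])
qed

lemma steps_tendsto:
  assumes "t \<ge> 0"
  shows "(\<lambda>n. real (steps n t) * step n) \<longlonglongrightarrow> t"
proof (rule tendsto_sandwich)
  show "\<forall>\<^sub>F n in sequentially. t - step n \<le> real (steps n t) * step n"
    using steps_bounds(2)[OF assms] by (intro always_eventually allI) (simp add: algebra_simps less_imp_le)
  show "\<forall>\<^sub>F n in sequentially. real (steps n t) * step n \<le> t"
    using steps_bounds(1)[OF assms] by simp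
  show "(\<lambda>n. t - step n) \<longlonglongrightarrow> t"
    using tendsto_diff[OF tendsto_const step_tendsto_0, of t] by simp
qed simp

lemma steps_Suc:
  assumes "t \<ge> 0"
  shows "steps (Suc n) t = 2 * steps n t \<or> steps (Suc n) t = Suc (2 * steps n t)"
proof -
  define x where "x = t / step n"
  have "t / step (Suc n) = 2 * x" by (simp add: x_def step_Suc)
  moreover have "\<lfloor>2 * x\<rfloor> = 2 * \<lfloor>x\<rfloor> \<or> \<lfloor>2 * x\<rfloor> = 2 * \<lfloor>x\<rfloor> + 1" by linarith
  moreover have "0 \<le> \<lfloor>x\<rfloor>" using assms step_nonneg by (simp add: x_def)
  moreover have "nat (2 * k) = 2 * nat k" "nat (2 * k + 1) = Suc (2 * nat k)" if "0 \<le> k" for k :: int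
    using that by linarith+
  ultimately show ?thesis unfolding steps_def x_def[symmetric] by auto
qed

lemma steps_add:
  assumes "s \<ge> 0" "t \<ge> 0"
  shows "steps n (s + t) = steps n s + steps n t \<or> steps n (s + t) = Suc (steps n s + steps n t)"
proof -
  define x y where "x = s / step n" and "y = t / step n"
  have "\<lfloor>x + y\<rfloor> = \<lfloor>x\<rfloor> + \<lfloor>y\<rfloor> \<or> \<lfloor>x + y\<rfloor> = \<lfloor>x\<rfloor> + \<lfloor>y\<rfloor> + 1" by linarith
  moreover have "0 \<le> \<lfloor>x\<rfloor>" "0 \<le> \<lfloor>y\<rfloor>" using assms step_nonneg by (simp_all add: x_def y_def)
  ultimately show ?thesis
    unfolding steps_def add_divide_distrib x_def[symmetric] y_def[symmetric]
    by (auto simp: nat_add_distrib)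
qed

context m_dissipative_op
begin

text \<open>The value at time \<open>t\<close> of the backward Euler scheme with step \<open>2\<^sup>-\<^sup>n\<close>.\<close>

definition euler :: "nat \<Rightarrow> real \<Rightarrow> 'h \<Rightarrow> 'h" where "euler n t = Jk n (steps n t)"

lemma euler_norm: "norm (euler n t u) \<le> norm u"
  and euler_diff: "euler n t (u - v) = euler n t u - euler n t v"
  by (simp_all add: euler_def Jk_norm Jk_diff)

lemma euler_Suc_near:
  assumes uv: "(u, v) \<in> M" and vw: "(v, w) \<in> M" and t: "t \<ge> 0"
  shows "norm (euler (Suc n) t u - euler n t u) \<le> (2 * t * norm w + norm v) * step n"
proof -
  let ?k = "steps n t"
  have "norm (euler (Suc n) t u - Jk (Suc n) (2 * ?k) u) \<le> step n * norm v"
    using steps_Suc[OF t, of n]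
  proof
    assume "steps (Suc n) t = Suc (2 * ?k)"
    then have "norm (euler (Suc n) t u - Jk (Suc n) (2 * ?k) u) \<le> step (Suc n) * norm v"
      using Jk_increment[OF uv, of "Suc n" "2 * ?k"] Jk_norm step_nonneg
      by (simp add: euler_def mult_left_mono)
    also have "\<dots> \<le> step n * norm v"
      using step_nonneg[of n] by (intro mult_right_mono) (auto simp: step_Suc)
    finally show ?thesis .
  qed (simp add: euler_def step_nonneg)
  moreover have "norm (Jk (Suc n) (2 * ?k) u - euler n t u) \<le> 2 * t * norm w * step n"
  proof -
    have "norm (Jk (Suc n) (2 * ?k) u - euler n t u) \<le> (real ?k * step n) * (2 * norm w * step n)"
      using Jk_consistency[OF uv vw, of n ?k] by (simp add: euler_def power2_eq_square mult_ac)
    also have "\<dots> \<le> t * (2 * norm w * step n)"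
      using steps_bounds(1)[OF t] step_nonneg by (intro mult_right_mono) auto
    finally show ?thesis by (simp add: mult_ac)
  qed
  ultimately have "norm (euler (Suc n) t u - euler n t u) \<le> step n * norm v + 2 * t * norm w * step n"
    by (rule norm_diff_triangle_le)
  then show ?thesis by (simp add: algebra_simps)
qed

lemma resolvent_tendsto: "(\<lambda>n. J n u) \<longlonglongrightarrow> u"
proof -
  have *: "(\<lambda>n. J n u) \<longlonglongrightarrow> u" if "(u, v) \<in> M" for u v
  proof (rule LIM_zero_cancel, rule Lim_null_comparison)
    show "\<forall>\<^sub>F n in sequentially. norm (J n u - u) \<le> step n * norm v"
      using Jk_near[OF that, of _ 1] by (simp add: Jk_def)
    show "(\<lambda>n. step n * norm v) \<longlonglongrightarrow> 0"
      using tendsto_mult_left_zero[OF step_tendsto_0] .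
  qed
  show ?thesis
  proof (rule LIMSEQ_I)
    fix e :: real assume e: "e > 0"
    have "u \<in> closure (Domain M)" by (simp add: domain_dense)
    then obtain x y where xy: "(x, y) \<in> M" "dist x u < e / 3"
      unfolding closure_approachable using e by (metis DomainE divide_pos_pos zero_less_numeral)
    obtain N where N: "\<And>n. n \<ge> N \<Longrightarrow> norm (J n x - x) < e / 3"
      using LIMSEQ_D[OF *[OF xy(1)], of "e / 3"] e by auto
    have "norm (J n u - u) < e" if "n \<ge> N" for n
    proof -
      have "norm (J n u - J n x) \<le> norm (u - x)"
        using J_norm[of n "u - x"] by (simp add: linear_diff[OF J_linear])
      then have "norm (J n u - J n x) < e / 3" "norm (x - u) < e / 3" 
        using xy(2) by (simp_all add: dist_norm norm_minus_commute)
      then have "norm ((J n u - J n x) + (J n x - x) + (x - u)) < e"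
        using N[OF that] norm_triangle_ineq[of "J n u - J n x" "J n x - x"]
          norm_triangle_ineq[of "(J n u - J n x) + (J n x - x)" "x - u"] by linarith
      then show ?thesis by simp
    qed
    then show "\<exists>N. \<forall>n\<ge>N. norm (J n u - u) < e" by blast
  qed
qed

lemma domain_square_dense: "closure {u. \<exists>v w. (u, v) \<in> M \<and> (v, w) \<in> M} = UNIV"
  (is "closure ?D = _")
proof -
  have "Domain M \<subseteq> closure ?D"
  proof
    fix u assume "u \<in> Domain M"
    then obtain v where uv: "(u, v) \<in> M" by blast
    have "J n u \<in> ?D" for n
    proof -
      obtain w where "(J n v, w) \<in> M" by (rule J_mem)
      then show ?thesis using J_on_domain(1)[OF uv] by blast
    qed
    then show "u \<in> closure ?D"
      unfolding closure_sequential using resolvent_tendsto[of u]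
      by (intro exI[of _ "\<lambda>n. J n u"]) blast
  qed
  then have "closure (Domain M) \<subseteq> closure ?D" by (rule closure_minimal) simp
  then show ?thesis unfolding domain_dense by auto
qed

text \<open>On the domain of \<open>M\<^sup>2\<close> the changes caused by halving the step are summable. The set of \<open>u\<close> for
  which the scheme is Cauchy is closed, because the scheme is contractive.\<close>

lemma euler_convergent:
  assumes t: "t \<ge> 0"
  shows "convergent (\<lambda>n. euler n t u)"
proof -
  have *: "Cauchy (\<lambda>n. euler n t u)" if uv: "(u, v) \<in> M" and vw: "(v, w) \<in> M" for u v w
  proof -
    have "summable (\<lambda>n. (2 * t * norm w + norm v) * step n)"
      unfolding step_def by (intro summable_mult summable_geometric) simp
    then have "summable (\<lambda>n. norm (euler (Suc n) t u - euler n t u))"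
      by (rule summable_comparison_test') (simp add: euler_Suc_near[OF uv vw t])
    then have "summable (\<lambda>n. euler (Suc n) t u - euler n t u)" by (rule summable_norm_cancel)
    then have "convergent (\<lambda>n. euler n t u - euler 0 t u)"
      using sum_lessThan_telescope[of "\<lambda>n. euler n t u"] by (simp add: summable_iff_convergent)
    then show ?thesis using convergent_diff_const_right_iff convergent_Cauchy by blast
  qed
  have "Cauchy (\<lambda>n. euler n t u)"
  proof (rule CauchyI)
    fix e :: real assume e: "e > 0"
    have "u \<in> closure {u. \<exists>v w. (u, v) \<in> M \<and> (v, w) \<in> M}" unfolding domain_square_dense by simp
    then obtain x where "x \<in> {u. \<exists>v w. (u, v) \<in> M \<and> (v, w) \<in> M}" "dist x u < e / 3"
      unfolding closure_approachable using e by (meson divide_pos_pos zero_less_numeral)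
    then obtain v w where x: "(x, v) \<in> M" "(v, w) \<in> M" "dist x u < e / 3" by blast
    obtain N where N: "\<And>m n. m \<ge> N \<Longrightarrow> n \<ge> N \<Longrightarrow> norm (euler m t x - euler n t x) < e / 3"
      using CauchyD[OF *[OF x(1,2)], of "e / 3"] e by auto
    have near: "norm (euler n t u - euler n t x) < e / 3" for n
      using euler_norm[of n t "u - x"] x(3) by (simp add: euler_diff dist_norm norm_minus_commute)
    have "norm (euler m t u - euler n t u) < e" if "m \<ge> N" "n \<ge> N" for m n
    proof -
      have "norm ((euler m t u - euler m t x) + (euler m t x - euler n t x)
          - (euler n t u - euler n t x)) < e"
        using near[of m] near[of n] N[OF that]
          norm_triangle_ineq[of "euler m t u - euler m t x" "euler m t x - euler n t x"]
          norm_triangle_ineq4[of "(euler m t u - euler m t x) + (euler m t x - euler n t x)"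
            "euler n t u - euler n t x"] by linarith
      then show ?thesis by simp
    qed
    then show "\<exists>N. \<forall>m\<ge>N. \<forall>n\<ge>N. norm (euler m t u - euler n t u) < e" by blast
  qed
  then show ?thesis by (rule Cauchy_convergent)
qed

definition semigroup :: "real \<Rightarrow> 'h \<Rightarrow> 'h" where
  "semigroup t u = lim (\<lambda>n. euler n t u)"

lemma euler_tendsto: "t \<ge> 0 \<Longrightarrow> (\<lambda>n. euler n t u) \<longlonglongrightarrow> semigroup t u"
  unfolding semigroup_def using euler_convergent convergent_LIMSEQ_iff by blast

lemma semigroup_norm: "t \<ge> 0 \<Longrightarrow> norm (semigroup t u) \<le> norm u"
  by (rule LIMSEQ_le_const2[OF tendsto_norm[OF euler_tendsto]]) (auto simp: euler_norm)

lemma semigroup_bounded_linear: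
  assumes t: "t \<ge> 0"
  shows "bounded_linear (semigroup t)"
proof (rule bounded_linear_intro[where K = 1])
  fix u v and c :: real
  have lin: "linear (euler n t)" for n by (simp add: euler_def Jk_linear)
  have "(\<lambda>n. euler n t (u + v)) \<longlonglongrightarrow> semigroup t u + semigroup t v"
    unfolding linear_add[OF lin] by (intro tendsto_add euler_tendsto t)
  then show "semigroup t (u + v) = semigroup t u + semigroup t v"
    by (rule LIMSEQ_unique[OF euler_tendsto[OF t]])
  have "(\<lambda>n. euler n t (c *\<^sub>R u)) \<longlonglongrightarrow> c *\<^sub>R semigroup t u"
    unfolding linear_scale[OF lin] by (intro tendsto_intros euler_tendsto t)
  then show "semigroup t (c *\<^sub>R u) = c *\<^sub>R semigroup t u"
    by (rule LIMSEQ_unique[OF euler_tendsto[OF t]])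
qed (simp add: semigroup_norm[OF t])

lemma eq_if_eq_on_domain:
  fixes f g :: "'h \<Rightarrow> 'b::t2_space"
  assumes "continuous_on UNIV f" "continuous_on UNIV g" "\<And>u v. (u, v) \<in> M \<Longrightarrow> f u = g u"
  shows "f u = g u"
proof -
  have "closure (Domain M) \<subseteq> {u. f u = g u}"
    using assms by (intro closure_minimal closed_Collect_eq) auto
  then show ?thesis by (auto simp: domain_dense)
qed

lemma semigroup_continuous: "t \<ge> 0 \<Longrightarrow> continuous_on S (semigroup t)"
  by (simp add: linear_continuous_on semigroup_bounded_linear)

text \<open>The numbers of steps for \<open>s + t\<close> and for \<open>s\<close> and \<open>t\<close> together differ by at most one, and a single
  step moves \<open>u\<close> by at most \<open>h \<parallel>M u\<parallel>\<close>.\<close>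

lemma semigroup_add:
  assumes s: "s \<ge> 0" and t: "t \<ge> 0"
  shows "semigroup (s + t) u = semigroup s (semigroup t u)"
proof (rule eq_if_eq_on_domain[of "semigroup (s + t)" "\<lambda>u. semigroup s (semigroup t u)"])
  show "continuous_on UNIV (semigroup (s + t))" using s t by (simp add: semigroup_continuous)
  show "continuous_on UNIV (\<lambda>u. semigroup s (semigroup t u))"
    using s t by (intro continuous_on_compose2[OF semigroup_continuous[of s UNIV] semigroup_continuous]) auto
  fix u v assume uv: "(u, v) \<in> M"
  have 1: "(\<lambda>n. euler n s (semigroup t u)) \<longlonglongrightarrow> semigroup s (semigroup t u)"
    by (rule euler_tendsto[OF s])
  have 2: "(\<lambda>n. euler n s (euler n t u - semigroup t u)) \<longlonglongrightarrow> 0"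
  proof (rule Lim_null_comparison)
    show "\<forall>\<^sub>F n in sequentially.
        norm (euler n s (euler n t u - semigroup t u)) \<le> norm (euler n t u - semigroup t u)"
      by (simp add: euler_norm)
    show "(\<lambda>n. norm (euler n t u - semigroup t u)) \<longlonglongrightarrow> 0"
      using euler_tendsto[OF t, of u] by (simp add: LIM_zero tendsto_norm_zero)
  qed
  have 3: "(\<lambda>n. euler n (s + t) u - euler n s (euler n t u)) \<longlonglongrightarrow> 0"
  proof (rule Lim_null_comparison)
    have "norm (euler n (s + t) u - euler n s (euler n t u)) \<le> step n * norm v" for n
      using steps_add[OF s t, of n]
    proof
      assume "steps n (s + t) = Suc (steps n s + steps n t)"
      then show ?thesis
        using Jk_increment[OF uv, of n "steps n s + steps n t"] Jk_norm step_nonneg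
        by (simp add: euler_def Jk_add[symmetric] mult_left_mono)
    qed (simp add: euler_def Jk_add[symmetric] step_nonneg)
    then show "\<forall>\<^sub>F n in sequentially.
        norm (euler n (s + t) u - euler n s (euler n t u)) \<le> step n * norm v" by simp
    show "(\<lambda>n. step n * norm v) \<longlonglongrightarrow> 0" using tendsto_mult_left_zero[OF step_tendsto_0] .
  qed
  have "(\<lambda>n. euler n (s + t) u) \<longlonglongrightarrow> semigroup s (semigroup t u)"
    using tendsto_add[OF tendsto_add[OF 1 2] 3] by (simp add: euler_diff)
  then show "semigroup (s + t) u = semigroup s (semigroup t u)"
    using s t by (intro LIMSEQ_unique[OF euler_tendsto]) auto
qed

lemma semigroup_near:
  assumes uv: "(u, v) \<in> M" and t: "t \<ge> 0"
  shows "norm (semigroup t u - u) \<le> t * norm v"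
proof (rule LIMSEQ_le_const2)
  show "(\<lambda>n. norm (euler n t u - u)) \<longlonglongrightarrow> norm (semigroup t u - u)"
    by (intro tendsto_intros euler_tendsto t)
  have "norm (euler n t u - u) \<le> t * norm v" for n
    using Jk_near[OF uv, of n "steps n t"] mult_right_mono[OF steps_bounds(1)[OF t, of n] norm_ge_zero[of v]]
    by (simp add: euler_def)
  then show "\<exists>N. \<forall>n\<ge>N. norm (euler n t u - u) \<le> t * norm v" by blast
qed

text \<open>A quantitative first order expansion; \<open>w\<close> is an approximation of \<open>v = M u\<close> in the domain
  of \<open>M\<close>, which makes the estimate usable for every \<open>u\<close> in the domain.\<close>

lemma semigroup_first_order:
  assumes uv: "(u, v) \<in> M" and wz: "(w, z) \<in> M" and t: "t \<ge> 0"
  shows "norm (semigroup t u - u - t *\<^sub>R v) \<le> t * (2 * norm (v - w) + t * norm z)"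
proof (rule LIMSEQ_le)
  let ?T = "\<lambda>n. real (steps n t) * step n"
  let ?C = "\<lambda>T. 2 * norm (v - w) + T * norm z"
  show "(\<lambda>n. norm (euler n t u - u - ?T n *\<^sub>R v)) \<longlonglongrightarrow> norm (semigroup t u - u - t *\<^sub>R v)"
    by (intro tendsto_intros euler_tendsto steps_tendsto t)
  show "(\<lambda>n. ?T n * ?C (?T n)) \<longlonglongrightarrow> t * (2 * norm (v - w) + t * norm z)"
    by (intro tendsto_intros steps_tendsto t)
  have "norm (Jk n k u - u - (real k * step n) *\<^sub>R v) \<le> (real k * step n) * ?C (real K * step n)"
    if "k \<le> K" for n k K
    using that
  proof (induction k)
    case (Suc k)
    have "norm (Jk n (Suc k) v - v) \<le> ?C (real (Suc k) * step n)"
    proof -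
      have split: "Jk n (Suc k) v - v = Jk n (Suc k) (v - w) + (Jk n (Suc k) w - w) - (v - w)"
        by (simp add: Jk_diff)
      have "norm (Jk n (Suc k) v - v)
          \<le> norm (Jk n (Suc k) (v - w)) + norm (Jk n (Suc k) w - w) + norm (v - w)"
        unfolding split using norm_triangle_ineq[of "Jk n (Suc k) (v - w)" "Jk n (Suc k) w - w"]
          norm_triangle_ineq4[of "Jk n (Suc k) (v - w) + (Jk n (Suc k) w - w)" "v - w"] by linarith
      then show ?thesis using Jk_norm[of n "Suc k" "v - w"] Jk_near[OF wz, of n "Suc k"] by linarith
    qed
    also have "\<dots> \<le> ?C (real K * step n)"
      using Suc.prems step_nonneg by (intro add_left_mono mult_right_mono) auto
    finally have incr: "step n * norm (Jk n (Suc k) v - v) \<le> step n * ?C (real K * step n)"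
      by (rule mult_left_mono[OF _ step_nonneg])
    have "Jk n (Suc k) u - u - (real (Suc k) * step n) *\<^sub>R v
        = (Jk n k u - u - (real k * step n) *\<^sub>R v) + step n *\<^sub>R (Jk n (Suc k) v - v)"
      using Jk_increment[OF uv, of n k] by (simp add: algebra_simps)
    also have "norm \<dots> \<le> (real k * step n) * ?C (real K * step n) + step n * ?C (real K * step n)"
      using Suc incr step_nonneg[of n] by (intro norm_triangle_le add_mono) auto
    finally show ?case by (simp add: algebra_simps)
  qed simp
  then show "\<exists>N. \<forall>n\<ge>N. norm (euler n t u - u - ?T n *\<^sub>R v) \<le> ?T n * ?C (?T n)"
    unfolding euler_def by blast
qed

lemma semigroup_derivative_0:
  assumes uv: "(u, v) \<in> M"
  shows "((\<lambda>h. (semigroup h u - u) /\<^sub>R h) \<longlongrightarrow> v) (at_right 0)"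
proof (rule tendstoI)
  fix e :: real assume e: "e > 0"
  have "v \<in> closure (Domain M)" by (simp add: domain_dense)
  then obtain w z where wz: "(w, z) \<in> M" "dist w v < e / 4"
    unfolding closure_approachable using e by (metis DomainE divide_pos_pos zero_less_numeral)
  define d where "d = e / (2 * (norm z + 1))"
  have d: "d > 0" using e by (simp add: d_def add_nonneg_pos)
  have "dist ((semigroup h u - u) /\<^sub>R h) v < e" if h: "h > 0" "h < d" for h
  proof -
    have "(semigroup h u - u) /\<^sub>R h - v = (semigroup h u - u - h *\<^sub>R v) /\<^sub>R h"
      using h by (simp add: scaleR_diff_right)
    then have "dist ((semigroup h u - u) /\<^sub>R h) v = norm (semigroup h u - u - h *\<^sub>R v) / h"
      using h by (simp add: dist_norm divide_inverse mult.commute)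
    also have "\<dots> \<le> 2 * norm (v - w) + h * norm z"
      using semigroup_first_order[OF uv wz(1), of h] h by (simp add: field_simps)
    also have "\<dots> < e / 2 + e / 2"
    proof (rule add_strict_mono)
      show "2 * norm (v - w) < e / 2" using wz(2) by (simp add: dist_norm norm_minus_commute)
      have "h * norm z \<le> h * (norm z + 1)" using h by simp
      also have "\<dots> < d * (norm z + 1)" using h by (intro mult_strict_right_mono) (auto simp: add_nonneg_pos)
      also have "\<dots> = e / 2"
        using norm_ge_zero[of z] by (simp add: d_def field_simps del: norm_ge_zero)
      finally show "h * norm z < e / 2" .
    qed
    finally show ?thesis by simp
  qed
  then show "\<forall>\<^sub>F h in at_right 0. dist ((semigroup h u - u) /\<^sub>R h) v < e"
    unfolding eventually_at_right_field using d by blast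
qed

lemma semigroup_continuous_0: "((\<lambda>t. semigroup t u) \<longlongrightarrow> u) (at_right 0)"
proof (rule tendstoI)
  fix e :: real assume e: "e > 0"
  have "u \<in> closure (Domain M)" by (simp add: domain_dense)
  then obtain x y where xy: "(x, y) \<in> M" "dist x u < e / 3"
    unfolding closure_approachable using e by (metis DomainE divide_pos_pos zero_less_numeral)
  define d where "d = e / (3 * (norm y + 1))"
  have d: "d > 0" using e by (simp add: d_def add_nonneg_pos)
  have "dist (semigroup t u) u < e" if t: "t > 0" "t < d" for t
  proof -
    interpret bounded_linear "semigroup t" using t by (simp add: semigroup_bounded_linear)
    have "norm (semigroup t u - semigroup t x) < e / 3"
      using semigroup_norm[of t "u - x"] t xy(2) by (simp add: diff dist_norm norm_minus_commute)
    moreover have "norm (semigroup t x - x) < e / 3"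
    proof -
      have "norm (semigroup t x - x) \<le> t * (norm y + 1)"
        using semigroup_near[OF xy(1), of t] t by (simp add: algebra_simps)
      also have "\<dots> < d * (norm y + 1)" using t by (intro mult_strict_right_mono) (auto simp: add_nonneg_pos)
      also have "\<dots> = e / 3" using norm_ge_zero[of y] by (simp add: d_def field_simps del: norm_ge_zero)
      finally show ?thesis .
    qed
    moreover have "norm (x - u) < e / 3" using xy(2) by (simp add: dist_norm)
    ultimately have "norm ((semigroup t u - semigroup t x) + (semigroup t x - x) + (x - u)) < e"
      using norm_triangle_ineq[of "semigroup t u - semigroup t x" "semigroup t x - x"]
        norm_triangle_ineq[of "(semigroup t u - semigroup t x) + (semigroup t x - x)" "x - u"]
      by linarith
    then show ?thesis by (simp add: dist_norm)
  qed
  then show "\<forall>\<^sub>F t in at_right 0. dist (semigroup t u) u < e"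
    unfolding eventually_at_right_field using d by blast
qed

theorem C0_contraction_semigroup_semigroup: "C0_contraction_semigroup semigroup"
  unfolding C0_contraction_semigroup_def
proof (intro conjI allI impI)
  show "semigroup 0 u = u" for u
    using LIMSEQ_unique[OF euler_tendsto[of 0 u]] by (simp add: euler_def steps_def)
qed (auto intro: semigroup_bounded_linear semigroup_norm semigroup_add semigroup_continuous_0)

text \<open>\<open>E - M\<close> is onto already and \<open>E - G\<close> is injective for dissipative \<open>G\<close>.\<close>

lemma dissipative_extension_eq:
  assumes sub: "subspace G" and diss: "\<And>u v. (u, v) \<in> G \<Longrightarrow> inner u v \<le> 0" and "M \<subseteq> G"
  shows "G = M"
proof (rule antisym[OF _ \<open>M \<subseteq> G\<close>], rule subrelI)
  fix u v assume uv: "(u, v) \<in> G"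
  obtain u' v' where u': "(u', v') \<in> M" "u' - v' = u - v"
    using m_dissipative unfolding m_dissipative_def by blast
  then have "(u - u', v - v') \<in> G" using op_diff[OF sub uv] \<open>M \<subseteq> G\<close> by blast
  then have "inner (u - u') (v - v') \<le> 0" by (rule diss)
  moreover have eq: "v - v' = u - u'"
  proof -
    have "v - v' = (u - u') + ((u' - v') - (u - v))" by simp
    then show ?thesis by (simp add: u'(2))
  qed
  ultimately have "inner (u - u') (u - u') = 0" using inner_ge_zero[of "u - u'"] by simp
  then have "u - u' = 0" by simp
  then show "(u, v) \<in> M" using eq u'(1) by simp
qed

text \<open>The generator of a contraction semigroup is dissipative, as \<open>\<langle>u, T\<^sub>h u - u\<rangle> \<le> 0\<close>, and it extends \<open>M\<close>.\<close>

theorem semigroup_generator_semigroup: "semigroup_generator semigroup = M"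
proof (rule dissipative_extension_eq)
  show "subspace (semigroup_generator semigroup)"
  proof (rule subspaceI)
    have "((\<lambda>h. (semigroup h 0 - 0) /\<^sub>R h) \<longlongrightarrow> 0) (at_right 0)"
      using semigroup_derivative_0[of 0 0] subspace_0[OF sub] by (simp add: zero_prod_def)
    then show "0 \<in> semigroup_generator semigroup"
      by (simp add: semigroup_generator_def zero_prod_def)
  next
    fix x y :: "'h \<times> 'h"
    assume x: "x \<in> semigroup_generator semigroup" and y: "y \<in> semigroup_generator semigroup"
    have "((\<lambda>h. (semigroup h (fst x) - fst x) /\<^sub>R h + (semigroup h (fst y) - fst y) /\<^sub>R h)
        \<longlongrightarrow> snd x + snd y) (at_right 0)"
      using x y by (intro tendsto_add) (auto simp: semigroup_generator_def)
    moreover have "\<forall>\<^sub>F h in at_right 0.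
        (semigroup h (fst x) - fst x) /\<^sub>R h + (semigroup h (fst y) - fst y) /\<^sub>R h
        = (semigroup h (fst x + fst y) - (fst x + fst y)) /\<^sub>R h"
      using eventually_at_right_less[of 0]
    proof eventually_elim
      case (elim h)
      then interpret bounded_linear "semigroup h" by (simp add: semigroup_bounded_linear)
      show ?case by (simp add: add scaleR_diff_right scaleR_add_right)
    qed
    ultimately have "((\<lambda>h. (semigroup h (fst x + fst y) - (fst x + fst y)) /\<^sub>R h)
        \<longlongrightarrow> snd x + snd y) (at_right 0)"
      by (rule Lim_transform_eventually)
    then show "x + y \<in> semigroup_generator semigroup"
      by (simp add: semigroup_generator_def plus_prod_def)
  next
    fix c :: real and x :: "'h \<times> 'h"
    assume x: "x \<in> semigroup_generator semigroup"
    have "((\<lambda>h. c *\<^sub>R ((semigroup h (fst x) - fst x) /\<^sub>R h)) \<longlongrightarrow> c *\<^sub>R snd x) (at_right 0)"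
      using x by (intro tendsto_intros) (auto simp: semigroup_generator_def)
    moreover have "\<forall>\<^sub>F h in at_right 0. c *\<^sub>R ((semigroup h (fst x) - fst x) /\<^sub>R h)
        = (semigroup h (c *\<^sub>R fst x) - c *\<^sub>R fst x) /\<^sub>R h"
      using eventually_at_right_less[of 0]
    proof eventually_elim
      case (elim h)
      then interpret bounded_linear "semigroup h" by (simp add: semigroup_bounded_linear)
      show ?case by (simp add: scaleR scaleR_diff_right mult.commute)
    qed
    ultimately have "((\<lambda>h. (semigroup h (c *\<^sub>R fst x) - c *\<^sub>R fst x) /\<^sub>R h) \<longlongrightarrow> c *\<^sub>R snd x) (at_right 0)"
      by (rule Lim_transform_eventually)
    then show "c *\<^sub>R x \<in> semigroup_generator semigroup"
      by (simp add: semigroup_generator_def scaleR_prod_def)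
  qed
next
  fix u v assume "(u, v) \<in> semigroup_generator semigroup"
  then have "((\<lambda>h. inner u ((semigroup h u - u) /\<^sub>R h)) \<longlongrightarrow> inner u v) (at_right 0)"
    by (intro tendsto_intros) (simp add: semigroup_generator_def)
  moreover have "\<forall>\<^sub>F h in at_right 0. inner u ((semigroup h u - u) /\<^sub>R h) \<le> 0"
    using eventually_at_right_less[of 0]
  proof eventually_elim
    case (elim h)
    have "inner u (semigroup h u) \<le> norm u * norm (semigroup h u)" by (rule norm_cauchy_schwarz)
    also have "\<dots> \<le> norm u * norm u" using elim by (intro mult_left_mono semigroup_norm) auto
    also have "\<dots> = inner u u" by (metis power2_norm_eq_inner power2_eq_square)
    finally have "inner u (semigroup h u - u) \<le> 0" by (simp add: inner_diff_right)
    then show ?case using elim by (simp add: mult_nonneg_nonpos)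
  qed
  ultimately show "inner u v \<le> 0" by (rule tendsto_upperbound) simp
next
  show "M \<subseteq> semigroup_generator semigroup"
    by (auto simp: semigroup_generator_def semigroup_derivative_0)
qed

text \<open>For skew-symmetric \<open>M\<close> a backward Euler step loses only \<open>h\<^sup>2 \<parallel>M u\<parallel>\<^sup>2\<close> of the squared norm, so
  \<open>t / h\<close> steps lose \<open>O(h)\<close>.\<close>

theorem semigroup_isometric:
  assumes skew: "\<And>u v. (u, v) \<in> M \<Longrightarrow> inner u v = 0" and t: "t \<ge> 0"
  shows "norm (semigroup t u) = norm u"
proof (rule eq_if_eq_on_domain[of "\<lambda>u. norm (semigroup t u)" norm])
  show "continuous_on UNIV (\<lambda>u. norm (semigroup t u))"
    using semigroup_continuous[OF t] by (intro continuous_intros)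
  show "continuous_on UNIV (norm :: 'h \<Rightarrow> real)" by (intro continuous_intros)
  fix u v assume uv: "(u, v) \<in> M"
  have loss: "(norm u)\<^sup>2 \<le> (norm (Jk n k u))\<^sup>2 + real k * (step n * step n * (norm v)\<^sup>2)" for n k
  proof (induction k)
    case (Suc k)
    let ?u = "Jk n (Suc k) u" let ?v = "Jk n (Suc k) v"
    have "Jk n k u = ?u - step n *\<^sub>R ?v" using Jk_increment[OF uv, of n k] by (simp add: algebra_simps)
    moreover have "inner ?u ?v = 0" by (rule skew[OF Jk_mem[OF uv]])
    ultimately have "(norm (Jk n k u))\<^sup>2 = (norm ?u)\<^sup>2 + step n * step n * (norm ?v)\<^sup>2"
      unfolding power2_norm_eq_inner
      by (simp add: inner_diff_left inner_diff_right inner_commute[of ?v ?u])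
    also have "\<dots> \<le> (norm ?u)\<^sup>2 + step n * step n * (norm v)\<^sup>2"
      by (intro add_left_mono mult_left_mono power_mono Jk_norm) auto
    finally show ?case using Suc by (simp add: algebra_simps)
  qed simp
  have "(norm u)\<^sup>2 \<le> (norm (semigroup t u))\<^sup>2 + t * 0 * (norm v)\<^sup>2"
  proof (rule LIMSEQ_le_const)
    show "(\<lambda>n. (norm (euler n t u))\<^sup>2 + (real (steps n t) * step n) * step n * (norm v)\<^sup>2)
        \<longlonglongrightarrow> (norm (semigroup t u))\<^sup>2 + t * 0 * (norm v)\<^sup>2"
      by (intro tendsto_intros euler_tendsto steps_tendsto step_tendsto_0 t)
    have "(norm u)\<^sup>2 \<le> (norm (euler n t u))\<^sup>2 + (real (steps n t) * step n) * step n * (norm v)\<^sup>2"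
      for n using loss[of n "steps n t"] by (simp only: euler_def mult.assoc)
    then show "\<exists>N. \<forall>n\<ge>N. (norm u)\<^sup>2
        \<le> (norm (euler n t u))\<^sup>2 + (real (steps n t) * step n) * step n * (norm v)\<^sup>2" by blast
  qed
  then have "(norm u)\<^sup>2 \<le> (norm (semigroup t u))\<^sup>2" by simp
  then have "norm u \<le> norm (semigroup t u)" by (rule power2_le_imp_le) simp
  then show "norm (semigroup t u) = norm u" using semigroup_norm[OF t, of u] by simp
qed

end

section \<open>Maximal skew-symmetric operators\<close>

lemma mem_op_uminus: "(u, v) \<in> op_uminus S \<longleftrightarrow> (u, - v) \<in> S"
proof
  show "(u, - v) \<in> S" if "(u, v) \<in> op_uminus S" using that by (auto simp: op_uminus_def)
  show "(u, v) \<in> op_uminus S" if "(u, - v) \<in> S"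
    using that unfolding op_uminus_def by (intro CollectI exI[of _ u] exI[of _ "- v"]) simp
qed

lemma mem_op_adjoint: "(v, w) \<in> op_adjoint S \<longleftrightarrow> (\<forall>u y. (u, y) \<in> S \<longrightarrow> inner y v = inner u w)"
  unfolding op_adjoint_def by blast

lemma eq_0_if_orthogonal_to_dense:
  fixes d :: "'h::real_inner"
  assumes "closure D = UNIV" "\<And>x. x \<in> D \<Longrightarrow> inner x d = 0"
  shows "d = 0"
proof -
  have "closure D \<subseteq> {x. inner x d = 0}"
    using assms(2) by (intro closure_minimal closed_Collect_eq continuous_intros) auto
  then have "inner d d = 0" using assms(1) by blast
  then show ?thesis by simp
qed

lemma skew_symmetricD:
  assumes "skew_symmetric S" "(u, v) \<in> S" "(x, y) \<in> S"
  shows "inner y u = - inner x v"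
proof -
  have "(u, - v) \<in> op_adjoint S"
    using assms(1,2) unfolding skew_symmetric_def mem_op_uminus[symmetric] by blast
  then show ?thesis using assms(3) by (auto simp: mem_op_adjoint)
qed

lemma skew_symmetric_inner_0: "skew_symmetric S \<Longrightarrow> (u, v) \<in> S \<Longrightarrow> inner u v = 0"
  using skew_symmetricD[of S u v u v] by (simp add: inner_commute)

lemma skew_symmetric_subspace: "skew_symmetric S \<Longrightarrow> subspace S"
  and skew_symmetric_dense: "skew_symmetric S \<Longrightarrow> closure (Domain S) = UNIV"
  by (auto simp: skew_symmetric_def is_operator_def densely_defined_def)

text \<open>Antisymmetry and density of the domain already force the graph to be that of an operator.\<close>

lemma skew_symmetricI:
  assumes "subspace S" "closure (Domain S) = UNIV"
    and skew: "\<And>u v x y. (u, v) \<in> S \<Longrightarrow> (x, y) \<in> S \<Longrightarrow> inner y u = - inner x v"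
  shows "skew_symmetric S"
proof -
  have "v = v'" if "(u, v) \<in> S" "(u, v') \<in> S" for u v v'
  proof -
    have "v - v' = 0"
    proof (rule eq_0_if_orthogonal_to_dense[OF assms(2)])
      fix x assume "x \<in> Domain S"
      then obtain y where "(x, y) \<in> S" by blast
      then show "inner x (v - v') = 0"
        using skew[OF op_diff[OF assms(1) that], of x y] by simp
    qed
    then show ?thesis by simp
  qed
  then have "single_valued S" by (rule single_valuedI)
  moreover have "S \<subseteq> op_uminus (op_adjoint S)"
    using skew by (auto simp: mem_op_uminus op_adjoint_def)
  ultimately show ?thesis
    using assms by (simp add: skew_symmetric_def is_operator_def densely_defined_def)
qed

lemma skew_symmetric_closure:
  fixes S :: "'h::real_inner op"
  assumes S: "skew_symmetric S"
  shows "skew_symmetric (closure S)"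
proof (rule skew_symmetricI)
  show "subspace (closure S)" by (rule subspace_closure[OF skew_symmetric_subspace[OF S]])
  have "closure (Domain S) \<subseteq> closure (Domain (closure S))"
    by (intro closure_mono Domain_mono closure_subset)
  then show "closure (Domain (closure S)) = UNIV"
    using skew_symmetric_dense[OF S] by auto
  have 1: "inner y u = - inner x v" if "(u, v) \<in> S" "(x, y) \<in> closure S" for u v x y
  proof -
    have "closure S \<subseteq> {p. inner (snd p) u = - inner (fst p) v}"
      using skew_symmetricD[OF S that(1)]
      by (intro closure_minimal closed_Collect_eq continuous_intros) auto
    then show ?thesis using that(2) by auto
  qed
  fix u v x y assume uv: "(u, v) \<in> closure S" and xy: "(x, y) \<in> closure S"
  have "closure S \<subseteq> {p. inner y (fst p) = - inner x (snd p)}"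
    using 1[OF _ xy] by (intro closure_minimal closed_Collect_eq continuous_intros) auto
  then show "inner y u = - inner x v" using uv by auto
qed

lemma maximal_skew_symmetric_closed:
  assumes "maximal_skew_symmetric S"
  shows "closed S"
proof -
  have "closure S = S"
    using assms skew_symmetric_closure[of S] closure_subset[of S]
    unfolding maximal_skew_symmetric_def by blast
  then show ?thesis by (simp add: closure_eq)
qed

lemma range_id_plus: "Range (op_add Id S) = (\<lambda>p. fst p + 1 *\<^sub>R snd p) ` S"
proof (rule set_eqI)
  fix x
  have "x \<in> Range (op_add Id S) \<longleftrightarrow> (\<exists>u v. (u, v) \<in> S \<and> x = u + v)"
    unfolding op_add_def by blast
  then show "x \<in> Range (op_add Id S) \<longleftrightarrow> x \<in> (\<lambda>p. fst p + 1 *\<^sub>R snd p) ` S"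
    by (simp add: image_iff Bex_def)
qed

lemma range_id_minus: "Range (op_add Id (op_uminus S)) = (\<lambda>p. fst p + (-1) *\<^sub>R snd p) ` S"
proof (rule set_eqI)
  fix x
  have "x \<in> Range (op_add Id (op_uminus S)) \<longleftrightarrow> (\<exists>u v. (u, v) \<in> S \<and> x = u + - v)"
    unfolding op_add_def op_uminus_def by blast
  then show "x \<in> Range (op_add Id (op_uminus S)) \<longleftrightarrow> x \<in> (\<lambda>p. fst p + (-1) *\<^sub>R snd p) ` S"
    by (simp add: image_iff Bex_def)
qed

text \<open>Skew-symmetry makes \<open>u \<plusminus> S u\<close> as large as the graph norm of \<open>u\<close>, so the ranges are closed.\<close>

lemma closed_range_skew:
  fixes S :: "'h::{real_inner,banach} op"
  assumes S: "skew_symmetric S" "closed S" and c: "c\<^sup>2 = 1"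
  shows "subspace ((\<lambda>p. fst p + c *\<^sub>R snd p) ` S)" "closed ((\<lambda>p. fst p + c *\<^sub>R snd p) ` S)"
proof -
  have bl: "bounded_linear (\<lambda>p :: 'h \<times> 'h. fst p + c *\<^sub>R snd p)"
    by (intro bounded_linear_add bounded_linear_fst bounded_linear_snd bounded_linear_const_scaleR)
  note sub = skew_symmetric_subspace[OF S(1)]
  show "subspace ((\<lambda>p. fst p + c *\<^sub>R snd p) ` S)"
    by (rule linear_subspace_image[OF bounded_linear.linear[OF bl] sub])
  have "norm p \<le> norm (fst p + c *\<^sub>R snd p)" if "p \<in> S" for p
  proof -
    have "inner (fst p) (snd p) = 0" using skew_symmetric_inner_0[OF S(1)] that by auto
    then have "(norm (fst p + c *\<^sub>R snd p))\<^sup>2 = (norm (fst p))\<^sup>2 + c\<^sup>2 * (norm (snd p))\<^sup>2"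
      unfolding power2_norm_eq_inner
      by (simp add: inner_add_left inner_add_right inner_commute[of "snd p" "fst p"] power2_eq_square)
    then show ?thesis using c by (simp add: norm_prod_def real_sqrt_le_iff' real_le_lsqrt)
  qed
  then have "complete ((\<lambda>p. fst p + c *\<^sub>R snd p) ` S)"
    using S(2) by (intro complete_isometric_image[where e = 1] sub bl) (auto simp: complete_eq_closed)
  then show "closed ((\<lambda>p. fst p + c *\<^sub>R snd p) ` S)" by (rule complete_imp_closed)
qed

text \<open>If both ranges were proper, unit vectors orthogonal to them would be mapped to each other by an
  isometric extension of the Cayley transform; in terms of \<open>S\<close> this means adding the pair
  \<open>(w\<^sub>1 + w\<^sub>2, w\<^sub>1 - w\<^sub>2)\<close> to the graph.\<close>

lemma maximal_skew_symmetric_range: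
  fixes S :: "'h::{real_inner,banach} op"
  assumes max: "maximal_skew_symmetric S"
  shows "Range (op_add Id S) = UNIV \<or> Range (op_add Id (op_uminus S)) = UNIV"
proof (rule ccontr)
  assume ne: "\<not> ?thesis"
  have S: "skew_symmetric S" using max by (simp add: maximal_skew_symmetric_def)
  note sub = skew_symmetric_subspace[OF S] and cl = maximal_skew_symmetric_closed[OF max]
  have unit: "\<exists>w. norm w = 1 \<and> (\<forall>v\<in>V. inner v w = 0)" if V: "subspace V" "closed V" "V \<noteq> UNIV"
    for V :: "'h set"
  proof -
    obtain w where "w \<noteq> 0" "\<And>v. v \<in> V \<Longrightarrow> inner v w = 0" using exists_orthogonal_vector[OF V] by blast
    then show ?thesis by (intro exI[of _ "sgn w"]) (auto simp: norm_sgn sgn_div_norm)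
  qed
  let ?g = "\<lambda>c p. fst p + c *\<^sub>R snd p"
  have mem: "u + c *\<^sub>R v \<in> ?g c ` S" if "(u, v) \<in> S" for u v c
    using imageI[OF that, of "?g c"] by simp
  obtain w1 where w1: "norm w1 = 1" "\<forall>v\<in>?g 1 ` S. inner v w1 = 0"
    using unit[OF closed_range_skew[OF S cl, of 1]] ne unfolding range_id_plus by auto
  have w1S: "inner (u + v) w1 = 0" if "(u, v) \<in> S" for u v
    using bspec[OF w1(2) mem[OF that]] by simp
  obtain w2 where w2: "norm w2 = 1" "\<forall>v\<in>?g (-1) ` S. inner v w2 = 0"
    using unit[OF closed_range_skew[OF S cl, of "-1"]] ne unfolding range_id_minus by auto
  have w2S: "inner (u - v) w2 = 0" if "(u, v) \<in> S" for u v
    using bspec[OF w2(2) mem[OF that]] by simp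
  define z where "z = (w1 + w2, w1 - w2)"
  define S' where "S' = {p + q | p q. p \<in> S \<and> q \<in> span {z}}"
  have memS': "\<exists>u v c. (u, v) \<in> S \<and> x = u + c *\<^sub>R (w1 + w2) \<and> y = v + c *\<^sub>R (w1 - w2)"
    if xy: "(x, y) \<in> S'" for x y
  proof -
    obtain p q where pq: "(x, y) = p + q" "p \<in> S" "q \<in> span {z}" using xy unfolding S'_def by blast
    obtain c where "q = c *\<^sub>R z" using pq(3) unfolding span_singleton by blast
    then show ?thesis
      using pq(1,2) by (intro exI[of _ "fst p"] exI[of _ "snd p"] exI[of _ c])
        (simp add: z_def plus_prod_def)
  qed
  have SS': "S \<subseteq> S'" unfolding S'_def using span_zero[of "{z}"] add_0_right by (metis (mono_tags, lifting) CollectI subsetI)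
  have zS': "z \<in> S'" 
    unfolding S'_def using subspace_0[OF sub] span_base[of z "{z}"]
    by (intro CollectI exI[of _ 0] exI[of _ z]) simp
  have "skew_symmetric S'"
  proof (rule skew_symmetricI)
    show "subspace S'" unfolding S'_def by (rule subspace_sums[OF sub subspace_span])
    have "closure (Domain S) \<subseteq> closure (Domain S')" by (intro closure_mono Domain_mono SS')
    then show "closure (Domain S') = UNIV" using skew_symmetric_dense[OF S] by auto
    fix x y x' y' assume "(x, y) \<in> S'" "(x', y') \<in> S'"
    then obtain u v c u' v' c' where *: "(u, v) \<in> S" "x = u + c *\<^sub>R (w1 + w2)" "y = v + c *\<^sub>R (w1 - w2)"
      "(u', v') \<in> S" "x' = u' + c' *\<^sub>R (w1 + w2)" "y' = v' + c' *\<^sub>R (w1 - w2)"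
      using memS' by meson
    have cross: "inner q (w1 + w2) + inner p (w1 - w2) = 0" if "(p, q) \<in> S" for p q
      using w1S[OF that] w2S[OF that]
      by (simp add: inner_add_left inner_add_right inner_diff_left inner_diff_right)
    have "inner (w1 - w2) (w1 + w2) = (norm w1)\<^sup>2 - (norm w2)\<^sup>2"
      unfolding power2_norm_eq_inner
      by (simp add: inner_diff_left inner_add_right inner_commute[of w2 w1])
    then have self: "inner (w1 - w2) (w1 + w2) = 0" using w1(1) w2(1) by simp
    have "inner y' x + inner x' y = (inner v' u + inner u' v)
        + c * (inner v' (w1 + w2) + inner u' (w1 - w2)) + c' * (inner v (w1 + w2) + inner u (w1 - w2))
        + 2 * c * c' * inner (w1 - w2) (w1 + w2)"
      unfolding *(2,3,5,6)
      by (simp add: inner_add_left inner_add_right inner_diff_left inner_diff_right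
          inner_commute[of w2 w1] inner_commute[of w1 v] inner_commute[of w1 u]
          inner_commute[of w2 v] inner_commute[of w2 u] algebra_simps)
    also have "\<dots> = 0"
      using cross[OF *(1)] cross[OF *(4)] self skew_symmetricD[OF S *(1) *(4)] by simp
    finally show "inner y' x = - inner x' y" by simp
  qed
  then have "z \<in> S" using max SS' zS' unfolding maximal_skew_symmetric_def by blast
  then have "inner (2 *\<^sub>R w1) w1 = 0" using w1S[of "w1 + w2" "w1 - w2"] by (simp add: z_def scaleR_2)
  then show False using w1(1) by auto
qed

lemma codim_eq_0_iff:
  fixes V :: "'a::real_vector set"
  assumes "subspace V"
  shows "codim V = 0 \<longleftrightarrow> V = UNIV"
proof
  let ?A = "(\<lambda>B. if finite B then enat (card B) else \<infinity>) ` {B. span (V \<union> B) = UNIV}"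
  assume "codim V = 0"
  moreover have "Inf ?A \<in> ?A"
  proof (rule wellorder_InfI)
    show "(if finite (UNIV :: 'a set) then enat (card (UNIV :: 'a set)) else \<infinity>) \<in> ?A"
      by (rule image_eqI[of _ _ UNIV]) (simp_all add: span_UNIV)
  qed
  ultimately have "0 \<in> ?A" by (simp add: codim_def)
  then obtain B where "span (V \<union> B) = UNIV" "(if finite B then enat (card B) else \<infinity>) = 0" by auto
  then have "span V = UNIV" by (auto split: if_splits simp: enat_0_iff)
  then show "V = UNIV" using assms by (metis span_eq_iff)
next
  assume "V = UNIV"
  then have "{} \<in> {B. span (V \<union> B) = UNIV}" by (simp add: span_UNIV)
  from INF_lower[OF this, of "\<lambda>B. if finite B then enat (card B) else \<infinity>"]
  show "codim V = 0" by (simp add: codim_def zero_enat_def[symmetric])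
qed

lemma deficiency_eq_0_iff:
  fixes S :: "'a::real_inner op"
  assumes "skew_symmetric S"
  shows "deficiency_plus S = 0 \<longleftrightarrow> (\<forall>f. \<exists>u v. (u, v) \<in> S \<and> u + v = f)"
    and "deficiency_minus S = 0 \<longleftrightarrow> (\<forall>f. \<exists>u v. (u, v) \<in> S \<and> u - v = f)"
proof -
  have sub: "subspace ((\<lambda>p. fst p + c *\<^sub>R snd p) ` S)" for c
    by (intro linear_subspace_image[OF _ skew_symmetric_subspace[OF assms]] bounded_linear.linear
        bounded_linear_add bounded_linear_fst bounded_linear_snd bounded_linear_const_scaleR)
  have img: "g ` S = UNIV \<longleftrightarrow> (\<forall>f. \<exists>u v. (u, v) \<in> S \<and> g (u, v) = f)" for g :: "'a \<times> 'a \<Rightarrow> 'a"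
  proof -
    have "g ` S = UNIV \<longleftrightarrow> (\<forall>f. f \<in> g ` S)" by auto
    moreover have "f \<in> g ` S \<longleftrightarrow> (\<exists>u v. (u, v) \<in> S \<and> g (u, v) = f)" for f by force
    ultimately show ?thesis by simp
  qed
  show "deficiency_plus S = 0 \<longleftrightarrow> (\<forall>f. \<exists>u v. (u, v) \<in> S \<and> u + v = f)"
    unfolding deficiency_plus_def range_id_plus codim_eq_0_iff[OF sub] img by simp
  show "deficiency_minus S = 0 \<longleftrightarrow> (\<forall>f. \<exists>u v. (u, v) \<in> S \<and> u - v = f)"
    unfolding deficiency_minus_def range_id_minus codim_eq_0_iff[OF sub] img by simp
qed

text \<open>If \<open>R\<close> is the resolvent of an m-dissipative \<open>M\<close>, then \<open>2 R - E\<close> is a contraction, hence so is its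
  adjoint; and this says that \<open>\<parallel>v + w\<parallel> \<le> \<parallel>v - w\<parallel>\<close> for \<open>w = M\<^sup>* v\<close>.\<close>

lemma (in m_dissipative_op) m_dissipative_adjoint: "m_dissipative (op_adjoint M)"
proof -
  have R: "inner (J 0 f) (v - w) = inner f v" if "(v, w) \<in> op_adjoint M" for f v w
  proof -
    obtain y where y: "(J 0 f, y) \<in> M" "J 0 f - step 0 *\<^sub>R y = f" by (rule J_mem)
    then have "inner y v = inner (J 0 f) w" using that by (auto simp: mem_op_adjoint)
    moreover have "f = J 0 f - y" using y(2) by (simp add: step_def)
    then have "inner f v = inner (J 0 f) v - inner y v" by (metis inner_diff_left)
    ultimately show ?thesis by (simp add: inner_diff_right)
  qed
  have "subspace (op_adjoint M)"
    by (rule subspaceI) (auto simp: mem_op_adjoint inner_add_right zero_prod_def)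
  moreover have "single_valued (op_adjoint M)"
  proof (rule single_valuedI)
    fix v w w' assume "(v, w) \<in> op_adjoint M" "(v, w') \<in> op_adjoint M"
    then have "inner x (w - w') = 0" if "x \<in> Domain M" for x
      using that unfolding mem_op_adjoint by (metis DomainE inner_diff_right right_minus_eq)
    then have "w - w' = 0" by (rule eq_0_if_orthogonal_to_dense[OF domain_dense])
    then show "w = w'" by simp
  qed
  moreover have "inner v w \<le> 0" if vw: "(v, w) \<in> op_adjoint M" for v w
  proof -
    let ?f = "v + w" and ?g = "v - w"
    obtain y where y: "(J 0 ?f, y) \<in> M" "J 0 ?f - step 0 *\<^sub>R y = ?f" by (rule J_mem)
    have refl: "2 *\<^sub>R J 0 ?f - ?f = J 0 ?f + y"
      using y(2) by (simp add: step_def scaleR_2 algebra_simps)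
    have "(norm (J 0 ?f + y))\<^sup>2 \<le> (norm (J 0 ?f - y))\<^sup>2"
      using inner_le_0[OF y(1)] unfolding power2_norm_eq_inner
      by (simp add: inner_add_left inner_add_right inner_diff_left inner_diff_right
          inner_commute[of y "J 0 ?f"])
    then have "norm (J 0 ?f + y) \<le> norm (J 0 ?f - y)" by (rule power2_le_imp_le) simp
    also have "J 0 ?f - y = ?f" using y(2) by (simp add: step_def)
    finally have contr: "norm (2 *\<^sub>R J 0 ?f - ?f) \<le> norm ?f" by (simp add: refl)
    have "norm ?f * norm ?f = inner ?f ?f" by (metis power2_norm_eq_inner power2_eq_square)
    also have "\<dots> = 2 * inner ?f v - inner ?f ?g"
      by (simp add: inner_add_right inner_diff_right)
    also have "\<dots> = inner (2 *\<^sub>R J 0 ?f - ?f) ?g" using R[OF vw, of ?f] by (simp add: inner_diff_left)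
    also have "\<dots> \<le> norm (2 *\<^sub>R J 0 ?f - ?f) * norm ?g" by (rule norm_cauchy_schwarz)
    also have "\<dots> \<le> norm ?f * norm ?g" by (rule mult_right_mono[OF contr]) simp
    finally have "norm ?f \<le> norm ?g" by (cases "norm ?f = 0") (auto simp: mult_le_cancel_left)
    then have "(norm ?f)\<^sup>2 \<le> (norm ?g)\<^sup>2" by (simp add: power_mono)
    then show ?thesis
      unfolding power2_norm_eq_inner
      by (simp add: inner_add_left inner_add_right inner_diff_left inner_diff_right
          inner_commute[of w v])
  qed
  moreover have "\<exists>v w. (v, w) \<in> op_adjoint M \<and> v - w = g" for g
  proof -
    have "bounded_linear (\<lambda>f. inner (J 0 f) g)"
      using linear_add[OF J_linear[of 0]] linear_scale[OF J_linear[of 0]] J_norm[of 0]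
      by (intro bounded_linear_compose[OF bounded_linear_inner_left] bounded_linear_intro[where K = 1]) auto
    then obtain v where v: "\<And>f. inner (J 0 f) g = inner f v"
      using riesz_representation by metis
    have "(v, v - g) \<in> op_adjoint M"
      unfolding op_adjoint_def
    proof (clarify)
      fix u y assume "(u, y) \<in> M"
      then have "J 0 (u - y) = u" by (intro J_eqI) (auto simp: step_def)
      then show "inner y v = inner u (v - g)"
        using v[of "u - y"] by (simp add: inner_diff_left inner_diff_right)
    qed
    then show ?thesis by (intro exI[of _ v] exI[of _ "v - g"]) simp
  qed
  ultimately show ?thesis
    by (auto simp: m_dissipative_def dissipative_def is_operator_def)
qed

lemma op_uminus_subset_adjoint: "skew_symmetric S \<Longrightarrow> op_uminus S \<subseteq> op_adjoint S"
  by (auto simp: op_uminus_def op_adjoint_def dest: skew_symmetricD)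

lemma m_dissipative_if_skew:
  assumes "skew_symmetric S"
  shows "deficiency_minus S = 0 \<Longrightarrow> m_dissipative S"
    and "deficiency_plus S = 0 \<Longrightarrow> m_dissipative (op_uminus S)"
proof -
  have op: "is_operator S" using assms by (simp add: skew_symmetric_def)
  then show "m_dissipative S" if "deficiency_minus S = 0"
    using that deficiency_eq_0_iff(2)[OF assms] skew_symmetric_inner_0[OF assms]
    by (fastforce simp: m_dissipative_def dissipative_def)
  have "subspace (op_uminus S)"
    using skew_symmetric_subspace[OF assms]
    by (intro subspaceI)
      (auto simp: mem_op_uminus zero_prod_def dest: subspace_0 op_add_mem op_scale)
  moreover have "single_valued (op_uminus S)"
    using op by (auto simp: is_operator_def single_valued_def mem_op_uminus) (metis minus_minus)
  moreover have "inner u v = 0" if "(u, v) \<in> op_uminus S" for u v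
    using that skew_symmetric_inner_0[OF assms] by (force simp: mem_op_uminus)
  moreover have "\<exists>u v. (u, v) \<in> op_uminus S \<and> u - v = f" if def0: "deficiency_plus S = 0" for f
  proof -
    obtain u v where "(u, v) \<in> S" "u + v = f" using def0 deficiency_eq_0_iff(1)[OF assms] by blast
    then show ?thesis by (intro exI[of _ u] exI[of _ "- v"]) (simp add: mem_op_uminus)
  qed
  ultimately show "m_dissipative (op_uminus S)" if "deficiency_plus S = 0"
    using that by (fastforce simp: m_dissipative_def dissipative_def is_operator_def)
qed

text \<open>If both deficiency indices vanish, \<open>- S\<close> is m-dissipative and its extension \<open>S\<^sup>*\<close> is dissipative,
  so they agree. This is why \<open>d\<^sub>+ = 0\<close> gives an isometric semigroup for either description of
  the generator.\<close>

lemma skew_symmetric_generator: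
  fixes S :: "'h::{real_inner,banach} op"
  assumes S: "skew_symmetric S"
    and B: "(deficiency_plus S = 0 \<and> B = op_uminus S) \<or> (deficiency_minus S = 0 \<and> B = op_adjoint S)"
  shows "m_dissipative B" "B \<subseteq> op_adjoint S"
    and "deficiency_plus S = 0 \<Longrightarrow> (u, v) \<in> B \<Longrightarrow> inner u v = 0"
proof -
  have adj: "m_dissipative (op_adjoint S)" if "deficiency_minus S = 0"
    by (rule m_dissipative_op.m_dissipative_adjoint, unfold_locales)
      (rule m_dissipative_if_skew(1)[OF S that])
  show "m_dissipative B" using B adj m_dissipative_if_skew(2)[OF S] by blast
  show "B \<subseteq> op_adjoint S" using B op_uminus_subset_adjoint[OF S] by blast
  assume plus: "deficiency_plus S = 0" and uv: "(u, v) \<in> B"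
  have "B = op_uminus S"
  proof (cases "B = op_uminus S")
    case False
    then have m: "deficiency_minus S = 0" "B = op_adjoint S" using B by auto
    interpret m_dissipative_op "op_uminus S"
      by unfold_locales (rule m_dissipative_if_skew(2)[OF S plus])
    show ?thesis
      unfolding m(2) using adj[OF m(1)] op_uminus_subset_adjoint[OF S]
      by (intro dissipative_extension_eq)
        (auto simp: m_dissipative_def dissipative_def is_operator_def)
  qed
  then have "(u, - v) \<in> S" using uv by (simp add: mem_op_uminus)
  then show "inner u v = 0" using skew_symmetric_inner_0[OF S] by fastforce
qed

section \<open>Orbits of contraction semigroups and the weak formulation\<close>

locale contraction_semigroup =
  fixes T :: "real \<Rightarrow> 'h::real_inner \<Rightarrow> 'h"
  assumes C0: "C0_contraction_semigroup T"
begin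

lemma bounded_linear_T: "t \<ge> 0 \<Longrightarrow> bounded_linear (T t)"
  and norm_T: "t \<ge> 0 \<Longrightarrow> norm (T t u) \<le> norm u"
  and T_0: "T 0 u = u"
  and T_add: "s \<ge> 0 \<Longrightarrow> t \<ge> 0 \<Longrightarrow> T (s + t) u = T s (T t u)"
  and T_continuous_0: "((\<lambda>t. T t u) \<longlongrightarrow> u) (at_right 0)"
  using C0 by (auto simp: C0_contraction_semigroup_def)

lemma T_diff: "t \<ge> 0 \<Longrightarrow> T t (u - v) = T t u - T t v"
  by (rule linear_diff[OF bounded_linear.linear[OF bounded_linear_T]])

lemma T_increment:
  assumes "s \<ge> 0" "t \<ge> 0"
  shows "norm (T s u - T t u) \<le> norm (T \<bar>s - t\<bar> u - u)"
proof -
  have *: "norm (T s u - T t u) \<le> norm (T (s - t) u - u)" if "t \<ge> 0" "t \<le> s" for s t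
    using T_add[of t "s - t" u] norm_T[of t "T (s - t) u - u"] that by (simp add: T_diff)
  show ?thesis
    using *[of t s] *[of s t] assms by (cases "t \<le> s") (auto simp: norm_minus_commute)
qed

lemma T_near_0:
  assumes "e > 0"
  obtains d where "d > 0" "\<And>t. 0 \<le> t \<Longrightarrow> t < d \<Longrightarrow> norm (T t u - u) < e"
proof -
  obtain d where "d > 0" "\<And>t. 0 < t \<Longrightarrow> t < d \<Longrightarrow> dist (T t u) u < e"
    using tendstoD[OF T_continuous_0[of u] assms] unfolding eventually_at_right_field by blast
  then have "norm (T t u - u) < e" if "0 \<le> t" "t < d" for t
    using that assms by (cases "t = 0") (auto simp: T_0 dist_norm)
  then show ?thesis using that \<open>d > 0\<close> by blast
qed

lemma orbit_uniformly_continuous: "uniformly_continuous_on {0..} (\<lambda>t. T t u)"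
  unfolding uniformly_continuous_on_def
proof (intro allI impI)
  fix e :: real assume "e > 0"
  then obtain d where d: "d > 0" "\<And>t. 0 \<le> t \<Longrightarrow> t < d \<Longrightarrow> norm (T t u - u) < e"
    using T_near_0 by blast
  have "dist (T s u) (T t u) < e" if "t \<ge> 0" "s \<ge> 0" "dist s t < d" for s t
    using T_increment[of s t u] d(2)[of "\<bar>s - t\<bar>"] that by (simp add: dist_norm)
  then show "\<exists>d>0. \<forall>x\<in>{0..}. \<forall>x'\<in>{0..}. dist x' x < d \<longrightarrow> dist (T x' u) (T x u) < e"
    using d(1) by auto
qed

lemma generator_invariant:
  assumes "(u, v) \<in> semigroup_generator T" "t \<ge> 0"
  shows "(T t u, T t v) \<in> semigroup_generator T"
proof -
  interpret bounded_linear "T t" using assms(2) by (rule bounded_linear_T)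
  have "((\<lambda>h. T t ((T h u - u) /\<^sub>R h)) \<longlongrightarrow> T t v) (at_right 0)"
    using assms(1) by (intro tendsto) (simp add: semigroup_generator_def)
  moreover have "\<forall>\<^sub>F h in at_right 0. T t ((T h u - u) /\<^sub>R h) = (T h (T t u) - T t u) /\<^sub>R h"
    using eventually_at_right_less[of 0]
  proof eventually_elim
    case (elim h)
    then have "T h (T t u) = T t (T h u)"
      using T_add[of h t u] T_add[of t h u] assms(2) by (simp add: add.commute)
    then show ?case by (simp add: scaleR diff)
  qed
  ultimately show ?thesis unfolding semigroup_generator_def by (auto elim: Lim_transform_eventually)
qed

text \<open>The derivative at \<open>0\<close> is one-sided. It is transported to \<open>t\<close> by \<open>T t\<close> from the right, and from
  the left by \<open>T s\<close> with \<open>s < t\<close>, at the price of the term \<open>T\<^sub>t v - T\<^sub>s v\<close>, which is small by strong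
  continuity.\<close>

lemma orbit_has_vector_derivative:
  assumes uv: "(u, v) \<in> semigroup_generator T" and t: "t \<ge> 0"
  shows "((\<lambda>t. T t u) has_vector_derivative T t v) (at t within {0..})"
  unfolding has_vector_derivative_def has_derivative_within_alt
proof (intro conjI allI impI)
  show "bounded_linear (\<lambda>h. h *\<^sub>R T t v)" by (rule bounded_linear_scaleR_left)
  fix e :: real assume e: "e > 0"
  define D where "D h = T h u - u - h *\<^sub>R v" for h
  have "((\<lambda>h. (T h u - u) /\<^sub>R h) \<longlongrightarrow> v) (at_right 0)"
    using uv by (simp add: semigroup_generator_def)
  then have "\<forall>\<^sub>F h in at_right 0. dist ((T h u - u) /\<^sub>R h) v < e / 2"
    by (rule tendstoD) (use e in simp)
  then obtain d1 where d1: "d1 > 0" "\<forall>h>0. h < d1 \<longrightarrow> dist ((T h u - u) /\<^sub>R h) v < e / 2"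
    unfolding eventually_at_right_field by auto
  obtain d2 where d2: "d2 > 0" "\<And>h. 0 \<le> h \<Longrightarrow> h < d2 \<Longrightarrow> norm (T h v - v) < e / 2"
    using T_near_0[of "e / 2" v] e by auto
  have D: "norm (D h) \<le> e / 2 * h" if "0 \<le> h" "h < d1" for h
  proof (cases "h = 0")
    case False
    then have h: "h > 0" using that by simp
    have "(T h u - u) /\<^sub>R h - v = D h /\<^sub>R h" using h by (simp add: D_def scaleR_diff_right)
    then have "norm (D h /\<^sub>R h) < e / 2"
      using d1(2)[rule_format, OF h that(2)] by (simp only: dist_norm)
    moreover have "norm (D h /\<^sub>R h) = norm (D h) / h"
      using h by (simp add: divide_inverse mult.commute)
    ultimately have "norm (D h) / h < e / 2" by simp
    then show ?thesis using h by (simp add: field_simps)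
  qed (simp add: D_def T_0)
  have "norm (T s u - T t u - (s - t) *\<^sub>R T t v) \<le> e * norm (s - t)"
    if s: "s \<ge> 0" "norm (s - t) < min d1 d2" for s
  proof (cases "t \<le> s")
    case True
    interpret bounded_linear "T t" using t by (rule bounded_linear_T)
    have "T s u - T t u - (s - t) *\<^sub>R T t v = T t (D (s - t))"
      using T_add[of t "s - t" u] t True by (simp add: D_def diff scaleR)
    also have "norm \<dots> \<le> norm (D (s - t))" by (rule norm_T[OF t])
    also have "\<dots> \<le> e / 2 * (s - t)" using D[of "s - t"] True s by simp
    also have "\<dots> \<le> e * norm (s - t)" using True e by simp
    finally show ?thesis .
  next
    case False
    interpret bounded_linear "T s" using s(1) by (rule bounded_linear_T)
    let ?h = "t - s"
    have "T t u = T s (T ?h u)" "T t v = T s (T ?h v)"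
      using T_add[of s ?h] s False by simp_all
    then have "T s u - T t u - (s - t) *\<^sub>R T t v = T s (?h *\<^sub>R T ?h v - T ?h u + u)"
      by (simp add: add diff scaleR scaleR_diff_left)
    moreover have "?h *\<^sub>R T ?h v - T ?h u + u = ?h *\<^sub>R (T ?h v - v) - D ?h"
      by (simp add: D_def scaleR_diff_right)
    ultimately have "T s u - T t u - (s - t) *\<^sub>R T t v = T s (?h *\<^sub>R (T ?h v - v) - D ?h)"
      by (simp only:)
    also have "norm \<dots> \<le> norm (?h *\<^sub>R (T ?h v - v) - D ?h)" by (rule norm_T[OF s(1)])
    also have "\<dots> \<le> ?h * norm (T ?h v - v) + norm (D ?h)"
      using norm_triangle_ineq4[of "?h *\<^sub>R (T ?h v - v)" "D ?h"] False by simp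
    also have "\<dots> \<le> ?h * (e / 2) + e / 2 * ?h"
      using D[of ?h] d2(2)[of ?h] False s by (intro add_mono mult_left_mono) auto
    also have "\<dots> = e * norm (s - t)" using False by simp
    finally show ?thesis .
  qed
  then show "\<exists>d>0. \<forall>s\<in>{0..}. norm (s - t) < d \<longrightarrow>
      norm (T s u - T t u - (s - t) *\<^sub>R T t v) \<le> e * norm (s - t)"
    using d1(1) d2(1) by (intro exI[of _ "min d1 d2"]) auto
qed

text \<open>For initial data in the domain of the generator this is the fundamental theorem of calculus for
  \<open>t \<mapsto> \<langle>T t u, F t\<rangle>\<close>; both sides are continuous in \<open>u\<close>.\<close>

lemma weak_formulation:
  assumes dense: "closure (Domain (semigroup_generator T)) = UNIV"
    and adj: "semigroup_generator T \<subseteq> op_adjoint S"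
    and r: "r \<ge> 0"
    and cont: "continuous_on {0..r} F" "continuous_on {0..r} P" "continuous_on {0..r} Q"
    and F': "\<And>t. t \<in> {0<..<r} \<Longrightarrow> (F has_vector_derivative P t) (at t)"
    and FQ: "\<And>t. t \<in> {0<..<r} \<Longrightarrow> (F t, Q t) \<in> S"
    and "F r = 0"
  shows "((\<lambda>t. inner (T t u) (P t + Q t)) has_integral - inner u (F 0)) {0..r}"
proof -
  have orbit: "continuous_on {0..r} (\<lambda>t. T t u)" for u
    by (rule continuous_on_subset[OF uniformly_continuous_imp_continuous[OF orbit_uniformly_continuous]])
      auto
  have integrand: "continuous_on {0..r} (\<lambda>t. inner (T t u) (P t + Q t))" for u
    by (intro continuous_intros orbit cont)
  define I where "I u = integral {0..r} (\<lambda>t. inner (T t u) (P t + Q t))" for u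
  have I: "((\<lambda>t. inner (T t u) (P t + Q t)) has_integral I u) {0..r}" for u
    unfolding I_def by (rule integrable_integral[OF integrable_continuous_interval[OF integrand]])
  obtain C where C: "\<forall>t\<in>{0..r}. norm (P t + Q t) \<le> C"
    using compact_imp_bounded[OF compact_continuous_image[OF continuous_on_add[OF cont(2,3)] compact_Icc]]
    unfolding bounded_iff by auto
  have "bounded_linear I"
  proof (rule bounded_linear_intro[where K = "C * r"])
    fix x y and c :: real
    note lin = bounded_linear.linear[OF bounded_linear_T]
    have "((\<lambda>t. inner (T t x) (P t + Q t) + inner (T t y) (P t + Q t)) has_integral I x + I y) {0..r}"
      by (rule has_integral_add[OF I I])
    then have "((\<lambda>t. inner (T t (x + y)) (P t + Q t)) has_integral I x + I y) {0..r}"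
      by (rule has_integral_eq[rotated]) (auto simp: linear_add[OF lin] inner_add_left)
    then show "I (x + y) = I x + I y" by (rule has_integral_unique[OF I])
    have "((\<lambda>t. c * inner (T t x) (P t + Q t)) has_integral c * I x) {0..r}"
      by (rule has_integral_mult_right[OF I])
    then have "((\<lambda>t. inner (T t (c *\<^sub>R x)) (P t + Q t)) has_integral c * I x) {0..r}"
      by (rule has_integral_eq[rotated]) (auto simp: linear_scale[OF lin])
    then show "I (c *\<^sub>R x) = c *\<^sub>R I x" unfolding real_scaleR_def by (rule has_integral_unique[OF I])
    have "norm (I x) \<le> (norm x * C) * (r - 0)"
      unfolding I_def
    proof (rule integral_bound[OF r integrand])
      fix t assume t: "t \<in> {0..r}"
      have "norm (inner (T t x) (P t + Q t)) \<le> norm (T t x) * norm (P t + Q t)"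
        using Cauchy_Schwarz_ineq2 by simp
      also have "\<dots> \<le> norm x * C" using t C by (intro mult_mono norm_T) auto
      finally show "norm (inner (T t x) (P t + Q t)) \<le> norm x * C" .
    qed
    then show "norm (I x) \<le> norm x * (C * r)" by simp
  qed
  then have "closed {u. I u = - inner u (F 0)}"
    by (intro closed_Collect_eq continuous_intros linear_continuous_on)
  moreover have "Domain (semigroup_generator T) \<subseteq> {u. I u = - inner u (F 0)}"
  proof
    fix u assume "u \<in> Domain (semigroup_generator T)"
    then obtain v where uv: "(u, v) \<in> semigroup_generator T" by blast
    have "((\<lambda>t. inner (T t u) (P t + Q t)) has_integral inner (T r u) (F r) - inner (T 0 u) (F 0)) {0..r}"
    proof (rule fundamental_theorem_of_calculus_interior[OF r])
      show "continuous_on {0..r} (\<lambda>t. inner (T t u) (F t))" by (intro continuous_intros orbit cont)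
      fix t assume t: "t \<in> {0<..<r}"
      have "((\<lambda>t. T t u) has_vector_derivative T t v) (at t within {0<..})"
        by (rule has_vector_derivative_within_subset[OF orbit_has_vector_derivative[OF uv]]) (use t in auto)
      then have "((\<lambda>t. T t u) has_vector_derivative T t v) (at t)"
        using t by (subst (asm) at_within_open) auto
      then have "((\<lambda>t. inner (T t u) (F t)) has_vector_derivative
          inner (T t u) (P t) + inner (T t v) (F t)) (at t)"
        using F'[OF t] unfolding has_vector_derivative_def
        by (auto intro!: derivative_eq_intros simp: algebra_simps)
      moreover have "inner (Q t) (T t u) = inner (F t) (T t v)"
        using subsetD[OF adj generator_invariant[OF uv, of t]] FQ[OF t] t by (auto simp: mem_op_adjoint)
      ultimately show "((\<lambda>t. inner (T t u) (F t)) has_vector_derivative inner (T t u) (P t + Q t)) (at t)"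
        by (simp add: inner_add_right inner_commute)
    qed
    then show "u \<in> {u. I u = - inner u (F 0)}"
      using has_integral_unique[OF I] by (simp add: \<open>F r = 0\<close> T_0)
  qed
  ultimately have "closure (Domain (semigroup_generator T)) \<subseteq> {u. I u = - inner u (F 0)}"
    by (intro closure_minimal)
  then have "I u = - inner u (F 0)" using dense by auto
  then show ?thesis using I[of u] by simp
qed

end

section \<open>Completeness of \<open>L\<^sup>2\<close> and almost everywhere convergence\<close>

lemma square_integrable_rep: "square_integrable (rep_L2 U)"
  using Quotient_rep_reflp[OF Quotient_L2, of U] by (simp add: ae_equal_def)

lemma abs_rep: "abs_L2 (rep_L2 U) = U"
  by (rule Quotient_abs_rep[OF Quotient_L2])

lemma abs_L2_eqI:
  assumes "square_integrable f" "square_integrable g" "AE x in lebesgue. f x = g x"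
  shows "abs_L2 f = abs_L2 g"
  using assms Quotient_rel_abs[OF Quotient_L2, of f g] by (simp add: ae_equal_def)

lemma inner_abs_L2:
  assumes "square_integrable f" "square_integrable g"
  shows "inner (abs_L2 f) (abs_L2 g) = (LINT x|lebesgue. f x * g x)"
  using assms by (intro inner_L2.abs_eq) (simp_all add: ae_equal_refl)

lemma abs_L2_add:
  assumes "square_integrable f" "square_integrable g"
  shows "abs_L2 f + abs_L2 g = abs_L2 (\<lambda>x. f x + g x)"
  using assms by (intro plus_L2.abs_eq) (simp_all add: ae_equal_refl)

lemma abs_L2_scaleR:
  assumes "square_integrable f"
  shows "c *\<^sub>R abs_L2 f = abs_L2 (\<lambda>x. c * f x)"
  using assms by (intro scaleR_L2.abs_eq) (simp_all add: ae_equal_refl)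

lemma square_integrable_diff:
  assumes "square_integrable f" "square_integrable g"
  shows "square_integrable (\<lambda>x. f x - g x)"
  using square_integrable_add[OF assms(1) square_integrable_scale[OF assms(2), of "-1"]] by simp

lemma abs_L2_diff:
  assumes "square_integrable f" "square_integrable g"
  shows "abs_L2 f - abs_L2 g = abs_L2 (\<lambda>x. f x - g x)"
proof -
  have "abs_L2 f - abs_L2 g = abs_L2 f + (-1) *\<^sub>R abs_L2 g" by simp
  also have "\<dots> = abs_L2 (\<lambda>x. f x + (-1) * g x)"
    unfolding abs_L2_scaleR[OF assms(2)]
    by (rule abs_L2_add[OF assms(1) square_integrable_scale[OF assms(2)]])
  finally show ?thesis by simp
qed

lemma square_integrable_sum:
  "finite I \<Longrightarrow> (\<And>i. i \<in> I \<Longrightarrow> square_integrable (f i)) \<Longrightarrow> square_integrable (\<lambda>x. \<Sum>i\<in>I. f i x)"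
  by (induction I rule: finite_induct) (auto intro: square_integrable_add square_integrable_zero)

lemma abs_L2_sum:
  "finite I \<Longrightarrow> (\<And>i. i \<in> I \<Longrightarrow> square_integrable (f i)) \<Longrightarrow>
    (\<Sum>i\<in>I. abs_L2 (f i)) = abs_L2 (\<lambda>x. \<Sum>i\<in>I. f i x)"
proof (induction I rule: finite_induct)
  case empty
  then show ?case by (simp add: zero_L2.abs_eq zero_L2_def)
qed (simp add: abs_L2_add square_integrable_sum)

lemma norm_abs_L2:
  assumes "square_integrable f"
  shows "(norm (abs_L2 f))\<^sup>2 = (LINT x|lebesgue. (f x)\<^sup>2)"
  unfolding power2_norm_eq_inner inner_abs_L2[OF assms assms] by (simp add: power2_eq_square)

lemma nn_integral_square:
  assumes "square_integrable f"
  shows "(\<integral>\<^sup>+ x. ennreal ((f x)\<^sup>2) \<partial>lebesgue) = ennreal ((norm (abs_L2 f))\<^sup>2)"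
  unfolding norm_abs_L2[OF assms] using assms
  by (intro nn_integral_eq_integral) (auto simp: square_integrable_def)

lemma AE_summable_weighted:
  fixes f :: "nat \<Rightarrow> 'a::euclidean_space \<Rightarrow> real"
  assumes f: "\<And>k. square_integrable (f k)" and c: "\<And>k. 0 \<le> c k"
    and sum: "summable (\<lambda>k. c k * (norm (abs_L2 (f k)))\<^sup>2)"
  shows "AE x in lebesgue. summable (\<lambda>k. c k * (f k x)\<^sup>2)"
proof -
  have m: "f k \<in> borel_measurable lebesgue" for k using f by (simp add: square_integrable_def)
  have "(\<integral>\<^sup>+ x. (\<Sum>k. ennreal (c k * (f k x)\<^sup>2)) \<partial>lebesgue)
      = (\<Sum>k. \<integral>\<^sup>+ x. ennreal (c k * (f k x)\<^sup>2) \<partial>lebesgue)"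
    using m by (intro nn_integral_suminf) measurable
  also have "\<dots> = (\<Sum>k. ennreal (c k * (norm (abs_L2 (f k)))\<^sup>2))"
    using m c nn_integral_square[OF f]
    by (intro suminf_cong) (simp add: ennreal_mult nn_integral_cmult)
  also have "\<dots> = ennreal (\<Sum>k. c k * (norm (abs_L2 (f k)))\<^sup>2)"
    using c sum by (intro suminf_ennreal2) auto
  also have "\<dots> < \<infinity>" by simp
  finally have fin: "(\<integral>\<^sup>+ x. (\<Sum>k. ennreal (c k * (f k x)\<^sup>2)) \<partial>lebesgue) \<noteq> \<infinity>" by simp
  have "AE x in lebesgue. (\<Sum>k. ennreal (c k * (f k x)\<^sup>2)) \<noteq> \<infinity>"
    using m by (intro nn_integral_PInf_AE[OF _ fin]) measurable
  then show ?thesis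
  proof eventually_elim
    case (elim x)
    then show ?case using c by (intro summable_suminf_not_top) (auto simp: infinity_ennreal_def)
  qed
qed

lemma AE_tendsto_if_summable:
  fixes f :: "nat \<Rightarrow> 'a::euclidean_space \<Rightarrow> real"
  assumes f: "\<And>k. square_integrable (f k)"
    and sum: "summable (\<lambda>k. (norm (abs_L2 (f k) - U))\<^sup>2)"
  shows "AE x in lebesgue. (\<lambda>k. f k x) \<longlonglongrightarrow> rep_L2 U x"
proof -
  let ?g = "\<lambda>k x. f k x - rep_L2 U x"
  have "AE x in lebesgue. summable (\<lambda>k. 1 * (?g k x)\<^sup>2)"
  proof (rule AE_summable_weighted)
    show "square_integrable (?g k)" for k by (intro square_integrable_diff f square_integrable_rep)
    show "summable (\<lambda>k. 1 * (norm (abs_L2 (?g k)))\<^sup>2)"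
      using sum abs_L2_diff[OF f square_integrable_rep, of _ U] by (simp add: abs_rep)
  qed simp
  then show ?thesis
  proof eventually_elim
    case (elim x)
    then have "summable (\<lambda>k. (?g k x)\<^sup>2)" by simp
    then have "(\<lambda>k. (?g k x)\<^sup>2) \<longlonglongrightarrow> 0" by (rule summable_LIMSEQ_zero)
    then have "(\<lambda>k. sqrt ((?g k x)\<^sup>2)) \<longlonglongrightarrow> sqrt 0" by (rule tendsto_real_sqrt)
    then have "(\<lambda>k. ?g k x) \<longlonglongrightarrow> 0" by (simp add: tendsto_rabs_zero_iff)
    then show ?case by (rule LIM_zero_cancel)
  qed
qed

text \<open>The Riesz-Fischer theorem. The weights \<open>2\<^sup>k\<close> turn square summability of the increments into
  absolute summability, as \<open>\<bar>d\<bar> \<le> 2\<^sup>-\<^sup>k + 2\<^sup>k d\<^sup>2\<close>.\<close>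

lemma L2_fast_Cauchy_convergent:
  fixes V :: "nat \<Rightarrow> 'a::euclidean_space L2"
  assumes fast: "\<And>j k. k \<le> j \<Longrightarrow> norm (V j - V k) \<le> (1/4) ^ k"
  obtains G where "\<And>k. norm (V k - G) \<le> (1/4) ^ k"
proof -
  define f where "f k = rep_L2 (V k)" for k
  have f: "square_integrable (f k)" "abs_L2 (f k) = V k" for k
    by (simp_all add: f_def square_integrable_rep abs_rep)
  have m: "f k \<in> borel_measurable lebesgue" for k using f by (simp add: square_integrable_def)
  let ?d = "\<lambda>k x. f (Suc k) x - f k x"
  have "summable (\<lambda>k. 2 ^ k * (norm (abs_L2 (?d k)))\<^sup>2)"
  proof (rule summable_comparison_test')
    show "summable (\<lambda>k. (1/8 :: real) ^ k)" by (rule summable_geometric) simp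
    fix k :: nat
    have "(norm (abs_L2 (?d k)))\<^sup>2 \<le> ((1/4) ^ k)\<^sup>2"
      using fast[of k "Suc k"] by (intro power_mono) (simp_all add: abs_L2_diff[symmetric] f)
    then have "2 ^ k * (norm (abs_L2 (?d k)))\<^sup>2 \<le> 2 ^ k * ((1/4) ^ k)\<^sup>2" by simp
    also have "\<dots> = (1/8) ^ k" by (simp add: power2_eq_square power_mult_distrib[symmetric])
    finally show "norm (2 ^ k * (norm (abs_L2 (?d k)))\<^sup>2) \<le> (1/8) ^ k" by simp
  qed
  then have "AE x in lebesgue. summable (\<lambda>k. 2 ^ k * (?d k x)\<^sup>2)"
    by (intro AE_summable_weighted square_integrable_diff f) auto
  then have conv: "AE x in lebesgue. (\<lambda>k. f k x) \<longlonglongrightarrow> lim (\<lambda>k. f k x)"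
  proof eventually_elim
    case (elim x)
    have "summable (\<lambda>k. (1/2 :: real) ^ k + 2 ^ k * (?d k x)\<^sup>2)"
      by (intro summable_add elim summable_geometric) simp
    then have "summable (\<lambda>k. ?d k x)"
    proof (rule summable_comparison_test')
      fix k :: nat
      have "2 * \<bar>?d k x\<bar> * 2 ^ k \<le> 1 + (\<bar>?d k x\<bar> * 2 ^ k)\<^sup>2"
        using sum_squares_bound[of 1 "\<bar>?d k x\<bar> * 2 ^ k"] by simp
      then have "\<bar>?d k x\<bar> * 2 ^ k \<le> 1 + (\<bar>?d k x\<bar> * 2 ^ k)\<^sup>2"
        using zero_le_power2[of "\<bar>?d k x\<bar> * 2 ^ k"] by linarith
      then have "\<bar>?d k x\<bar> \<le> (1 + (\<bar>?d k x\<bar> * 2 ^ k)\<^sup>2) / 2 ^ k" by (simp add: pos_le_divide_eq)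
      also have "\<dots> = (1/2) ^ k + 2 ^ k * (?d k x)\<^sup>2"
        by (simp add: add_divide_distrib power_mult_distrib power2_eq_square power_one_over)
      finally show "norm (?d k x) \<le> (1/2) ^ k + 2 ^ k * (?d k x)\<^sup>2" by simp
    qed
    then have "convergent (\<lambda>k. f k x - f 0 x)"
      using sum_lessThan_telescope[of "\<lambda>k. f k x"] by (simp add: summable_iff_convergent)
    then show ?case
      using convergent_diff_const_right_iff convergent_LIMSEQ_iff by blast
  qed
  define g where "g x = lim (\<lambda>k. f k x)" for x
  have gm: "g \<in> borel_measurable lebesgue" unfolding g_def using m by measurable
  have bound: "(\<integral>\<^sup>+ x. ennreal ((f k x - g x)\<^sup>2) \<partial>lebesgue) \<le> ennreal (((1/4) ^ k)\<^sup>2)" for k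
  proof -
    have "(\<integral>\<^sup>+ x. ennreal ((f k x - g x)\<^sup>2) \<partial>lebesgue)
        = (\<integral>\<^sup>+ x. liminf (\<lambda>j. ennreal ((f k x - f j x)\<^sup>2)) \<partial>lebesgue)"
    proof (rule nn_integral_cong_AE, use conv in eventually_elim)
      case (elim x)
      then have "(\<lambda>j. ennreal ((f k x - f j x)\<^sup>2)) \<longlonglongrightarrow> ennreal ((f k x - g x)\<^sup>2)"
        unfolding g_def by (intro tendsto_intros)
      then show ?case by (rule lim_imp_Liminf[OF sequentially_bot, symmetric])
    qed
    also have "\<dots> \<le> liminf (\<lambda>j. \<integral>\<^sup>+ x. ennreal ((f k x - f j x)\<^sup>2) \<partial>lebesgue)"
      using m by (intro nn_integral_liminf) measurable
    also have "\<dots> \<le> ennreal (((1/4) ^ k)\<^sup>2)"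
    proof (rule Liminf_le)
      have "(\<integral>\<^sup>+ x. ennreal ((f k x - f j x)\<^sup>2) \<partial>lebesgue) \<le> ennreal (((1/4) ^ k)\<^sup>2)" if "k \<le> j" for j
        unfolding nn_integral_square[OF square_integrable_diff[OF f(1) f(1)]]
          abs_L2_diff[OF f(1) f(1), symmetric] f
        using fast[OF that] by (intro ennreal_leI power_mono) (simp_all add: norm_minus_commute)
      then show "\<forall>\<^sub>F j in sequentially.
          (\<integral>\<^sup>+ x. ennreal ((f k x - f j x)\<^sup>2) \<partial>lebesgue) \<le> ennreal (((1/4) ^ k)\<^sup>2)"
        by (rule eventually_sequentiallyI)
    qed simp
    finally show ?thesis .
  qed
  have diff: "square_integrable (\<lambda>x. f k x - g x)" for k
    unfolding square_integrable_def
  proof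
    show "(\<lambda>x. f k x - g x) \<in> borel_measurable lebesgue" using m gm by measurable
    then show "integrable lebesgue (\<lambda>x. (f k x - g x)\<^sup>2)"
      using bound[of k] by (intro integrableI_bounded) (auto simp: less_top[symmetric] top_unique)
  qed
  have g: "square_integrable g"
    using square_integrable_diff[OF f(1) diff, of 0 0] by simp
  have "norm (V k - abs_L2 g) \<le> (1/4) ^ k" for k
  proof -
    have "ennreal ((norm (V k - abs_L2 g))\<^sup>2) \<le> ennreal (((1/4) ^ k)\<^sup>2)"
      using bound[of k] nn_integral_square[OF diff[of k]] abs_L2_diff[OF f(1) g, of k] f(2)[of k] by simp
    then have "(norm (V k - abs_L2 g))\<^sup>2 \<le> ((1/4) ^ k)\<^sup>2" by (simp add: ennreal_le_iff)
    then show ?thesis by (rule power2_le_imp_le) simp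
  qed
  then show ?thesis using that by blast
qed

instance L2 :: (euclidean_space) banach
proof
  fix X :: "nat \<Rightarrow> 'a L2"
  assume X: "Cauchy X"
  have "\<exists>N. \<forall>m\<ge>N. \<forall>n\<ge>N. norm (X m - X n) < (1/4) ^ k" for k
    using CauchyD[OF X, of "(1/4) ^ k"] by simp
  then obtain N where N: "\<And>k m n. N k \<le> m \<Longrightarrow> N k \<le> n \<Longrightarrow> norm (X m - X n) < (1/4) ^ k" by metis
  \<comment> \<open>Summing makes the thresholds increasing.\<close>
  define r where "r k = (\<Sum>i\<le>k. N i)" for k
  have r: "N k \<le> r j" if "k \<le> j" for j k
    unfolding r_def using that by (intro member_le_sum) auto
  have "norm (X (r j) - X (r k)) \<le> (1/4) ^ k" if "k \<le> j" for j k
    using N[OF r[OF that] r[OF order.refl]] by simp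
  then obtain G where G: "\<And>k. norm (X (r k) - G) \<le> (1/4) ^ k"
    using L2_fast_Cauchy_convergent[of "\<lambda>k. X (r k)"] by metis
  have "X \<longlonglongrightarrow> G"
  proof (rule LIMSEQ_I)
    fix e :: real assume e: "e > 0"
    obtain k where k: "(1/4 :: real) ^ k < e / 2"
      using real_arch_pow_inv[of "e / 2" "1/4"] e by auto
    have "norm (X n - G) < e" if "n \<ge> N k" for n
    proof -
      have "norm (X n - G) \<le> norm (X n - X (r k)) + norm (X (r k) - G)"
        using norm_triangle_ineq[of "X n - X (r k)" "X (r k) - G"] by simp
      also have "\<dots> \<le> (1/4) ^ k + (1/4) ^ k"
        using N[OF that r[OF order.refl]] G[of k] by (intro add_mono) auto
      finally show ?thesis using k by simp
    qed
    then show "\<exists>n0. \<forall>n\<ge>n0. norm (X n - G) < e" by blast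
  qed
  then show "convergent X" by (rule convergentI)
qed

section \<open>Lebesgue measurable functions on \<open>\<real> \<times> 'a\<close>\<close>

lemma null_sets_vimage_snd:
  assumes N: "N \<in> null_sets (lborel :: 'a::euclidean_space measure)"
  shows "(snd -` N :: ('b::euclidean_space \<times> 'a) set) \<in> null_sets lborel"
proof -
  have "(snd -` N :: ('b \<times> 'a) set) = UNIV \<times> N" by auto
  moreover have "(UNIV :: 'b set) \<times> N \<in> null_sets (lborel \<Otimes>\<^sub>M lborel)"
    using N by (auto simp: null_sets_def lborel.emeasure_pair_measure_Times)
  ultimately show ?thesis by (simp add: lborel_prod)
qed

lemma measurable_snd_lebesgue:
  "(snd :: 'b::euclidean_space \<times> 'a::euclidean_space \<Rightarrow> 'a) \<in> lebesgue \<rightarrow>\<^sub>M lebesgue"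
proof (rule completion.measurable_completion2)
  let ?s = "snd :: 'b \<times> 'a \<Rightarrow> 'a"
  have s: "?s \<in> lborel \<rightarrow>\<^sub>M lborel" by (simp add: borel_measurable_continuous_onI continuous_on_snd)
  then show "?s \<in> lebesgue \<rightarrow>\<^sub>M lborel" by (rule measurable_completion)
  have "emeasure (distr lborel lborel ?s) N = 0" if N: "N \<in> null_sets lborel" for N
    using null_sets_vimage_snd[OF N, where 'b = 'b] N s by (subst emeasure_distr) auto
  then show "null_sets lborel \<subseteq> null_sets (distr lebesgue lborel ?s)"
    unfolding distr_completion[OF s] by (auto simp: null_sets_def)
qed

lemma AE_lebesgue_prod:
  fixes P :: "'b::euclidean_space \<times> 'a::euclidean_space \<Rightarrow> bool"
  assumes "AE p in lebesgue. P p"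
  shows "AE t in lebesgue. AE x in lebesgue. P (t, x)"
proof -
  have "AE p in lborel \<Otimes>\<^sub>M lborel. P p" using assms unfolding AE_completion_iff lborel_prod .
  from lborel_pair.AE_pair[OF this] show ?thesis by (simp add: AE_completion_iff)
qed

lemma AE_snd_lebesgue:
  fixes P :: "'a::euclidean_space \<Rightarrow> bool"
  assumes "AE x in lebesgue. P x"
  shows "AE p in lebesgue. P (snd (p :: 'b::euclidean_space \<times> 'a))"
proof -
  have "AE x in lborel. P x" using assms by (simp add: AE_completion_iff)
  then obtain N where N: "N \<in> null_sets lborel" "{x. \<not> P x} \<subseteq> N"
    by (auto simp: eventually_ae_filter)
  have "AE p in lborel. P (snd (p :: 'b \<times> 'a))"
    by (rule AE_I'[OF null_sets_vimage_snd[OF N(1)]]) (use N(2) in auto)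
  then show ?thesis by (rule AE_completion)
qed

text \<open>Lebesgue measure on \<open>\<real> \<times> 'a\<close> is the completion of a product measure rather than a product, so
  Fubini's and Tonelli's theorems are applied to a Borel function that agrees almost everywhere.\<close>

theorem lebesgue_Fubini:
  fixes G :: "'b::euclidean_space \<times> 'a::euclidean_space \<Rightarrow> real"
  assumes G: "integrable lebesgue G"
  shows "integrable lebesgue (\<lambda>t. LINT x|lebesgue. G (t, x))"
    and "(LINT t|lebesgue. LINT x|lebesgue. G (t, x)) = (LINT p|lebesgue. G p)"
proof -
  obtain H where H: "H \<in> borel_measurable lborel" "AE p in lborel. G p = H p"
    using completion_ex_borel_measurable_real[of G lborel] G by auto
  have Hm: "H \<in> borel_measurable lebesgue" using H(1) by (rule measurable_completion)
  have GH: "AE p in lebesgue. G p = H p" using H(2) by (rule AE_completion)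
  have "integrable lebesgue H" using G Hm GH integrable_cong_AE_imp by blast
  then have intH: "integrable (lborel \<Otimes>\<^sub>M lborel) H"
    using integrable_completion[OF H(1)] by (simp add: lborel_prod)
  have slice: "AE t in lebesgue. (LINT x|lebesgue. G (t, x)) = (LINT x|lborel. H (t, x))"
    using AE_lebesgue_prod[OF GH]
  proof eventually_elim
    case (elim t)
    have Ht: "(\<lambda>x. H (t, x)) \<in> borel_measurable lborel"
      using H(1) by (simp add: lborel_prod[symmetric])
    have "(LINT x|lebesgue. G (t, x)) = (LINT x|lebesgue. H (t, x))"
    proof (rule integral_cong_AE)
      show "(\<lambda>x. H (t, x)) \<in> borel_measurable lebesgue" using Ht by (rule measurable_completion)
      then show "(\<lambda>x. G (t, x)) \<in> borel_measurable lebesgue"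
        by (rule borel_measurable_AE) (use elim in \<open>simp add: eq_commute\<close>)
    qed (rule elim)
    then show ?case by (simp add: integral_completion[OF Ht])
  qed
  have "integrable lborel (\<lambda>t. LINT x|lborel. H (t, x))"
    by (rule lborel_pair.integrable_fst'[OF intH])
  moreover from this have m: "(\<lambda>t. LINT x|lborel. H (t, x)) \<in> borel_measurable lborel" by simp
  ultimately have intI: "integrable lebesgue (\<lambda>t. LINT x|lborel. H (t, x))"
    by (simp add: integrable_completion)
  have mG: "(\<lambda>t. LINT x|lebesgue. G (t, x)) \<in> borel_measurable lebesgue"
    by (rule borel_measurable_AE[OF measurable_completion[OF m]]) (use slice in \<open>simp add: eq_commute\<close>)
  show "integrable lebesgue (\<lambda>t. LINT x|lebesgue. G (t, x))"
    by (rule integrable_cong_AE_imp[OF intI mG]) (use slice in \<open>simp add: eq_commute\<close>)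
  have "(LINT t|lebesgue. LINT x|lebesgue. G (t, x)) = (LINT t|lebesgue. LINT x|lborel. H (t, x))"
    by (rule integral_cong_AE[OF mG measurable_completion[OF m] slice])
  also have "\<dots> = (LINT t|lborel. LINT x|lborel. H (t, x))" by (rule integral_completion[OF m])
  also have "\<dots> = (LINT p|lborel. H p)"
    using lborel_pair.integral_fst'[OF intH] by (simp add: lborel_prod)
  also have "\<dots> = (LINT p|lebesgue. H p)" by (rule integral_completion[OF H(1), symmetric])
  also have "\<dots> = (LINT p|lebesgue. G p)"
    using G Hm GH by (intro integral_cong_AE) (auto simp: eq_commute)
  finally show "(LINT t|lebesgue. LINT x|lebesgue. G (t, x)) = (LINT p|lebesgue. G p)" .
qed

lemma lebesgue_Tonelli:
  fixes h :: "'b::euclidean_space \<times> 'a::euclidean_space \<Rightarrow> real"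
  assumes h: "h \<in> borel_measurable lebesgue"
  shows "(\<integral>\<^sup>+ p. ennreal (h p) \<partial>lebesgue) = (\<integral>\<^sup>+ t. \<integral>\<^sup>+ x. ennreal (h (t, x)) \<partial>lebesgue \<partial>lebesgue)"
proof -
  obtain H where H: "H \<in> borel_measurable lborel" "AE p in lborel. h p = H p"
    using completion_ex_borel_measurable_real[OF h] by blast
  have hH: "AE p in lebesgue. h p = H p" using H(2) by (rule AE_completion)
  have "(\<integral>\<^sup>+ p. ennreal (h p) \<partial>lebesgue) = (\<integral>\<^sup>+ p. ennreal (H p) \<partial>lebesgue)"
    by (rule nn_integral_cong_AE) (use hH in eventually_elim, simp)
  also have "\<dots> = (\<integral>\<^sup>+ p. ennreal (H p) \<partial>(lborel \<Otimes>\<^sub>M lborel))"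
    by (simp add: nn_integral_completion lborel_prod)
  also have "\<dots> = (\<integral>\<^sup>+ t. \<integral>\<^sup>+ x. ennreal (H (t, x)) \<partial>lborel \<partial>lborel)"
    using H(1) by (intro lborel.nn_integral_fst[symmetric]) (simp add: lborel_prod)
  also have "\<dots> = (\<integral>\<^sup>+ t. \<integral>\<^sup>+ x. ennreal (H (t, x)) \<partial>lebesgue \<partial>lebesgue)"
    by (simp add: nn_integral_completion)
  also have "\<dots> = (\<integral>\<^sup>+ t. \<integral>\<^sup>+ x. ennreal (h (t, x)) \<partial>lebesgue \<partial>lebesgue)"
  proof (rule nn_integral_cong_AE, use AE_lebesgue_prod[OF hH] in eventually_elim)
    case (elim t)
    show ?case by (rule nn_integral_cong_AE) (use elim in eventually_elim, simp)
  qed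
  finally show ?thesis .
qed

section \<open>Functions of \<open>(t, x)\<close> representing curves in \<open>L\<^sup>2\<close>\<close>

text \<open>Step functions in \<open>t\<close> are jointly measurable, and uniform continuity makes them converge so fast
  that the limit exists almost everywhere in \<open>x\<close> for every single \<open>t\<close>.\<close>

theorem represents_curve_exists:
  fixes U :: "real \<Rightarrow> 'a::euclidean_space L2"
  assumes U: "uniformly_continuous_on {0..} U"
  shows "\<exists>u. represents_curve u U"
proof -
  have "\<exists>d>0. \<forall>t\<ge>0. \<forall>s\<ge>0. dist s t < d \<longrightarrow> dist (U s) (U t) < (1/2) ^ k" for k
  proof -
    have "(1/2 :: real) ^ k > 0" by simp
    with U show ?thesis unfolding uniformly_continuous_on_def atLeast_iff by blast
  qed
  then obtain d where d: "\<And>k. d k > 0"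
    "\<And>k s t. t \<ge> 0 \<Longrightarrow> s \<ge> 0 \<Longrightarrow> dist s t < d k \<Longrightarrow> dist (U s) (U t) < (1/2) ^ k" by metis
  define grid where "grid k t = d k * of_int \<lfloor>t / d k\<rfloor>" for k t
  have grid: "grid k t \<ge> 0" "dist (grid k t) t < d k" if "t \<ge> 0" for k t
  proof -
    have *: "of_int \<lfloor>t / d k\<rfloor> * d k \<le> t" "t < (of_int \<lfloor>t / d k\<rfloor> + 1) * d k"
      using floor_divide_lower[OF d(1)] floor_divide_upper[OF d(1)] by blast+
    then show "dist (grid k t) t < d k" by (simp add: grid_def dist_real_def algebra_simps)
    have "0 \<le> \<lfloor>t / d k\<rfloor>" using that d(1)[of k] by simp
    then show "grid k t \<ge> 0" using d(1)[of k] by (simp add: grid_def)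
  qed
  define f where "f k = (\<lambda>p. rep_L2 (U (grid k (fst p))) (snd p))" for k
  have fm: "f k \<in> borel_measurable lebesgue" for k
  proof -
    have "(\<lambda>p. (\<lambda>(i::int) p. rep_L2 (U (d k * of_int i)) (snd (p :: real \<times> 'a))) (\<lfloor>fst p / d k\<rfloor>) p)
        \<in> borel_measurable lebesgue"
    proof (rule measurable_compose_countable)
      show "(\<lambda>p::real \<times> 'a. \<lfloor>fst p / d k\<rfloor>) \<in> lebesgue \<rightarrow>\<^sub>M count_space UNIV"
      proof (rule measurable_completion)
        have "(\<lambda>p::real \<times> 'a. fst p / d k) \<in> borel_measurable lborel"
          using d(1)[of k] by (simp, intro borel_measurable_continuous_onI continuous_intros) auto
        then show "(\<lambda>p::real \<times> 'a. \<lfloor>fst p / d k\<rfloor>) \<in> lborel \<rightarrow>\<^sub>M count_space UNIV" by measurable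
      qed
      fix i :: int
      show "(\<lambda>p::real \<times> 'a. rep_L2 (U (d k * of_int i)) (snd p)) \<in> borel_measurable lebesgue"
        using square_integrable_rep
        by (intro measurable_compose[OF measurable_snd_lebesgue]) (auto simp: square_integrable_def)
    qed
    then show ?thesis by (simp add: f_def grid_def)
  qed
  define u where "u p = lim (\<lambda>k. f k p)" for p
  have "u \<in> borel_measurable lebesgue" unfolding u_def using fm by measurable
  then have "u \<in> borel_measurable (lebesgue_on closed_half_space)" by (rule measurable_restrict_space1)
  moreover have "AE x in lebesgue. u (t, x) = rep_L2 (U t) x" if t: "t \<ge> 0" for t
  proof -
    have "AE x in lebesgue. (\<lambda>k. rep_L2 (U (grid k t)) x) \<longlonglongrightarrow> rep_L2 (U t) x"
    proof (rule AE_tendsto_if_summable[OF square_integrable_rep])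
      have "summable (\<lambda>k. (1/4 :: real) ^ k)" by (rule summable_geometric) simp
      then show "summable (\<lambda>k. (norm (abs_L2 (rep_L2 (U (grid k t))) - U t))\<^sup>2)"
      proof (rule summable_comparison_test')
        fix k :: nat
        have "norm (U (grid k t) - U t) \<le> (1/2) ^ k"
          using d(2)[OF t grid[OF t], of k] by (simp add: dist_norm)
        then have "(norm (U (grid k t) - U t))\<^sup>2 \<le> ((1/2) ^ k)\<^sup>2" by (rule power_mono) simp
        also have "\<dots> = (1/4) ^ k" by (simp add: power2_eq_square power_mult_distrib[symmetric])
        finally show "norm ((norm (abs_L2 (rep_L2 (U (grid k t))) - U t))\<^sup>2) \<le> (1/4) ^ k"
          by (simp add: abs_rep)
      qed
    qed
    then show ?thesis
      by eventually_elim (simp add: u_def f_def limI)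
  qed
  ultimately show ?thesis unfolding represents_curve_def by blast
qed

section \<open>Test functions as curves in \<open>L\<^sup>2\<close>\<close>

text \<open>A condition that a test function shares with its derivatives; it provides uniform continuity and a
  common ball containing the supports in \<open>x\<close>. The value at \<open>t = r\<close> is \<open>0\<close>, so \<open>[0, r]\<close> carries the
  whole weak formulation without a boundary term at \<open>r\<close>.\<close>

definition box_supported :: "real \<Rightarrow> real \<Rightarrow> (real \<times> 'a::euclidean_space \<Rightarrow> real) \<Rightarrow> bool" where
  "box_supported r R g \<longleftrightarrow> continuous_on closed_half_space g \<and>
     (\<forall>t x. 0 \<le> t \<longrightarrow> r \<le> t \<or> R < norm x \<longrightarrow> g (t, x) = 0)"

lemma box_supported_0: "box_supported r R g \<Longrightarrow> 0 \<le> t \<Longrightarrow> r \<le> t \<or> R < norm x \<Longrightarrow> g (t, x) = 0"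
  by (auto simp: box_supported_def)

lemma box_supported_continuous: "box_supported r R g \<Longrightarrow> continuous_on ({0..r} \<times> cball 0 R) g"
  unfolding box_supported_def closed_half_space_def
  by (rule continuous_on_subset[of "{0..} \<times> UNIV"]) auto

lemma box_supported_bounded:
  fixes g :: "real \<times> 'a::euclidean_space \<Rightarrow> real"
  assumes g: "box_supported r R g"
  shows "\<exists>C\<ge>0. \<forall>t x. 0 \<le> t \<longrightarrow> \<bar>g (t, x)\<bar> \<le> C"
proof -
  have "compact (g ` ({0..r} \<times> cball 0 R))"
    by (intro compact_continuous_image box_supported_continuous[OF g] compact_Times) auto
  then have "bounded (g ` ({0..r} \<times> cball 0 R))" by (rule compact_imp_bounded)
  then obtain C where C: "\<forall>y\<in>g ` ({0..r} \<times> cball 0 R). norm y \<le> C"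
    unfolding bounded_iff by (rule exE)
  have "\<bar>g (t, x)\<bar> \<le> max C 0" if "0 \<le> t" for t x
  proof (cases "t \<le> r \<and> norm x \<le> R")
    case True
    then have "(t, x) \<in> {0..r} \<times> cball 0 R" using that by simp
    then have "norm (g (t, x)) \<le> C" using bspec[OF C imageI] by blast
    then show ?thesis by simp
  next
    case False
    then have "r \<le> t \<or> R < norm x" by auto
    then have "g (t, x) = 0" by (rule box_supported_0[OF g that])
    then show ?thesis by simp
  qed
  then show ?thesis by (intro exI[of _ "max C 0"]) auto
qed

lemma box_supported_uniform:
  fixes g :: "real \<times> 'a::euclidean_space \<Rightarrow> real"
  assumes g: "box_supported r R g" and e: "e > 0"
  shows "\<exists>d>0. \<forall>s\<in>{0..r}. \<forall>t\<in>{0..r}. \<bar>s - t\<bar> < d \<longrightarrow>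
      (\<forall>x. \<bar>g (s, x) - g (t, x)\<bar> \<le> e * indicator (cball 0 R) x)"
proof -
  have "uniformly_continuous_on ({0..r} \<times> cball 0 R) g"
    by (intro compact_uniformly_continuous box_supported_continuous[OF g] compact_Times) auto
  then obtain d where d: "d > 0"
    "\<forall>p\<in>{0..r} \<times> cball 0 R. \<forall>q\<in>{0..r} \<times> cball 0 R. dist q p < d \<longrightarrow> dist (g q) (g p) < e"
    using e unfolding uniformly_continuous_on_def by blast
  have "\<bar>g (s, x) - g (t, x)\<bar> \<le> e * indicator (cball 0 R) x"
    if "s \<in> {0..r}" "t \<in> {0..r}" "\<bar>s - t\<bar> < d" for s t x
  proof (cases "x \<in> cball 0 R")
    case True
    have "dist (s, x) (t, x) < d" using that(3) by (simp add: dist_Pair_Pair dist_real_def)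
    then have "dist (g (s, x)) (g (t, x)) < e" using that True by (intro d(2)[rule_format]) auto
    then show ?thesis using True by (simp add: dist_real_def)
  next
    case False
    then have "g (s, x) = 0" "g (t, x) = 0" using that by (auto intro!: box_supported_0[OF g])
    then show ?thesis using False by simp
  qed
  then show ?thesis using d(1) by (intro exI[of _ d]) simp
qed

lemma box_supported_slice_continuous:
  assumes g: "box_supported r R g" and t: "0 \<le> t"
  shows "continuous_on UNIV (\<lambda>x. g (t, x))"
proof -
  have cont: "continuous_on ({0..} \<times> UNIV) g"
    using g by (simp add: box_supported_def closed_half_space_def)
  show ?thesis
    by (rule continuous_on_compose2[OF cont]) (use t in \<open>auto intro!: continuous_intros\<close>)
qed

lemma box_supported_slice_measurable:
  fixes g :: "real \<times> 'a::euclidean_space \<Rightarrow> real"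
  assumes g: "box_supported r R g" and t: "0 \<le> t"
  shows "(\<lambda>x. g (t, x)) \<in> borel_measurable lebesgue"
proof (rule measurable_completion)
  have "continuous_on UNIV (\<lambda>x. g (t, x))" by (rule box_supported_slice_continuous[OF g t])
  then show "(\<lambda>x. g (t, x)) \<in> borel_measurable lborel"
    by (simp add: borel_measurable_continuous_onI)
qed

lemma square_integrable_bounded_on_ball:
  fixes h :: "'a::euclidean_space \<Rightarrow> real"
  assumes h: "h \<in> borel_measurable lebesgue" and D: "D \<ge> 0"
    and le: "AE x in lebesgue. \<bar>h x\<bar> \<le> D * indicator (cball 0 R) x"
  shows "square_integrable h" "norm (abs_L2 h) \<le> D * sqrt (measure lebesgue (cball 0 R :: 'a set))"
proof -
  let ?B = "cball 0 R :: 'a set"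
  have B: "integrable lebesgue (\<lambda>x. D\<^sup>2 * indicator ?B x :: real)"
    using lmeasurable_cball by (intro integrable_mult_right) (simp add: lmeasurable_iff_integrable)
  have sq: "AE x in lebesgue. (h x)\<^sup>2 \<le> D\<^sup>2 * indicator ?B x"
    using le
  proof eventually_elim
    case (elim x)
    then have "\<bar>h x\<bar>\<^sup>2 \<le> (D * indicator ?B x)\<^sup>2" by (intro power_mono) auto
    then show ?case by (cases "x \<in> ?B") (simp_all add: power_mult_distrib)
  qed
  have int: "integrable lebesgue (\<lambda>x. (h x)\<^sup>2)"
  proof (rule Bochner_Integration.integrable_bound[OF B])
    show "(\<lambda>x. (h x)\<^sup>2) \<in> borel_measurable lebesgue" using h by simp
    show "AE x in lebesgue. norm ((h x)\<^sup>2) \<le> norm (D\<^sup>2 * indicator ?B x :: real)"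
      using sq by eventually_elim simp
  qed
  then show s: "square_integrable h" using h by (simp add: square_integrable_def)
  have "(norm (abs_L2 h))\<^sup>2 \<le> (LINT x|lebesgue. D\<^sup>2 * indicator ?B x)"
    unfolding norm_abs_L2[OF s] by (rule integral_mono_AE[OF int B sq])
  also have "\<dots> = (D * sqrt (measure lebesgue ?B))\<^sup>2" by (simp add: power_mult_distrib)
  finally show "norm (abs_L2 h) \<le> D * sqrt (measure lebesgue ?B)"
    by (rule power2_le_imp_le) (use D in simp)
qed

definition bounded_coefficient :: "real \<Rightarrow> ('a::euclidean_space \<Rightarrow> real) \<Rightarrow> bool" where
  "bounded_coefficient K c \<longleftrightarrow> 0 \<le> K \<and> c \<in> borel_measurable lebesgue \<and> (AE x in lebesgue. \<bar>c x\<bar> \<le> K)"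

lemma slice_square_integrable:
  assumes c: "bounded_coefficient K c" and g: "box_supported r R g" and t: "0 \<le> t"
  shows "square_integrable (\<lambda>x. c x * g (t, x))"
proof -
  obtain C where C: "C \<ge> 0" "\<And>t x. 0 \<le> t \<Longrightarrow> \<bar>g (t, x)\<bar> \<le> C"
    using box_supported_bounded[OF g] by blast
  have K: "0 \<le> K" "c \<in> borel_measurable lebesgue" "AE x in lebesgue. \<bar>c x\<bar> \<le> K"
    using c by (auto simp: bounded_coefficient_def)
  show ?thesis
  proof (rule square_integrable_bounded_on_ball(1)[of _ "K * C" R])
    show "(\<lambda>x. c x * g (t, x)) \<in> borel_measurable lebesgue"
      using K(2) box_supported_slice_measurable[OF g t] by (rule borel_measurable_times)
    show "AE x in lebesgue. \<bar>c x * g (t, x)\<bar> \<le> K * C * indicator (cball 0 R) x"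
      using K(3)
    proof eventually_elim
      case (elim x)
      show ?case
      proof (cases "x \<in> cball 0 R")
        case True
        then show ?thesis using elim C(2)[OF t, of x] K(1) by (simp add: abs_mult mult_mono)
      next
        case False
        then show ?thesis using box_supported_0[OF g t] by simp
      qed
    qed
  qed (use K C in simp)
qed

lemma slice_curve_continuous:
  fixes c :: "'a::euclidean_space \<Rightarrow> real"
  assumes c: "bounded_coefficient K c" and g: "box_supported r R g"
  shows "continuous_on {0..r} (\<lambda>t. abs_L2 (\<lambda>x. c x * g (t, x)))"
  unfolding continuous_on_iff
proof (intro ballI allI impI)
  fix t and e :: real assume t: "t \<in> {0..r}" and e: "e > 0"
  have K: "0 \<le> K" "c \<in> borel_measurable lebesgue" "AE x in lebesgue. \<bar>c x\<bar> \<le> K"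
    using c by (auto simp: bounded_coefficient_def)
  define m where "m = sqrt (measure lebesgue (cball 0 R :: 'a set))"
  have m: "m \<ge> 0" by (simp add: m_def)
  define e' where "e' = e / (2 * (K * m + 1))"
  have e': "e' > 0" using e K(1) m by (simp add: e'_def add_nonneg_pos)
  obtain d where d: "d > 0" "\<forall>s\<in>{0..r}. \<forall>t\<in>{0..r}. \<bar>s - t\<bar> < d \<longrightarrow>
      (\<forall>x. \<bar>g (s, x) - g (t, x)\<bar> \<le> e' * indicator (cball 0 R) x)"
    using box_supported_uniform[OF g e'] by blast
  have "dist (abs_L2 (\<lambda>x. c x * g (s, x))) (abs_L2 (\<lambda>x. c x * g (t, x))) < e"
    if s: "s \<in> {0..r}" "dist s t < d" for s
  proof -
    have sm: "square_integrable (\<lambda>x. c x * g (s, x))" "square_integrable (\<lambda>x. c x * g (t, x))"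
      using s t by (auto intro: slice_square_integrable[OF c g])
    have "norm (abs_L2 (\<lambda>x. c x * g (s, x) - c x * g (t, x))) \<le> (K * e') * m"
      unfolding m_def
    proof (rule square_integrable_bounded_on_ball(2))
      show "(\<lambda>x. c x * g (s, x) - c x * g (t, x)) \<in> borel_measurable lebesgue"
        using square_integrable_diff[OF sm] by (simp add: square_integrable_def)
      show "AE x in lebesgue. \<bar>c x * g (s, x) - c x * g (t, x)\<bar> \<le> K * e' * indicator (cball 0 R) x"
        using K(3)
      proof eventually_elim
        case (elim x)
        have "\<bar>c x * g (s, x) - c x * g (t, x)\<bar> = \<bar>c x\<bar> * \<bar>g (s, x) - g (t, x)\<bar>"
          by (simp add: abs_mult[symmetric] right_diff_distrib)
        also have "\<dots> \<le> K * (e' * indicator (cball 0 R) x)"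
          using s t by (intro mult_mono elim d(2)[rule_format]) (auto simp: dist_real_def K(1))
        finally show ?case by (simp add: mult.assoc)
      qed
    qed (use K e' in simp)
    also have "(K * e') * m = (K * m) * e'" by simp
    also have "\<dots> \<le> (K * m + 1) * e'" using e' by (intro mult_right_mono) auto
    also have "\<dots> = e / 2" using K(1) m by (simp add: e'_def field_simps add_nonneg_eq_0_iff)
    finally show ?thesis using e by (simp add: dist_norm abs_L2_diff[OF sm])
  qed
  then show "\<exists>d>0. \<forall>s\<in>{0..r}. dist s t < d \<longrightarrow>
      dist (abs_L2 (\<lambda>x. c x * g (s, x))) (abs_L2 (\<lambda>x. c x * g (t, x))) < e"
    using d(1) by blast
qed

lemma bounded_coefficient_one: "bounded_coefficient 1 (\<lambda>x. 1)"
  by (simp add: bounded_coefficient_def)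

lemmas slice_square_integrable_one = slice_square_integrable[OF bounded_coefficient_one, simplified]
lemmas slice_curve_continuous_one = slice_curve_continuous[OF bounded_coefficient_one, simplified]

text \<open>The difference quotients in \<open>t\<close> converge uniformly in \<open>x\<close> by the mean value theorem, and
  hence in \<open>L\<^sup>2\<close>, because all supports lie in a fixed ball.\<close>

lemma slice_curve_derivative:
  fixes f g :: "real \<times> 'a::euclidean_space \<Rightarrow> real"
  assumes f: "box_supported r R f" and g: "box_supported r R g"
    and fg: "\<And>t x. t > 0 \<Longrightarrow> ((\<lambda>s. f (s, x)) has_real_derivative g (t, x)) (at t)"
    and t: "t \<in> {0<..<r}"
  shows "((\<lambda>s. abs_L2 (\<lambda>x. f (s, x))) has_vector_derivative abs_L2 (\<lambda>x. g (t, x))) (at t)"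
proof -
  have "((\<lambda>s. abs_L2 (\<lambda>x. f (s, x))) has_vector_derivative abs_L2 (\<lambda>x. g (t, x))) (at t within {0<..<r})"
    unfolding has_vector_derivative_def has_derivative_within_alt
  proof (intro conjI allI impI)
    show "bounded_linear (\<lambda>h. h *\<^sub>R abs_L2 (\<lambda>x. g (t, x)))" by (rule bounded_linear_scaleR_left)
    fix e :: real assume e: "e > 0"
    define m where "m = sqrt (measure lebesgue (cball 0 R :: 'a set))"
    have m: "m \<ge> 0" by (simp add: m_def)
    define e' where "e' = e / (m + 1)"
    have e': "e' > 0" using e m by (simp add: e'_def add_nonneg_pos)
    obtain d where d: "d > 0" "\<forall>s\<in>{0..r}. \<forall>t\<in>{0..r}. \<bar>s - t\<bar> < d \<longrightarrow>
        (\<forall>x. \<bar>g (s, x) - g (t, x)\<bar> \<le> e' * indicator (cball 0 R) x)"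
      using box_supported_uniform[OF g e'] by blast
    have "norm (abs_L2 (\<lambda>x. f (s, x)) - abs_L2 (\<lambda>x. f (t, x)) - (s - t) *\<^sub>R abs_L2 (\<lambda>x. g (t, x)))
        \<le> e * norm (s - t)"
      if s: "s \<in> {0<..<r}" "norm (s - t) < d" for s
    proof -
      have fs: "square_integrable (\<lambda>x. f (s, x))" and ft: "square_integrable (\<lambda>x. f (t, x))"
        and gt: "square_integrable (\<lambda>x. g (t, x))"
        using s t by (auto intro: slice_square_integrable_one[OF f] slice_square_integrable_one[OF g])
      let ?h = "\<lambda>x. f (s, x) - f (t, x) - (s - t) * g (t, x)"
      have sq: "square_integrable ?h" by (intro square_integrable_diff square_integrable_scale fs ft gt)
      have pw: "\<bar>?h x\<bar> \<le> (\<bar>s - t\<bar> * e') * indicator (cball 0 R) x" for x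
      proof (cases "s = t")
        case False
        have "\<exists>z. min s t < z \<and> z < max s t \<and>
            f (max s t, x) - f (min s t, x) = (max s t - min s t) * g (z, x)"
          using s t False by (intro MVT2 fg) auto
        then obtain z where z: "min s t < z" "z < max s t"
          "f (max s t, x) - f (min s t, x) = (max s t - min s t) * g (z, x)" by blast
        have "f (s, x) - f (t, x) = (s - t) * g (z, x)"
        proof (cases "s \<le> t")
          case True
          then have "f (t, x) - f (s, x) = (t - s) * g (z, x)" using z(3) by simp
          then show ?thesis by (simp add: left_diff_distrib)
        next
          case False
          then show ?thesis using z(3) by simp
        qed
        then have "\<bar>?h x\<bar> = \<bar>s - t\<bar> * \<bar>g (z, x) - g (t, x)\<bar>"
          by (simp add: abs_mult[symmetric] right_diff_distrib)
        also have "\<dots> \<le> \<bar>s - t\<bar> * (e' * indicator (cball 0 R) x)"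
          using z(1,2) s t by (intro mult_left_mono d(2)[rule_format]) auto
        finally show ?thesis by (simp add: mult.assoc)
      qed simp
      have "norm (abs_L2 ?h) \<le> (\<bar>s - t\<bar> * e') * m"
        unfolding m_def
      proof (rule square_integrable_bounded_on_ball(2))
        show "?h \<in> borel_measurable lebesgue" using sq by (simp add: square_integrable_def)
      qed (use e' pw in simp_all)
      also have "\<dots> \<le> (\<bar>s - t\<bar> * e') * (m + 1)" using e' by (intro mult_left_mono) auto
      also have "\<dots> = e * norm (s - t)" using m by (simp add: e'_def add_nonneg_eq_0_iff)
      finally show ?thesis
        by (simp add: abs_L2_diff abs_L2_scaleR fs ft gt square_integrable_diff square_integrable_scale)
    qed
    then show "\<exists>d>0. \<forall>s\<in>{0<..<r}. norm (s - t) < d \<longrightarrow>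
        norm (abs_L2 (\<lambda>x. f (s, x)) - abs_L2 (\<lambda>x. f (t, x)) - (s - t) *\<^sub>R abs_L2 (\<lambda>x. g (t, x)))
        \<le> e * norm (s - t)"
      using d(1) by blast
  qed
  then show ?thesis using t by (subst (asm) at_within_open) auto
qed

text \<open>The derivative of \<open>f\<close> within the half-space vanishes off the box where \<open>t > 0\<close>, by uniqueness of
  derivatives at interior points, and then at \<open>t = 0\<close> by continuity.\<close>

lemma test_function_derivatives:
  fixes f :: "real \<times> 'a::euclidean_space \<Rightarrow> real"
  assumes f: "Cinf_compact_on closed_half_space f"
  obtains r R g0 gx where "r > 0" "box_supported r R f" "box_supported r R g0" "\<And>v. box_supported r R (gx v)"
    "\<And>t x. t > 0 \<Longrightarrow> ((\<lambda>s. f (s, x)) has_real_derivative g0 (t, x)) (at t)"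
    "\<And>t x. t > 0 \<Longrightarrow> ((\<lambda>y. f (t, y)) has_derivative (\<lambda>v. gx v (t, x))) (at x)"
proof -
  let ?H = "closed_half_space :: (real \<times> 'a) set"
  have "Ck_on 1 ?H f" using f by (simp add: Cinf_compact_on_def)
  then obtain f' where f': "\<And>p. p \<in> ?H \<Longrightarrow> (f has_derivative f' p) (at p within ?H)"
    "\<And>v. continuous_on ?H (\<lambda>p. f' p v)" by auto
  have K: "compact (closure (support_on ?H f))" "closure (support_on ?H f) \<subseteq> ?H"
    using f by (auto simp: Cinf_compact_on_def compactly_supported_on_def)
  obtain \<rho> where \<rho>: "\<rho> > 0" "\<And>p. p \<in> closure (support_on ?H f) \<Longrightarrow> norm p \<le> \<rho>"
    using compact_imp_bounded[OF K(1)] bounded_pos by metis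
  define r where "r = \<rho> + 1"
  have off: "norm (t, x) > \<rho>" if "r \<le> t \<or> r < norm x" for t :: real and x :: 'a
  proof -
    have t: "\<bar>t\<bar> \<le> norm (t, x)" and x: "norm x \<le> norm (t, x)"
      using norm_fst_le[of t x] norm_snd_le[of x t] by simp_all
    from that show ?thesis
    proof
      assume "r \<le> t"
      then show ?thesis using t unfolding r_def by linarith
    next
      assume "r < norm x"
      then show ?thesis using x unfolding r_def by linarith
    qed
  qed
  have f0: "f p = 0" if "p \<in> ?H" "norm p > \<rho>" for p
  proof (rule ccontr)
    assume "f p \<noteq> 0"
    then have "p \<in> support_on ?H f" using that(1) by (simp add: in_support_on)
    then show False using \<rho>(2)[of p] that(2) closure_subset[of "support_on ?H f"] by fastforce
  qed
  have int: "(f has_derivative f' (t, x)) (at (t, x))" if "t > 0" for t x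
  proof -
    have "open ({0<..} \<times> UNIV :: (real \<times> 'a) set)" by (intro open_Times) auto
    then have "(t, x) \<in> interior ?H"
      by (rule interiorI) (use that in \<open>auto simp: closed_half_space_def\<close>)
    then have "at (t, x) within ?H = at (t, x)" by (rule at_within_interior)
    then show ?thesis using f'(1)[of "(t, x)"] that by (simp add: closed_half_space_def)
  qed
  have f'0: "f' (t, x) v = 0" if tx: "r \<le> t \<or> r < norm x" "0 < t" for t x v
  proof -
    let ?W = "{0<..} \<times> UNIV \<inter> {p :: real \<times> 'a. norm p > \<rho>}"
    have "open ?W" by (intro open_Int open_Times open_Collect_less continuous_intros) auto
    then have "((\<lambda>p. 0) has_derivative f' (t, x)) (at (t, x))"
    proof (rule has_derivative_transform_within_open[OF int[OF tx(2), of x]])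
      show "(t, x) \<in> ?W" using tx(2) off[OF tx(1)] by simp
      show "f p = 0" if "p \<in> ?W" for p
        using that by (intro f0) (auto simp: closed_half_space_def)
    qed
    then have "f' (t, x) = (\<lambda>v. 0)" by (rule has_derivative_unique[OF _ has_derivative_const])
    then show ?thesis by simp
  qed
  have box: "box_supported r r (\<lambda>p. f' p v)" for v
    unfolding box_supported_def
  proof (intro conjI allI impI)
    show "continuous_on ?H (\<lambda>p. f' p v)" by (rule f'(2))
    fix t :: real and x :: 'a assume t: "0 \<le> t" "r \<le> t \<or> r < norm x"
    show "f' (t, x) v = 0"
    proof (cases "t = 0")
      case True
      then have x: "r < norm x" using t(2) \<rho>(1) by (simp add: r_def)
      let ?p = "\<lambda>n. (1 / real (Suc n), x)"
      have "(\<lambda>n. 1 / real (Suc n)) \<longlonglongrightarrow> 0" by (rule LIMSEQ_Suc[OF lim_1_over_n])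
      then have "?p \<longlonglongrightarrow> (0, x)" by (intro tendsto_intros)
      then have "(\<lambda>n. f' (?p n) v) \<longlonglongrightarrow> f' (0, x) v"
        by (intro continuous_on_tendsto_compose[OF f'(2)[of v]]) (auto simp: closed_half_space_def)
      moreover have "f' (?p n) v = 0" for n using x by (intro f'0) auto
      ultimately have "(\<lambda>n. 0) \<longlonglongrightarrow> f' (0, x) v" by simp
      then have "f' (0, x) v = 0" by (rule LIMSEQ_unique[OF _ tendsto_const])
      then show ?thesis using True by simp
    next
      case False
      then show ?thesis using t(1) by (intro f'0[OF t(2)]) simp
    qed
  qed
  show ?thesis
  proof (rule that[of r r "\<lambda>p. f' p (1, 0)" "\<lambda>v p. f' p (0, v)"])
    show "r > 0" using \<rho>(1) by (simp add: r_def)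
    have "continuous_on ?H f"
      by (rule has_derivative_continuous_on[OF f'(1)])
    then show "box_supported r r f"
      unfolding box_supported_def
      by (intro conjI allI impI f0 off) (simp_all add: closed_half_space_def)
    fix t :: real and x :: 'a assume t: "t > 0"
    interpret L: bounded_linear "f' (t, x)" using int[OF t] by (rule has_derivative_bounded_linear)
    have "((\<lambda>s. (s, x)) has_derivative (\<lambda>h. (h, 0))) (at t)" by (auto intro!: derivative_eq_intros)
    then have "((\<lambda>s. f (s, x)) has_derivative (\<lambda>h. f' (t, x) (h, 0))) (at t)"
      by (rule has_derivative_compose[where f = "\<lambda>s. (s, x)" and g = f and g' = "f' (t, x)"])
        (rule int[OF t])
    moreover have "(\<lambda>h. f' (t, x) (h, 0)) = (\<lambda>h. f' (t, x) (1, 0) * h)"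
    proof
      fix h :: real
      show "f' (t, x) (h, 0) = f' (t, x) (1, 0) * h" using L.scaleR[of h "(1, 0)"] by (simp add: mult.commute)
    qed
    ultimately show "((\<lambda>s. f (s, x)) has_real_derivative f' (t, x) (1, 0)) (at t)"
      unfolding has_field_derivative_def by (simp only:)
    have "((\<lambda>y. (t, y)) has_derivative (\<lambda>v. (0, v))) (at x)" by (auto intro!: derivative_eq_intros)
    then show "((\<lambda>y. f (t, y)) has_derivative (\<lambda>v. f' (t, x) (0, v))) (at x)"
      by (rule has_derivative_compose[where f = "\<lambda>y. (t, y)" and g = f and g' = "f' (t, x)"])
        (rule int[OF t])
  qed (rule box)+
qed

lemma grad_eq:
  assumes "(\<phi> has_derivative \<phi>') (at x)"
  shows "inner (c :: 'a::euclidean_space) (grad \<phi> x) = (\<Sum>b\<in>Basis. inner c b * \<phi>' b)"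
  unfolding grad_def frechet_derivative_at[OF assms, symmetric]
  by (simp add: inner_sum_right mult.commute)

lemma slice_in_A0:
  fixes a :: "'a::euclidean_space \<Rightarrow> 'a"
  assumes f: "box_supported r R f" and gx: "\<And>v. box_supported r R (gx v)"
    and der: "\<And>x. ((\<lambda>y. f (t, y)) has_derivative (\<lambda>v. gx v (t, x))) (at x)" and t: "t > 0"
  shows "(abs_L2 (\<lambda>x. f (t, x)), abs_L2 (\<lambda>x. \<Sum>b\<in>Basis. inner (a x) b * gx b (t, x))) \<in> A0 a"
proof -
  let ?\<phi> = "\<lambda>x. f (t, x)"
  have cont: "continuous_on UNIV (\<lambda>x. gx v (t, x))" for v
    using box_supported_slice_continuous[OF gx] t by simp
  have "\<exists>\<phi>'. (\<forall>x\<in>UNIV. (?\<phi> has_derivative \<phi>' x) (at x within UNIV)) \<and> (\<forall>v. Ck_on 0 UNIV (\<lambda>x. \<phi>' x v))"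
    by (intro exI[of _ "\<lambda>x v. gx v (t, x)"]) (simp add: der cont)
  then have "Ck_on 1 UNIV ?\<phi>" by (simp only: One_nat_def Ck_on.simps)
  moreover have "compactly_supported_on UNIV ?\<phi>"
  proof -
    have "support_on UNIV ?\<phi> \<subseteq> cball 0 R"
      using box_supported_0[OF f, of t] t by (force simp: support_on_def)
    then have "bounded (support_on UNIV ?\<phi>)" using bounded_subset bounded_cball by blast
    then show ?thesis by (simp add: compactly_supported_on_def compact_closure)
  qed
  ultimately have "Ck_compact_on 1 UNIV ?\<phi>" by (simp add: Ck_compact_on_def)
  moreover have "inner (a x) (grad ?\<phi> x) = (\<Sum>b\<in>Basis. inner (a x) b * gx b (t, x))" for x
    by (rule grad_eq[OF der])
  ultimately show ?thesis unfolding A0_def by (intro CollectI exI[of _ ?\<phi>]) simp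
qed

section \<open>From the weak formulation in \<open>L\<^sup>2\<close> to generalized solutions\<close>

lemma square_integrable_set_integrable:
  assumes f: "square_integrable f" and K: "compact K"
  shows "set_integrable lebesgue K f"
  unfolding set_integrable_def
proof (rule Bochner_Integration.integrable_bound)
  have Kl: "K \<in> lmeasurable" using K by (rule lmeasurable_compact)
  show "integrable lebesgue (\<lambda>x. indicator K x + (f x)\<^sup>2 :: real)"
    using f Kl by (intro Bochner_Integration.integrable_add)
      (simp_all add: square_integrable_def lmeasurable_iff_integrable)
  show "(\<lambda>x. indicator K x *\<^sub>R f x) \<in> borel_measurable lebesgue"
    using f fmeasurableD[OF Kl]
    by (intro borel_measurable_scaleR borel_measurable_indicator) (simp_all add: square_integrable_def)
  have "\<bar>y\<bar> \<le> 1 + y\<^sup>2" for y :: real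
    using sum_squares_bound[of 1 "\<bar>y\<bar>"] zero_le_power2[of y] by simp
  then show "AE x in lebesgue. norm (indicator K x *\<^sub>R f x) \<le> norm (indicator K x + (f x)\<^sup>2 :: real)"
    by (intro AE_I2) (simp add: indicator_def)
qed

lemma closed_half_space_closed: "closed (closed_half_space :: (real \<times> 'a::euclidean_space) set)"
  unfolding closed_half_space_def by (intro closed_Times) auto

lemma represents_curve_measurable:
  fixes u :: "real \<times> 'a::euclidean_space \<Rightarrow> real"
  assumes "represents_curve u U"
  shows "(\<lambda>p. indicator closed_half_space p * u p) \<in> borel_measurable lebesgue"
proof -
  have "closed_half_space \<in> sets (lebesgue :: (real \<times> 'a) measure)"
    by (intro sets_completionI_sets) (simp add: borel_closed closed_half_space_closed)
  then show ?thesis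
    using assms borel_measurable_restrict_space_iff[of closed_half_space lebesgue u]
    by (simp add: represents_curve_def)
qed

lemma represents_curve_slice:
  assumes u: "represents_curve u U" and t: "t \<ge> 0"
  shows "square_integrable (\<lambda>x. u (t, x))" "abs_L2 (\<lambda>x. u (t, x)) = U t"
proof -
  have "AE x in lebesgue. u (t, x) = rep_L2 (U t) x"
    using u t by (simp add: represents_curve_def)
  then have ae: "AE x in lebesgue. rep_L2 (U t) x = u (t, x)" by eventually_elim simp
  have rep: "square_integrable (rep_L2 (U t))" by (rule square_integrable_rep)
  then have m: "(\<lambda>x. u (t, x)) \<in> borel_measurable lebesgue"
    unfolding square_integrable_def by (elim conjE) (rule borel_measurable_AE[OF _ ae])
  have "integrable lebesgue (\<lambda>x. (u (t, x))\<^sup>2)"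
  proof (rule integrable_cong_AE_imp)
    show "integrable lebesgue (\<lambda>x. (rep_L2 (U t) x)\<^sup>2)" using rep by (simp add: square_integrable_def)
    show "(\<lambda>x. (u (t, x))\<^sup>2) \<in> borel_measurable lebesgue" using m by simp
    show "AE x in lebesgue. (rep_L2 (U t) x)\<^sup>2 = (u (t, x))\<^sup>2" using ae by eventually_elim simp
  qed
  then show sq: "square_integrable (\<lambda>x. u (t, x))" using m by (simp add: square_integrable_def)
  show "abs_L2 (\<lambda>x. u (t, x)) = U t"
    using abs_L2_eqI[OF rep sq ae] by (simp add: abs_rep)
qed

text \<open>By Tonelli's theorem and \<open>\<bar>u\<bar> \<le> 1 + u\<^sup>2\<close>, a bound for \<open>\<parallel>U t\<parallel>\<close> controls the integral over a box.\<close>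

lemma represents_curve_integrable_box:
  fixes u :: "real \<times> 'a::euclidean_space \<Rightarrow> real"
  assumes u: "represents_curve u U" and N: "\<And>t. t \<ge> 0 \<Longrightarrow> norm (U t) \<le> N"
  shows "set_integrable lebesgue ({0..r} \<times> cball 0 R) u"
proof -
  let ?B = "cball 0 R :: 'a set" and ?Q = "{0..r} \<times> cball 0 R :: (real \<times> 'a) set"
  have "compact ?Q" by (intro compact_Times) auto
  then have Q: "?Q \<in> sets lebesgue" by (intro sets_completionI_sets) (auto simp: compact_imp_closed)
  have "(\<lambda>p. indicator ?Q p * (indicator closed_half_space p * u p)) \<in> borel_measurable lebesgue"
    by (rule borel_measurable_times[OF borel_measurable_indicator[OF Q] represents_curve_measurable[OF u]])
  also have "(\<lambda>p. indicator ?Q p * (indicator closed_half_space p * u p)) = (\<lambda>p. indicator ?Q p * u p)"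
    by (auto simp: indicator_def closed_half_space_def)
  finally have m: "(\<lambda>p. indicator ?Q p * u p) \<in> borel_measurable lebesgue" .
  define V where "V = measure lebesgue ?B"
  have V: "emeasure lebesgue ?B = ennreal V"
    unfolding V_def by (intro emeasure_eq_measure2 fmeasurableD2 lmeasurable_cball)
  have slice: "(\<integral>\<^sup>+ x. ennreal \<bar>indicator ?Q (t, x) * u (t, x)\<bar> \<partial>lebesgue)
      \<le> ennreal (V + N\<^sup>2) * indicator {0..r} t" for t
  proof (cases "t \<in> {0..r}")
    case True
    then have t: "t \<ge> 0" by simp
    note sq = represents_curve_slice[OF u t]
    have um: "(\<lambda>x. u (t, x)) \<in> borel_measurable lebesgue" using sq by (simp add: square_integrable_def)
    have le: "\<bar>y\<bar> \<le> 1 + y\<^sup>2" for y :: real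
      using sum_squares_bound[of 1 "\<bar>y\<bar>"] zero_le_power2[of y] by simp
    have "(\<integral>\<^sup>+ x. ennreal \<bar>indicator ?Q (t, x) * u (t, x)\<bar> \<partial>lebesgue)
        \<le> (\<integral>\<^sup>+ x. indicator ?B x + ennreal ((u (t, x))\<^sup>2) \<partial>lebesgue)"
    proof (rule nn_integral_mono)
      fix x
      show "ennreal \<bar>indicator ?Q (t, x) * u (t, x)\<bar> \<le> indicator ?B x + ennreal ((u (t, x))\<^sup>2)"
        using True le[of "u (t, x)"]
        by (auto simp: indicator_def ennreal_plus[symmetric] ennreal_1[symmetric] simp del: ennreal_plus ennreal_1
            intro!: ennreal_leI)
    qed
    also have "\<dots> = emeasure lebesgue ?B + (\<integral>\<^sup>+ x. ennreal ((u (t, x))\<^sup>2) \<partial>lebesgue)"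
      using um fmeasurableD[OF lmeasurable_cball, of 0 R]
      by (subst nn_integral_add) (auto intro: borel_measurable_indicator)
    also have "\<dots> = ennreal V + ennreal ((norm (U t))\<^sup>2)"
      by (simp add: V nn_integral_square[OF sq(1)] sq(2))
    also have "\<dots> \<le> ennreal V + ennreal (N\<^sup>2)"
      using N[OF t] by (intro add_left_mono ennreal_leI power_mono) auto
    also have "\<dots> = ennreal (V + N\<^sup>2)" by (rule ennreal_plus[symmetric]) (auto simp: V_def)
    finally show ?thesis using True by simp
  next
    case False
    then have "indicat_real ?Q (t, x) = 0" for x by auto
    then show ?thesis using False by simp
  qed
  have "(\<integral>\<^sup>+ p. ennreal \<bar>indicator ?Q p * u p\<bar> \<partial>lebesgue)
      = (\<integral>\<^sup>+ t. \<integral>\<^sup>+ x. ennreal \<bar>indicator ?Q (t, x) * u (t, x)\<bar> \<partial>lebesgue \<partial>lebesgue)"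
    using m by (intro lebesgue_Tonelli) simp
  also have "\<dots> \<le> (\<integral>\<^sup>+ t. ennreal (V + N\<^sup>2) * indicator {0..r} t \<partial>lebesgue)"
    by (intro nn_integral_mono slice)
  also have "\<dots> = ennreal (V + N\<^sup>2) * emeasure lebesgue {0..r}" by (rule nn_integral_cmult_indicator) auto
  also have "\<dots> < \<infinity>" by (cases "0 \<le> r") (auto simp: ennreal_mult_less_top)
  finally have "integrable lebesgue (\<lambda>p. indicator ?Q p * u p)"
    using m by (intro integrableI_bounded) auto
  then show ?thesis by (simp add: set_integrable_def)
qed

lemma represents_curve_L1_loc:
  fixes u :: "real \<times> 'a::euclidean_space \<Rightarrow> real"
  assumes u: "represents_curve u U" and N: "\<And>t. t \<ge> 0 \<Longrightarrow> norm (U t) \<le> N"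
  shows "L1_loc closed_half_space u"
  unfolding L1_loc_def
proof (intro allI impI, elim conjE)
  fix K :: "(real \<times> 'a) set" assume K: "compact K" "K \<subseteq> closed_half_space"
  obtain \<rho> where \<rho>: "\<And>p. p \<in> K \<Longrightarrow> norm p \<le> \<rho>"
    using compact_imp_bounded[OF K(1)] bounded_iff by metis
  have "K \<in> sets lebesgue" using lmeasurable_compact[OF K(1)] by (rule fmeasurableD)
  moreover have "K \<subseteq> {0..\<rho>} \<times> cball 0 \<rho>"
  proof
    fix p assume p: "p \<in> K"
    then have "norm (fst p) \<le> \<rho>" "norm (snd p) \<le> \<rho>"
      using \<rho>[OF p] norm_fst_le[of "fst p" "snd p"] norm_snd_le[of "snd p" "fst p"] by simp_all
    then show "p \<in> {0..\<rho>} \<times> cball 0 \<rho>"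
      using K(2) p by (auto simp: closed_half_space_def mem_Times_iff)
  qed
  moreover have "set_integrable lebesgue ({0..\<rho>} \<times> cball 0 \<rho>) u"
    by (rule represents_curve_integrable_box[OF u N])
  ultimately show "set_integrable lebesgue K u" using set_integrable_subset by metis
qed

text \<open>This turns an identity between inner products in \<open>L\<^sup>2\<close>, integrated in \<open>t\<close> alone, into one for
  the space-time integral.\<close>

lemma integral_against_curve:
  fixes u h :: "real \<times> 'a::euclidean_space \<Rightarrow> real"
  assumes u: "represents_curve u U" and N: "\<And>t. t \<ge> 0 \<Longrightarrow> norm (U t) \<le> N"
    and hm: "(\<lambda>p. indicator closed_half_space p * h p) \<in> borel_measurable lebesgue"
    and hb: "AE p in lebesgue. 0 \<le> fst p \<longrightarrow> \<bar>h p\<bar> \<le> C"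
    and h0: "\<And>t x. 0 \<le> t \<Longrightarrow> r \<le> t \<or> R < norm x \<Longrightarrow> h (t, x) = 0"
    and hs: "\<And>t. 0 \<le> t \<Longrightarrow> square_integrable (\<lambda>x. h (t, x))"
    and hi: "((\<lambda>t. inner (U t) (abs_L2 (\<lambda>x. h (t, x)))) has_integral I) {0..r}"
  shows "(LINT p:open_half_space|lebesgue. u p * h p) = I"
proof -
  let ?Q = "{0..r} \<times> cball 0 R :: (real \<times> 'a) set"
  define G where "G p = indicator open_half_space p * (u p * h p)" for p
  define k where "k p = indicator open_half_space p * (indicator closed_half_space p * h p)" for p
  have G_eq: "G p = (indicator ?Q p * u p) * k p" for p
  proof (cases "p \<in> open_half_space")
    case True
    then have p: "0 < fst p" by (auto simp: open_half_space_def)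
    show ?thesis
    proof (cases "p \<in> ?Q")
      case False
      then have "h (fst p, snd p) = 0" using p by (intro h0) (auto simp: mem_Times_iff)
      then show ?thesis using False by (simp add: G_def)
    qed (use p in \<open>auto simp: G_def k_def closed_half_space_def indicator_def\<close>)
  qed (simp add: G_def k_def)
  have "open (open_half_space :: (real \<times> 'a) set)"
    unfolding open_half_space_def by (intro open_Times) auto
  then have open_sets: "open_half_space \<in> sets (lebesgue :: (real \<times> 'a) measure)"
    by (intro sets_completionI_sets) simp
  have km: "k \<in> borel_measurable lebesgue"
    unfolding k_def by (rule borel_measurable_times[OF borel_measurable_indicator[OF open_sets] hm])
  have box: "integrable lebesgue (\<lambda>p. indicator ?Q p * u p)"
    using represents_curve_integrable_box[OF u N, of r R] by (simp add: set_integrable_def)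
  have Gint: "integrable lebesgue G"
  proof (rule Bochner_Integration.integrable_bound)
    show "integrable lebesgue (\<lambda>p. C * (indicator ?Q p * u p))" using box by (rule integrable_mult_right)
    show "G \<in> borel_measurable lebesgue"
      unfolding G_eq[abs_def] using km borel_measurable_integrable[OF box] by (rule borel_measurable_times[rotated])
    show "AE p in lebesgue. norm (G p) \<le> norm (C * (indicator ?Q p * u p))"
      using hb
    proof eventually_elim
      case (elim p)
      have "\<bar>k p\<bar> \<le> \<bar>C\<bar>" using elim by (auto simp: k_def indicator_def open_half_space_def)
      then have "\<bar>indicator ?Q p * u p\<bar> * \<bar>k p\<bar> \<le> \<bar>indicator ?Q p * u p\<bar> * \<bar>C\<bar>"
        by (rule mult_left_mono) simp
      then show ?case unfolding G_eq by (simp add: abs_mult mult_ac)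
    qed
  qed
  let ?\<phi> = "\<lambda>t. LINT x|lebesgue. G (t, x)"
  have pos: "?\<phi> t = inner (U t) (abs_L2 (\<lambda>x. h (t, x)))" if "t > 0" for t
  proof -
    have t: "t \<ge> 0" using that by simp
    have "?\<phi> t = (LINT x|lebesgue. u (t, x) * h (t, x))"
      using that by (simp add: G_def open_half_space_def)
    also have "\<dots> = inner (U t) (abs_L2 (\<lambda>x. h (t, x)))"
      using inner_abs_L2[OF represents_curve_slice(1)[OF u t] hs[OF t]] represents_curve_slice(2)[OF u t] by simp
    finally show ?thesis .
  qed
  have zero: "?\<phi> t = 0" if "t \<notin> {0..r}" for t
  proof -
    have "G (t, x) = 0" for x
      using that h0[of t x] by (cases "0 < t") (auto simp: G_def open_half_space_def)
    then show ?thesis by simp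
  qed
  have "(?\<phi> has_integral I) {0..r}"
    by (rule has_integral_spike_finite[OF _ _ hi, of "{0}"]) (auto simp: pos)
  then have "(?\<phi> has_integral I) UNIV"
    by (rule has_integral_on_superset) (auto simp: zero)
  moreover have "(?\<phi> has_integral (LINT t|lebesgue. ?\<phi> t)) UNIV"
    by (rule has_integral_integral_lebesgue[OF lebesgue_Fubini(1)[OF Gint]])
  ultimately have "(LINT t|lebesgue. ?\<phi> t) = I" by (rule has_integral_unique[rotated])
  then show ?thesis
    using lebesgue_Fubini(2)[OF Gint] by (simp add: set_lebesgue_integral_def G_def)
qed

lemma box_supported_measurable:
  fixes g :: "real \<times> 'a::euclidean_space \<Rightarrow> real"
  assumes "box_supported r R g"
  shows "(\<lambda>p. indicator closed_half_space p * g p) \<in> borel_measurable lebesgue"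
proof (rule measurable_completion)
  have "(\<lambda>p. indicator closed_half_space p *\<^sub>R g p) \<in> borel_measurable borel"
    using assms closed_half_space_closed[where 'a = 'a]
    by (intro borel_measurable_continuous_on_indicator) (auto simp: box_supported_def)
  then show "(\<lambda>p. indicator closed_half_space p * g p) \<in> borel_measurable lborel" by simp
qed

lemma Linf_field_coefficients:
  assumes "Linf_field a"
  obtains K where "\<And>b. b \<in> Basis \<Longrightarrow> bounded_coefficient K (\<lambda>x. inner (a x) b)"
proof -
  obtain C where a: "a \<in> borel_measurable lebesgue" "AE x in lebesgue. norm (a x) \<le> C"
    using assms by (auto simp: Linf_field_def)
  have "bounded_coefficient \<bar>C\<bar> (\<lambda>x. inner (a x) b)" if b: "b \<in> Basis" for b
    unfolding bounded_coefficient_def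
  proof (intro conjI)
    show "(\<lambda>x. inner (a x) b) \<in> borel_measurable lebesgue" using a(1) by simp
    show "AE x in lebesgue. \<bar>inner (a x) b\<bar> \<le> \<bar>C\<bar>"
      using a(2)
    proof eventually_elim
      case (elim x)
      then show ?case using Basis_le_norm[OF b, of "a x"] by simp
    qed
  qed simp
  then show ?thesis using that by blast
qed

theorem generalized_solution_orbit:
  fixes a :: "'a::euclidean_space \<Rightarrow> 'a"
  assumes T: "C0_contraction_semigroup T"
    and dense: "closure (Domain (semigroup_generator T)) = UNIV"
    and adj: "semigroup_generator T \<subseteq> op_adjoint S"
    and a: "Linf_field a" and AS: "A0 a \<subseteq> S"
    and u: "represents_curve u (\<lambda>t. T t u0)"
  shows "generalized_solution a (rep_L2 u0) u"
  unfolding generalized_solution_def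
proof (intro conjI allI impI)
  interpret contraction_semigroup T using T by unfold_locales
  have N: "norm (T t u0) \<le> norm u0" if "t \<ge> 0" for t using that by (rule norm_T)
  show "L1_loc UNIV (rep_L2 u0)"
    unfolding L1_loc_def by (simp add: square_integrable_set_integrable[OF square_integrable_rep])
  show "L1_loc closed_half_space u" by (rule represents_curve_L1_loc[OF u N])
  fix f :: "real \<times> 'a \<Rightarrow> real" assume "Cinf_compact_on closed_half_space f"
  then obtain r R g0 gx where r: "r > 0" and f: "box_supported r R f" and g0: "box_supported r R g0"
    and gx: "\<And>v. box_supported r R (gx v)"
    and dt: "\<And>t x. t > 0 \<Longrightarrow> ((\<lambda>s. f (s, x)) has_real_derivative g0 (t, x)) (at t)"
    and dx: "\<And>t x. t > 0 \<Longrightarrow> ((\<lambda>y. f (t, y)) has_derivative (\<lambda>v. gx v (t, x))) (at x)"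
    using test_function_derivatives[of f thesis] by blast
  obtain K where K: "\<And>b. b \<in> Basis \<Longrightarrow> bounded_coefficient K (\<lambda>x. inner (a x) b)"
    using Linf_field_coefficients[OF a] by metis
  define F where "F t = abs_L2 (\<lambda>x. f (t, x))" for t
  define P where "P t = abs_L2 (\<lambda>x. g0 (t, x))" for t
  define q where "q p = (\<Sum>b\<in>Basis. inner (a (snd p)) b * gx b p)" for p
  define Q where "Q t = abs_L2 (\<lambda>x. q (t, x))" for t
  define h where "h p = g0 p + q p" for p
  have qb_sq: "square_integrable (\<lambda>x. inner (a x) b * gx b (t, x))" if "b \<in> Basis" "t \<ge> 0" for b t
    using slice_square_integrable[OF K gx] that by blast
  have q_sq: "square_integrable (\<lambda>x. q (t, x))" if "t \<ge> 0" for t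
    unfolding q_def snd_conv using qb_sq that by (intro square_integrable_sum) auto
  have g0_sq: "square_integrable (\<lambda>x. g0 (t, x))" if "t \<ge> 0" for t
    by (rule slice_square_integrable_one[OF g0 that])
  have h_sq: "square_integrable (\<lambda>x. h (t, x))" if "t \<ge> 0" for t
    unfolding h_def by (rule square_integrable_add[OF g0_sq[OF that] q_sq[OF that]])
  have h_abs: "abs_L2 (\<lambda>x. h (t, x)) = P t + Q t" if "t \<ge> 0" for t
    unfolding h_def P_def Q_def by (rule abs_L2_add[OF g0_sq[OF that] q_sq[OF that], symmetric])
  have weak: "((\<lambda>t. inner (T t u0) (P t + Q t)) has_integral - inner u0 (F 0)) {0..r}"
  proof (rule weak_formulation[OF dense adj])
    show "r \<ge> 0" using r by simp
    show "continuous_on {0..r} F" unfolding F_def by (rule slice_curve_continuous_one[OF f])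
    show "continuous_on {0..r} P" unfolding P_def by (rule slice_curve_continuous_one[OF g0])
    have "continuous_on {0..r} (\<lambda>t. \<Sum>b\<in>Basis. abs_L2 (\<lambda>x. inner (a x) b * gx b (t, x)))"
      by (intro continuous_on_sum slice_curve_continuous[OF K gx])
    then show "continuous_on {0..r} Q"
    proof (rule continuous_on_eq)
      fix t assume "t \<in> {0..r}"
      then have t: "t \<ge> 0" by simp
      show "(\<Sum>b\<in>Basis. abs_L2 (\<lambda>x. inner (a x) b * gx b (t, x))) = Q t"
        unfolding Q_def q_def snd_conv by (rule abs_L2_sum) (auto intro: qb_sq[OF _ t])
    qed
    show "F r = 0"
    proof -
      have "f (r, x) = 0" for x using r by (intro box_supported_0[OF f]) auto
      then show ?thesis by (simp add: F_def zero_L2.abs_eq zero_L2_def)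
    qed
    fix t assume t: "t \<in> {0<..<r}"
    show "(F has_vector_derivative P t) (at t)"
      unfolding F_def P_def by (rule slice_curve_derivative[OF f g0 dt t])
    show "(F t, Q t) \<in> S"
      unfolding F_def Q_def q_def snd_conv
      using AS slice_in_A0[OF f gx dx, of t a] t by auto
  qed
  obtain C0 where C0: "\<And>t x. 0 \<le> t \<Longrightarrow> \<bar>g0 (t, x)\<bar> \<le> C0" using box_supported_bounded[OF g0] by metis
  obtain C where C: "\<And>v t x. 0 \<le> t \<Longrightarrow> \<bar>gx v (t, x)\<bar> \<le> C v" using box_supported_bounded[OF gx] by metis
  have "(LINT p:open_half_space|lebesgue. u p * h p) = - inner u0 (F 0)"
  proof (rule integral_against_curve[OF u N])
    have "(\<lambda>p. indicator closed_half_space p * g0 p +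
        (\<Sum>b\<in>Basis. inner (a (snd p)) b * (indicator closed_half_space p * gx b p))) \<in> borel_measurable lebesgue"
    proof (intro borel_measurable_add borel_measurable_sum box_supported_measurable[OF g0]
        borel_measurable_times[OF _ box_supported_measurable[OF gx]])
      fix b :: 'a assume "b \<in> Basis"
      then have "(\<lambda>x. inner (a x) b) \<in> borel_measurable lebesgue"
        using K by (simp add: bounded_coefficient_def)
      then show "(\<lambda>p :: real \<times> 'a. inner (a (snd p)) b) \<in> borel_measurable lebesgue"
        by (rule measurable_compose[OF measurable_snd_lebesgue])
    qed
    then show "(\<lambda>p. indicator closed_half_space p * h p) \<in> borel_measurable lebesgue"
      by (simp add: h_def q_def distrib_left sum_distrib_left mult_ac)
    have "AE x in lebesgue. \<forall>b\<in>Basis. \<bar>inner (a x) b\<bar> \<le> K"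
      using K by (intro eventually_ball_finite) (auto simp: bounded_coefficient_def)
    then have "AE p in lebesgue. \<forall>b\<in>Basis. \<bar>inner (a (snd (p :: real \<times> 'a))) b\<bar> \<le> K"
      by (rule AE_snd_lebesgue)
    then show "AE p in lebesgue. 0 \<le> fst p \<longrightarrow> \<bar>h p\<bar> \<le> C0 + (\<Sum>b\<in>Basis. K * C b)"
    proof eventually_elim
      case (elim p)
      show ?case
      proof
        assume p: "0 \<le> fst p"
        have "\<bar>q p\<bar> \<le> (\<Sum>b\<in>Basis. \<bar>inner (a (snd p)) b * gx b p\<bar>)" unfolding q_def by (rule sum_abs)
        also have "\<dots> \<le> (\<Sum>b\<in>Basis. K * C b)"
        proof (rule sum_mono)
          fix b :: 'a assume b: "b \<in> Basis"
          have "0 \<le> K" using K[OF b] by (simp add: bounded_coefficient_def)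
          then show "\<bar>inner (a (snd p)) b * gx b p\<bar> \<le> K * C b"
            unfolding abs_mult using elim b C[OF p, of b "snd p"] by (intro mult_mono) auto
        qed
        finally show "\<bar>h p\<bar> \<le> C0 + (\<Sum>b\<in>Basis. K * C b)"
          using C0[OF p, of "snd p"] by (simp add: h_def)
      qed
    qed
    show "h (t, x) = 0" if "0 \<le> t" "r \<le> t \<or> R < norm x" for t x
      using box_supported_0[OF g0 that] box_supported_0[OF gx that] by (simp add: h_def q_def)
    show "square_integrable (\<lambda>x. h (t, x))" if "0 \<le> t" for t by (rule h_sq[OF that])
    show "((\<lambda>t. inner (T t u0) (abs_L2 (\<lambda>x. h (t, x)))) has_integral - inner u0 (F 0)) {0..r}"
      by (rule has_integral_eq[OF _ weak]) (simp add: h_abs)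
  qed
  moreover have "(LINT (t, x):open_half_space|lebesgue.
      u (t, x) * deriv (\<lambda>s. f (s, x)) t + u (t, x) * inner (a x) (grad (\<lambda>y. f (t, y)) x))
      = (LINT p:open_half_space|lebesgue. u p * h p)"
    unfolding set_lebesgue_integral_def
  proof (rule Bochner_Integration.integral_cong[OF refl])
    fix p :: "real \<times> 'a"
    obtain t x where p: "p = (t, x)" by (cases p)
    show "indicat_real open_half_space p *\<^sub>R (case p of (t, x) \<Rightarrow>
        u (t, x) * deriv (\<lambda>s. f (s, x)) t + u (t, x) * inner (a x) (grad (\<lambda>y. f (t, y)) x))
        = indicat_real open_half_space p *\<^sub>R (u p * h p)"
    proof (cases "t > 0")
      case True
      then show ?thesis
        by (simp add: p DERIV_imp_deriv[OF dt] grad_eq[OF dx] h_def q_def distrib_left)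
    qed (simp add: p open_half_space_def)
  qed
  moreover have "inner u0 (F 0) = (LINT x|lebesgue. rep_L2 u0 x * f (0, x))"
    using inner_abs_L2[OF square_integrable_rep[of u0] slice_square_integrable_one[OF f order.refl]]
    by (simp add: abs_rep F_def)
  ultimately show "(LINT (t, x):open_half_space|lebesgue.
      u (t, x) * deriv (\<lambda>s. f (s, x)) t + u (t, x) * inner (a x) (grad (\<lambda>y. f (t, y)) x))
      + (LINT x|lebesgue. rep_L2 u0 x * f (0, x)) = 0"
    by simp
qed

theorem theorem6p1:
  fixes a :: "real ^ 'n \<Rightarrow> real ^ 'n"
    and A At :: "(real ^ 'n) L2 op"
  assumes "Linf_field a"
    and "divergence_free a"
    and "A = closure (A0 a)"
    and "maximal_skew_symmetric At"
    and "A \<subseteq> At"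
  shows "(deficiency_plus At = 0 \<or> deficiency_minus At = 0) \<and>
    (\<forall>B. (deficiency_plus At = 0 \<and> B = op_uminus At) \<or>
          (deficiency_minus At = 0 \<and> B = op_adjoint At) \<longrightarrow>
      (\<exists>T. C0_contraction_semigroup T \<and> semigroup_generator T = B \<and>
        (\<forall>u0. (\<exists>u. represents_curve u (\<lambda>t. T t u0)) \<and>
              (\<forall>u. represents_curve u (\<lambda>t. T t u0) \<longrightarrow>
                 generalized_solution a (rep_L2 u0) u)) \<and>
        (deficiency_plus At = 0 \<longrightarrow> (\<forall>t\<ge>0. \<forall>u. norm (T t u) = norm u))))"
proof (intro conjI allI impI)
  have skew: "skew_symmetric At" using assms(4) by (simp add: maximal_skew_symmetric_def)
  have "codim (Range (op_add Id At)) = 0 \<or> codim (Range (op_add Id (op_uminus At))) = 0"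
    using maximal_skew_symmetric_range[OF assms(4)] codim_eq_0_iff[OF subspace_UNIV] by auto
  then show "deficiency_plus At = 0 \<or> deficiency_minus At = 0"
    by (simp add: deficiency_plus_def deficiency_minus_def)
  have A0: "A0 a \<subseteq> At" using closure_subset[of "A0 a"] assms(3,5) by blast
  fix B
  assume B: "(deficiency_plus At = 0 \<and> B = op_uminus At) \<or> (deficiency_minus At = 0 \<and> B = op_adjoint At)"
  interpret B: m_dissipative_op B by unfold_locales (rule skew_symmetric_generator(1)[OF skew B])
  interpret T: contraction_semigroup B.semigroup
    by unfold_locales (rule B.C0_contraction_semigroup_semigroup)
  show "\<exists>T. C0_contraction_semigroup T \<and> semigroup_generator T = B \<and>
        (\<forall>u0. (\<exists>u. represents_curve u (\<lambda>t. T t u0)) \<and>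
              (\<forall>u. represents_curve u (\<lambda>t. T t u0) \<longrightarrow>
                 generalized_solution a (rep_L2 u0) u)) \<and>
        (deficiency_plus At = 0 \<longrightarrow> (\<forall>t\<ge>0. \<forall>u. norm (T t u) = norm u))"
  proof (intro exI[of _ B.semigroup] conjI allI impI)
    show "C0_contraction_semigroup B.semigroup" by (rule B.C0_contraction_semigroup_semigroup)
    show gen: "semigroup_generator B.semigroup = B" by (rule B.semigroup_generator_semigroup)
    fix u0
    show "\<exists>u. represents_curve u (\<lambda>t. B.semigroup t u0)"
      by (rule represents_curve_exists[OF T.orbit_uniformly_continuous])
    show "generalized_solution a (rep_L2 u0) u" if "represents_curve u (\<lambda>t. B.semigroup t u0)" for u
      using that skew_symmetric_generator(2)[OF skew B] B.domain_dense
      by (intro generalized_solution_orbit[OF T.C0 _ _ assms(1) A0]) (simp_all add: gen)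
  next
    fix t :: real and u
    assume "deficiency_plus At = 0" "0 \<le> t"
    then show "norm (B.semigroup t u) = norm u"
      using skew_symmetric_generator(3)[OF skew B] by (intro B.semigroup_isometric) blast+
  qed
qed

end
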